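(* Let $S=(s_j)_{j=1}^\infty$ be a bounded sequence of distinct points from the half-plane $\mathbb{C}_{1/2}=\{s=\sigma+\mathrm{i}t:\ \sigma>1/2\}$. Then $S$ is an interpolating sequence for $\mathscr{H}$ if and only if $S$ is an interpolating sequence for $H^2(\mathbb{C}_{1/2})$.
   Context: Write $s=\sigma+\mathrm{i}t$ for a complex variable with real part $\sigma$ and imaginary part $t$. The space $\mathscr{H}$ is the Hilbert space of all Dirichlet series $f(s)=\sum_{n=1}^\infty a_n n^{-s}$ with complex coefficients such that $\|f\|_{\mathscr{H}}^2=\sum_{n=1}^\infty |a_n|^2<+\infty$. Its elements are analytic functions in $\mathbb{C}_{1/2}$, and point evaluation at each point of $\mathbb{C}_{1/2}$ is bounded on $\mathscr{H}$; its reproducing kernel at $w\in\mathbb{C}_{1/2}$ is $k^{\mathscr{H}}_w(s)=\zeta(s+\bar w)$, where $\zeta$ is the Riemann zeta-function. The space $H^2(\mathbb{C}_{1/2})$ is the Hardy space of all functions $f$ analytic in $\mathbb{C}_{1/2}$ with $\|f\|_{H^2}^2=\sup_{\sigma>1/2}\frac{1}{2\pi}\int_{-\infty}^\infty |f(\sigma+\mathrm{i}t)|^2\,\mathrm{d}t<+\infty$. Its reproducing kernel at $w\in\mathbb{C}_{1/2}$ is $k^{H^2}_w(s)=\frac{1}{s+\bar w-1}$. Interpolating sequences: Let $H$ be a Hilbert space of functions on a set $\Omega$ such that point evaluation $f\mapsto f(w)$ is bounded on $H$ for each $w\in\Omega$, and let $k^H_w$ denote the reproducing kernel of $H$ at $w$.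 A sequence $(s_j)_{j=1}^\infty$ of distinct points of $\Omega$ is called an interpolating sequence for $H$ if, for every complex sequence $(a_j)_{j=1}^\infty$ such that $(a_j\|k^H_{s_j}\|_H^{-1})_{j=1}^\infty\in\ell^2$, there is a function $f\in H$ with $f(s_j)=a_j$ for all $j$. *)

theory Defs
  imports "HOL-Complex_Analysis.Complex_Analysis"
begin

text \<open>
  A Hilbert space of complex functions on a set \<open>\<Omega>\<close> is given by its carrier \<open>H\<close> and its norm \<open>N\<close>.
  Functions on \<open>\<Omega>\<close> are represented by total functions that vanish outside \<open>\<Omega>\<close>, so that carriers
  are closed under the pointwise operations and equality of functions on \<open>\<Omega>\<close> is equality in HOL.
\<close>

text \<open>The inner product inducing the norm \<open>N\<close>, by polarization; it is linear in the first argument.\<close>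

definition norm_inner ::
    "(('a \<Rightarrow> complex) \<Rightarrow> real) \<Rightarrow> ('a \<Rightarrow> complex) \<Rightarrow> ('a \<Rightarrow> complex) \<Rightarrow> complex" where
  "norm_inner N f g =
     (\<Sum>k<4. \<i> ^ k * complex_of_real ((N (\<lambda>x. f x + \<i> ^ k * g x))\<^sup>2)) / 4"

definition reproducing_kernel ::
    "('a \<Rightarrow> complex) set \<Rightarrow> (('a \<Rightarrow> complex) \<Rightarrow> real) \<Rightarrow> 'a \<Rightarrow> ('a \<Rightarrow> complex)" where
  "reproducing_kernel H N w = (THE k. k \<in> H \<and> (\<forall>f\<in>H. f w = norm_inner N f k))"

definition interpolating_sequence ::
    "'a set \<Rightarrow> ('a \<Rightarrow> complex) set \<Rightarrow> (('a \<Rightarrow> complex) \<Rightarrow> real) \<Rightarrow> (nat \<Rightarrow> 'a) \<Rightarrow> bool" where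
  "interpolating_sequence \<Omega> H N s \<longleftrightarrow>
     inj s \<and> range s \<subseteq> \<Omega> \<and>
     (\<forall>a :: nat \<Rightarrow> complex.
        summable (\<lambda>j. (cmod (a j) / N (reproducing_kernel H N (s j)))\<^sup>2) \<longrightarrow>
        (\<exists>f\<in>H. \<forall>j. f (s j) = a j))"

definition half_plane :: "complex set" where
  "half_plane = {s. Re s > 1 / 2}"

text \<open>
  Coefficient sequences are indexed from 0: \<open>a n\<close> is the coefficient of \<open>(n + 1)\<^sup>-\<^sup>s\<close>.
  The coefficients of a Dirichlet series are determined by its sum, which justifies the
  description operator in \<open>dirichlet_coeffs\<close>.
\<close>

definition has_dirichlet_coeffs :: "(complex \<Rightarrow> complex) \<Rightarrow> (nat \<Rightarrow> complex) \<Rightarrow> bool" where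
  "has_dirichlet_coeffs f a \<longleftrightarrow>
     summable (\<lambda>n. (cmod (a n))\<^sup>2) \<and>
     (\<forall>s\<in>half_plane. (\<lambda>n. a n * of_nat (Suc n) powr (- s)) sums f s)"

definition dirichlet_space :: "(complex \<Rightarrow> complex) set" where
  "dirichlet_space = {f. (\<exists>a. has_dirichlet_coeffs f a) \<and> (\<forall>s. s \<notin> half_plane \<longrightarrow> f s = 0)}"

definition dirichlet_coeffs :: "(complex \<Rightarrow> complex) \<Rightarrow> nat \<Rightarrow> complex" where
  "dirichlet_coeffs f = (THE a. has_dirichlet_coeffs f a)"

definition dirichlet_norm :: "(complex \<Rightarrow> complex) \<Rightarrow> real" where
  "dirichlet_norm f = sqrt (\<Sum>n. (cmod (dirichlet_coeffs f n))\<^sup>2)"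

definition hardy_sq_norm :: "(complex \<Rightarrow> complex) \<Rightarrow> ennreal" where
  "hardy_sq_norm f =
     (SUP \<sigma>\<in>{1/2<..}. ennreal (1 / (2 * pi)) *
        (\<integral>\<^sup>+ t. ennreal ((cmod (f (Complex \<sigma> t)))\<^sup>2) \<partial>lborel))"

definition hardy_space :: "(complex \<Rightarrow> complex) set" where
  "hardy_space = {f. f holomorphic_on half_plane \<and> hardy_sq_norm f < \<infinity> \<and>
                     (\<forall>s. s \<notin> half_plane \<longrightarrow> f s = 0)}"

definition hardy_norm :: "(complex \<Rightarrow> complex) \<Rightarrow> real" where
  "hardy_norm f = sqrt (enn2real (hardy_sq_norm f))"

end

theory Submission
  imports Defs "HOL-Probability.Sinc_Integral"
begin

text \<open>
  Write \<open>d\<^sub>j = 2 Re s\<^sub>j - 1\<close>.  The kernels have squared norms \<open>\<zeta>(2 Re w)\<close> and \<open>1 / (2 Re w - 1)\<close>, which are comparable on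
  bounded sets (\<open>dirichlet_kernel_norm\<close>, \<open>hardy_kernel_norm\<close>).  So for a bounded sequence both interpolation
  problems ask for the same data, the sequences \<open>a\<close> with \<open>\<Sum> d\<^sub>j |a\<^sub>j|\<^sup>2 < \<infinity>\<close>.

  From Dirichlet series to the Hardy space: if \<open>f\<close> is a Dirichlet series with square-summable coefficients,
  then \<open>f(s) / (s + 1)\<close> lies in the Hardy space (\<open>dirichlet_embedding\<close>).  By Cauchy's formula the line inner products
  of \<open>m\<^sup>-\<^sup>s / (s + 1)\<close> and \<open>n\<^sup>-\<^sup>s / (s + 1)\<close> are at most \<open>2\<pi> min(m, n) / max(m, n)\<^sup>2\<close>, a matrix with bounded row sums.
  Since the points \<open>s\<^sub>j\<close> are bounded, multiplying the data by \<open>s\<^sub>j + 1\<close> costs only a constant.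

  From the Hardy space to Dirichlet series: put \<open>V\<^sub>c(x) = \<Sum> c\<^sub>j d\<^sub>j\<^bsup>1/2\<^esup> x\<^bsup>-cnj s\<^sub>j\<^esup>\<close> for a finite sequence \<open>c\<close>.  Interpolation for the
  Hardy space, together with uniform boundedness, gives a lower bound \<open>\<delta> \<Sum> |c\<^sub>j|\<^sup>2 \<le> \<integral>\<^sub>1\<^sup>\<infinity> |V\<^sub>c|\<^sup>2\<close> (\<open>hardy_lower_bound\<close>,
  \<open>hardy_norm_integral\<close>), while interpolation for Dirichlet series follows from the corresponding lower bound for
  \<open>\<Sum>\<^sub>n |V\<^sub>c(n)|\<^sup>2\<close> (\<open>l2_interpolation\<close>).  The passage from the integral to the sum is \<open>dirichlet_lower_bound\<close>.  If it failed, there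
  would be unit vectors \<open>c\<^sup>m\<close> with \<open>\<Sum>\<^sub>n |V\<^sub>m(n)|\<^sup>2 \<rightarrow> 0\<close>, and after passing to a subsequence a weak limit \<open>c\<close>.  The Hardy
  function that is 1 at \<open>s\<^sub>0\<close> and 0 at the other points yields the Blaschke condition \<open>\<Sum> d\<^sub>j < \<infinity>\<close> (\<open>blaschke_condition\<close>),
  so \<open>V\<^sub>m \<rightarrow> V\<^sub>c\<close> pointwise and \<open>V\<^sub>c(n) = 0\<close> for all integers \<open>n\<close>.  But \<open>V\<^sub>c(e\<^sup>z)\<close> is an entire function of exponential
  type, and such a function cannot vanish at all the points \<open>ln n\<close> without vanishing identically
  (\<open>exponential_type_zero_at_logs\<close>).  Hence \<open>V\<^sub>m \<rightarrow> 0\<close> pointwise.  As \<open>V\<^sub>m(x) - V\<^sub>m(\<lfloor>x\<rfloor>) = O(1/x)\<close> uniformly in \<open>m\<close>,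
  dominated convergence gives \<open>\<integral> |V\<^sub>m|\<^sup>2 \<rightarrow> 0\<close>, which contradicts the lower bound.

  The norm of the Hardy space is a supremum over vertical lines.  Poisson's formula shows that the line integrals
  decrease to the right, so the supremum is a limit and the norm comes from an inner product; Cauchy's formula on
  the lines identifies the kernel.
\<close>

section \<open>Cauchy's formula on vertical lines\<close>

lemma line_measurable [measurable]:
  assumes "f holomorphic_on S" "\<And>t. Complex \<sigma> t \<in> S"
  shows "(\<lambda>t. f (Complex \<sigma> t)) \<in> borel_measurable lborel"
proof -
  have "continuous_on UNIV (\<lambda>t. f (Complex \<sigma> t))"
    by (rule continuous_on_compose2[OF holomorphic_on_imp_continuous_on[OF assms(1)]])
      (use assms(2) in \<open>auto simp: Complex_eq intro!: continuous_intros\<close>)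
  then show ?thesis
    by (simp add: borel_measurable_continuous_onI)
qed

text \<open>
  Used to dominate the Cauchy kernel on a vertical line by the integrable function \<open>1 / (1 + t\<^sup>2)\<close>.
\<close>

lemma norm_line_ge:
  fixes w :: complex
  assumes "\<sigma> < Re w"
  shows "\<exists>K>0. \<forall>t. 1 + t\<^sup>2 \<le> K * (cmod (w - Complex \<sigma> t))\<^sup>2"
proof -
  define x where "x = Re w - \<sigma>"
  have x: "x > 0" using assms by (simp add: x_def)
  let ?K = "1 / x\<^sup>2 + 2 * (1 + (Im w)\<^sup>2 / x\<^sup>2)"
  have "1 + t\<^sup>2 \<le> ?K * (cmod (w - Complex \<sigma> t))\<^sup>2" for t
  proof -
    let ?N = "(cmod (w - Complex \<sigma> t))\<^sup>2"
    have N: "?N = x\<^sup>2 + (Im w - t)\<^sup>2"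
      by (simp add: cmod_power2 x_def)
    have 1: "1 \<le> ?N / x\<^sup>2" "?N / x\<^sup>2 \<ge> 0"
      using x by (simp_all add: N)
    have 2: "(t - Im w)\<^sup>2 \<le> ?N"
      by (simp add: N power2_commute)
    have "t\<^sup>2 \<le> 2 * (t - Im w)\<^sup>2 + 2 * (Im w)\<^sup>2"
      using sum_squares_bound[of "t - Im w" "Im w"]
      by (smt (verit, best) four_x_squared power2_diff power2_sum zero_le_power2 sum_squares_bound)
    also have "(Im w)\<^sup>2 \<le> (Im w)\<^sup>2 * (?N / x\<^sup>2)"
      using mult_left_mono[OF 1(1), of "(Im w)\<^sup>2"] by simp
    finally have "t\<^sup>2 \<le> 2 * ?N + 2 * ((Im w)\<^sup>2 * (?N / x\<^sup>2))"
      using 2 by linarith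
    with 1 show ?thesis by (simp add: algebra_simps)
  qed
  moreover have "?K > 0" using x by (intro add_pos_nonneg) auto
  ultimately show ?thesis by blast
qed

lemma integrable_inverse_line_sq:
  assumes "\<sigma> < Re w"
  shows "integrable lborel (\<lambda>t. (cmod (1 / (w - Complex \<sigma> t)))\<^sup>2)"
proof -
  obtain K where K: "K > 0" "\<And>t. 1 + t\<^sup>2 \<le> K * (cmod (w - Complex \<sigma> t))\<^sup>2"
    using norm_line_ge[OF assms] by blast
  have "integrable lborel (\<lambda>t::real. inverse (1 + t\<^sup>2))"
    using integrable_inverse_1_plus_square by (simp add: set_integrable_def)
  then have "integrable lborel (\<lambda>t::real. K * inverse (1 + t\<^sup>2))" by simp
  then show ?thesis
  proof (rule Bochner_Integration.integrable_bound)
    show "(\<lambda>t. (cmod (1 / (w - Complex \<sigma> t)))\<^sup>2) \<in> borel_measurable lborel"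
      by (simp add: Complex_eq)
    have "(cmod (1 / (w - Complex \<sigma> t)))\<^sup>2 \<le> K * inverse (1 + t\<^sup>2)" for t
    proof -
      have "w - Complex \<sigma> t \<noteq> 0" using assms by (auto simp: complex_eq_iff)
      then have "0 < (cmod (w - Complex \<sigma> t))\<^sup>2" by simp
      moreover have "0 < 1 + t\<^sup>2" by (simp add: add_pos_nonneg)
      ultimately show ?thesis using K(2)[of t]
        by (simp add: norm_divide power_divide field_simps)
    qed
    then show "AE t in lborel. norm ((cmod (1 / (w - Complex \<sigma> t)))\<^sup>2) \<le> norm (K * inverse (1 + t\<^sup>2))"
      using K(1) by (auto simp: abs_of_pos)
  qed
qed

lemma integrable_mult_of_squares:
  fixes f g :: "real \<Rightarrow> complex"
  assumes "integrable M (\<lambda>t. (cmod (f t))\<^sup>2)" "integrable M (\<lambda>t. (cmod (g t))\<^sup>2)"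
    and [measurable]: "f \<in> borel_measurable M" "g \<in> borel_measurable M"
  shows "integrable M (\<lambda>t. f t * g t)"
proof (rule Bochner_Integration.integrable_bound)
  show "integrable M (\<lambda>t. (cmod (f t))\<^sup>2 + (cmod (g t))\<^sup>2)"
    using assms by simp
  show "AE t in M. cmod (f t * g t) \<le> norm ((cmod (f t))\<^sup>2 + (cmod (g t))\<^sup>2)"
  proof (rule AE_I2)
    fix t
    have "2 * (cmod (f t) * cmod (g t)) \<le> (cmod (f t))\<^sup>2 + (cmod (g t))\<^sup>2"
      using sum_squares_bound[of "cmod (f t)" "cmod (g t)"] by simp
    moreover have "0 \<le> cmod (f t) * cmod (g t)" by simp
    ultimately show "cmod (f t * g t) \<le> norm ((cmod (f t))\<^sup>2 + (cmod (g t))\<^sup>2)"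
      unfolding norm_mult real_norm_def by linarith
  qed
qed simp

text \<open>
  Cauchy's formula on the squares with left side on the line \<open>Re z = \<sigma>\<close>, as their size grows.  The decay of \<open>g\<close>
  is exactly what makes the crude length-times-maximum estimate of the other three sides tend to 0.
\<close>

lemma cauchy_line_decay:
  fixes g :: "complex \<Rightarrow> complex"
  assumes hol: "g holomorphic_on {z. \<tau> < Re z}"
    and \<tau>: "\<tau> < \<sigma>" "\<sigma> < Re w" "0 < \<sigma>"
    and decay: "\<And>z. \<sigma> \<le> Re z \<Longrightarrow> cmod (g z) * (1 + cmod z) \<le> C"
  shows "integrable lborel (\<lambda>t. g (Complex \<sigma> t) / (w - Complex \<sigma> t))"
    and "(\<integral>t. g (Complex \<sigma> t) / (w - Complex \<sigma> t) \<partial>lborel) = 2 * pi * g w"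
proof -
  let ?q = "\<lambda>t. g (Complex \<sigma> t) / (w - Complex \<sigma> t)"
  have C: "C \<ge> 0" using decay[of \<sigma>] by (smt (verit) Re_complex_of_real mult_nonneg_nonneg norm_ge_zero)
  have gb: "cmod (g z) \<le> C / (1 + cmod z)" if "\<sigma> \<le> Re z" for z
    using decay[OF that] by (simp add: pos_le_divide_eq add_pos_nonneg)
  have mg[measurable]: "(\<lambda>t. g (Complex \<sigma> t)) \<in> borel_measurable lborel"
    by (rule line_measurable[OF hol]) (use \<tau> in auto)
  have mw[measurable]: "(\<lambda>t. 1 / (w - Complex \<sigma> t)) \<in> borel_measurable lborel"
    by (simp add: Complex_eq)
  have ig: "integrable lborel (\<lambda>t. (cmod (g (Complex \<sigma> t)))\<^sup>2)"
  proof (rule Bochner_Integration.integrable_bound)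
    show "integrable lborel (\<lambda>t::real. C\<^sup>2 * inverse (1 + t\<^sup>2))"
      using integrable_inverse_1_plus_square by (simp add: set_integrable_def)
    have "(cmod (g (Complex \<sigma> t)))\<^sup>2 \<le> C\<^sup>2 * inverse (1 + t\<^sup>2)" for t
    proof -
      let ?z = "Complex \<sigma> t"
      have "\<bar>t\<bar> \<le> cmod ?z" using abs_Im_le_cmod[of ?z] by simp
      then have "t\<^sup>2 \<le> (cmod ?z)\<^sup>2" by (simp add: abs_le_square_iff[symmetric])
      then have 1: "1 + t\<^sup>2 \<le> (1 + cmod ?z)\<^sup>2"
        using norm_ge_zero[of ?z] by (simp only: power2_sum one_power2 mult_1_right)
      have "(cmod (g ?z))\<^sup>2 \<le> (C / (1 + cmod ?z))\<^sup>2"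
        by (rule power_mono) (use gb[of ?z] in auto)
      also have "\<dots> = C\<^sup>2 * inverse ((1 + cmod ?z)\<^sup>2)"
        by (simp add: power_mult_distrib power_inverse divide_inverse)
      also have "\<dots> \<le> C\<^sup>2 * inverse (1 + t\<^sup>2)"
        using 1 by (intro mult_left_mono le_imp_inverse_le) (auto simp: add_pos_nonneg)
      finally show ?thesis .
    qed
    then show "AE t in lborel. norm ((cmod (g (Complex \<sigma> t)))\<^sup>2) \<le> norm (C\<^sup>2 * inverse (1 + t\<^sup>2))"
      by (auto simp: abs_mult)
  qed simp
  show int: "integrable lborel (\<lambda>t. ?q t)"
    using integrable_mult_of_squares[OF ig integrable_inverse_line_sq[OF \<tau>(2)]] by simp
  define h where "h z = g z / (z - w)" for z
  define S where "S = {z. \<tau> < Re z}"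
  have S: "convex S" "open S"
    by (auto simp: S_def convex_halfspace_Re_gt open_halfspace_Re_gt)
  define n0 where "n0 = 2 * cmod w + 2"
  have hb: "cmod (h z) \<le> 2 * C / r\<^sup>2"
    if "\<sigma> \<le> Re z" "r \<le> cmod z" "r > n0" for z r
  proof -
    have r: "r > 0" using that(3) by (smt (verit) n0_def norm_ge_zero)
    have "cmod z - cmod w \<le> cmod (z - w)" by (rule norm_triangle_ineq2)
    then have 1: "r / 2 \<le> cmod (z - w)" using that(2,3) unfolding n0_def by linarith
    have "cmod (g z) \<le> C / (1 + cmod z)" by (rule gb[OF that(1)])
    also have "\<dots> \<le> C / r" using that r C by (intro divide_left_mono) (auto intro!: mult_pos_pos add_pos_nonneg)
    finally have "cmod (h z) \<le> (C / r) / (r / 2)"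
      unfolding h_def norm_divide using 1 r C by (intro frac_le) auto
    then show ?thesis by (simp add: power2_eq_square field_simps)
  qed
  have main: "cmod (2 * pi * \<i> * g w - \<i> * (\<integral>t. indicator {-r..r} t *\<^sub>R (?q t) \<partial>lborel))
        \<le> 12 * C / r" if r: "r > n0" "r > \<sigma>" "r > Re w" "r > \<bar>Im w\<bar>" for r
  proof -
    define a1 a2 a3 a4 where "a1 = Complex \<sigma> (-r)" and "a2 = Complex r (-r)"
      and "a3 = Complex r r" and "a4 = Complex \<sigma> r"
    have wbox: "w \<in> box a1 a3"
      using r \<tau> by (auto simp: in_box_complex_iff a1_def a3_def)
    have r0: "r > 0" using r(4) by linarith
    have cb: "cbox a1 a3 \<subseteq> S"
      using \<tau> by (auto simp: S_def in_cbox_complex_iff a1_def)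
    have pim: "path_image (rectpath a1 a3) = cbox a1 a3 - box a1 a3"
      by (rule path_image_rectpath_cbox_minus_box) (use r r0 in \<open>auto simp: a1_def a3_def\<close>)
    have pi: "path_image (rectpath a1 a3) \<subseteq> S - {w}"
      using pim cb wbox by blast
    have "(h has_contour_integral (2 * pi * \<i> * winding_number (rectpath a1 a3) w * g w)) (rectpath a1 a3)"
      unfolding h_def
      by (rule Cauchy_integral_formula_convex_simple[OF S(1) _ _ _ pi])
        (use hol \<tau> S(2) in \<open>auto simp: S_def interior_open\<close>)
    then have "(h has_contour_integral (2 * pi * \<i> * g w)) (rectpath a1 a3)"
      by (simp add: winding_number_rectpath[OF wbox])
    then have ci: "(h has_contour_integral (2 * pi * \<i> * g w))
        (linepath a1 a2 +++ linepath a2 a3 +++ linepath a3 a4 +++ linepath a4 a1)"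
      by (simp add: rectpath_def Let_def a1_def a2_def a3_def a4_def)
    have sub: "path_image (linepath a1 a2) \<subseteq> S - {w}" "path_image (linepath a2 a3) \<subseteq> S - {w}"
      "path_image (linepath a3 a4) \<subseteq> S - {w}" "path_image (linepath a4 a1) \<subseteq> S - {w}"
      using pi unfolding rectpath_def Let_def
      by (simp_all add: a1_def a2_def a3_def a4_def path_image_join)
    have hh: "h holomorphic_on (S - {w})" unfolding h_def
      by (intro holomorphic_intros holomorphic_on_subset[OF hol]) (auto simp: S_def)
    have I: "h contour_integrable_on (linepath a b)" if "path_image (linepath a b) \<subseteq> S - {w}" for a b
      using that hh S(2) by (intro contour_integrable_holomorphic_simple[of _ "S - {w}"]) auto
    have *: "contour_integral (linepath a1 a2) h + (contour_integral (linepath a2 a3) h +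
        (contour_integral (linepath a3 a4) h + contour_integral (linepath a4 a1) h)) = 2 * pi * \<i> * g w"
      using contour_integral_unique[OF ci] I[OF sub(1)] I[OF sub(2)] I[OF sub(3)] I[OF sub(4)]
      by (subst (asm) contour_integral_join, auto intro!: contour_integrable_joinI)+
    have B0: "0 \<le> 2 * C / r\<^sup>2" using C by simp
    have b1: "cmod (contour_integral (linepath a1 a2) h) \<le> 2 * C / r\<^sup>2 * cmod (a2 - a1)"
    proof (rule contour_integral_bound_linepath[OF I[OF sub(1)] B0])
      fix z assume "z \<in> closed_segment a1 a2"
      then have "\<sigma> \<le> Re z" "Im z = -r"
        using r by (auto simp: a1_def a2_def closed_segment_same_Im closed_segment_eq_real_ivl)
      with abs_Im_le_cmod[of z] show "cmod (h z) \<le> 2 * C / r\<^sup>2"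
        using r(1) r0 by (intro hb) auto
    qed
    have b2: "cmod (contour_integral (linepath a2 a3) h) \<le> 2 * C / r\<^sup>2 * cmod (a3 - a2)"
    proof (rule contour_integral_bound_linepath[OF I[OF sub(2)] B0])
      fix z assume "z \<in> closed_segment a2 a3"
      then have "Re z = r" by (auto simp: a2_def a3_def closed_segment_same_Re)
      with abs_Re_le_cmod[of z] show "cmod (h z) \<le> 2 * C / r\<^sup>2"
        using r r0 by (intro hb) auto
    qed
    have b3: "cmod (contour_integral (linepath a3 a4) h) \<le> 2 * C / r\<^sup>2 * cmod (a4 - a3)"
    proof (rule contour_integral_bound_linepath[OF I[OF sub(3)] B0])
      fix z assume "z \<in> closed_segment a3 a4"
      then have "\<sigma> \<le> Re z" "Im z = r"
        using r by (auto simp: a3_def a4_def closed_segment_same_Im closed_segment_eq_real_ivl)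
      with abs_Im_le_cmod[of z] show "cmod (h z) \<le> 2 * C / r\<^sup>2"
        using r(1) r0 by (intro hb) auto
    qed
    have l1: "cmod (a2 - a1) \<le> 2 * r" "cmod (a3 - a2) \<le> 2 * r" "cmod (a4 - a3) \<le> 2 * r"
      using r r0 \<tau> cmod_eq_Re[of "a2 - a1"] cmod_eq_Im[of "a3 - a2"] cmod_eq_Re[of "a4 - a3"]
      by (auto simp: a1_def a2_def a3_def a4_def)
    have bb: "x \<le> 4 * C / r" if "x \<le> 2 * C / r\<^sup>2 * y" "y \<le> 2 * r" for x y
    proof -
      have "2 * C / r\<^sup>2 * y \<le> 2 * C / r\<^sup>2 * (2 * r)" by (rule mult_left_mono[OF that(2) B0])
      also have "\<dots> = 4 * C / r" using r0 by (simp add: power2_eq_square field_simps)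
      finally show ?thesis using that(1) by simp
    qed
    have left: "contour_integral (linepath a4 a1) h =
        \<i> * (\<integral>t. indicator {-r..r} t *\<^sub>R (?q t) \<partial>lborel)"
    proof -
      have eq: "h (Complex \<sigma> t) = - (?q t)" for t
        unfolding h_def by (metis minus_diff_eq minus_divide_right)
      have "contour_integral (linepath a4 a1) h = - contour_integral (linepath a1 a4) h"
        using contour_integral_reversepath[of "linepath a1 a4" h] by simp
      also have "contour_integral (linepath a1 a4) h = \<i> * integral {-r..r} (\<lambda>t. h (Complex \<sigma> t))"
        by (rule contour_integral_linepath_same_Re) (use r0 in \<open>auto simp: a1_def a4_def\<close>)
      also have "integral {-r..r} (\<lambda>t. h (Complex \<sigma> t)) =
          - integral {-r..r} (\<lambda>t. ?q t)"
        unfolding eq by (rule integral_neg)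
      also have "integral {-r..r} (\<lambda>t. ?q t) =
         (LINT t:{-r..r}|lborel. ?q t)"
        by (rule set_borel_integral_eq_integral(2)[symmetric])
          (use integrable_mult_indicator[OF _ int, of "{-r..r}"] in \<open>simp add: set_integrable_def\<close>)
      finally show ?thesis by (simp add: set_lebesgue_integral_def)
    qed
    have "2 * pi * \<i> * g w - contour_integral (linepath a4 a1) h =
        contour_integral (linepath a1 a2) h + contour_integral (linepath a2 a3) h +
        contour_integral (linepath a3 a4) h"
      using * by (simp add: algebra_simps)
    also have "cmod \<dots> \<le> 4 * C / r + 4 * C / r + 4 * C / r"
      by (intro norm_triangle_mono bb[OF b1 l1(1)] bb[OF b2 l1(2)] bb[OF b3 l1(3)])
    finally show ?thesis by (simp add: left)
  qed
  have lim1: "(\<lambda>n. \<integral>t. indicator {-real n..real n} t *\<^sub>R (?q t) \<partial>lborel)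
      \<longlonglongrightarrow> (\<integral>t. ?q t \<partial>lborel)"
  proof (rule integral_dominated_convergence)
    show "integrable lborel (\<lambda>t. cmod (?q t))"
      using int by simp
    show "AE t in lborel. (\<lambda>n. indicator {-real n..real n} t *\<^sub>R (?q t))
        \<longlonglongrightarrow> ?q t"
    proof (rule AE_I2)
      fix t :: real
      obtain N :: nat where "\<bar>t\<bar> \<le> real N" using real_arch_simple by blast
      then have "eventually (\<lambda>n. indicator {-real n..real n} t *\<^sub>R (?q t)
        = ?q t) sequentially"
        by (intro eventually_sequentiallyI[of N]) (auto simp: abs_le_iff indicator_def)
      then show "(\<lambda>n. indicator {-real n..real n} t *\<^sub>R (?q t))
        \<longlonglongrightarrow> ?q t"
        by (rule tendsto_eventually)
    qed
    show "AE t in lborel. norm (indicator {-real n..real n} t *\<^sub>R (?q t))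
         \<le> cmod (?q t)" for n
      by (rule AE_I2) (auto split: split_indicator)
  qed (use int in \<open>auto intro: borel_measurable_integrable\<close>)
  let ?J = "\<lambda>r. (\<integral>t. indicator {-r..r} t *\<^sub>R (?q t) \<partial>lborel)"
  have "(\<lambda>n. 2 * pi * \<i> * g w - \<i> * ?J (real n)) \<longlonglongrightarrow> 0"
  proof (rule Lim_null_comparison)
    obtain N :: nat where N: "max (max n0 \<sigma>) (max (Re w) \<bar>Im w\<bar>) < real N"
      using reals_Archimedean2 by blast
    show "eventually (\<lambda>n. cmod (2 * pi * \<i> * g w - \<i> * ?J (real n)) \<le> 12 * C / real n) sequentially"
      by (rule eventually_sequentiallyI[of N], rule main) (use N in auto)
    show "(\<lambda>n. 12 * C / real n) \<longlonglongrightarrow> 0" by (rule lim_const_over_n)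
  qed
  moreover have "(\<lambda>n. 2 * pi * \<i> * g w - \<i> * ?J (real n)) \<longlonglongrightarrow>
      2 * pi * \<i> * g w - \<i> * (\<integral>t. ?q t \<partial>lborel)"
    by (intro tendsto_intros lim1)
  ultimately have "2 * pi * \<i> * g w - \<i> * (\<integral>t. ?q t \<partial>lborel) = 0"
    using LIMSEQ_unique by blast
  then have "\<i> * (2 * pi * g w - (\<integral>t. ?q t \<partial>lborel)) = 0"
    by (simp add: algebra_simps)
  then show "(\<integral>t. ?q t \<partial>lborel) = 2 * pi * g w" by simp
qed

section \<open>Function spaces with a reproducing kernel\<close>

text \<open>
  A space with inner product \<open>norm_inner N\<close> and point evaluations represented by \<open>k\<close>.  The norm is definite: a function of
  norm 0 vanishes on \<open>\<Omega>\<close> by the Cauchy-Schwarz inequality against the kernels, and outside \<open>\<Omega>\<close> by \<open>outside\<close>.  This makes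
  the kernels unique, so that the description in \<open>reproducing_kernel\<close> yields \<open>k\<close>.
\<close>

locale kernel_space =
  fixes \<Omega> :: "'a set" and H :: "('a \<Rightarrow> complex) set" and N :: "('a \<Rightarrow> complex) \<Rightarrow> real"
    and k :: "'a \<Rightarrow> 'a \<Rightarrow> complex"
  assumes zero_mem: "(\<lambda>_. 0) \<in> H"
    and lin_mem: "f \<in> H \<Longrightarrow> g \<in> H \<Longrightarrow> (\<lambda>x. f x + c * g x) \<in> H"
    and inner_lin: "f \<in> H \<Longrightarrow> g \<in> H \<Longrightarrow> h \<in> H \<Longrightarrow>
      norm_inner N (\<lambda>x. f x + c * g x) h = norm_inner N f h + c * norm_inner N g h"
    and inner_cnj: "f \<in> H \<Longrightarrow> g \<in> H \<Longrightarrow> norm_inner N g f = cnj (norm_inner N f g)"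
    and inner_self: "f \<in> H \<Longrightarrow> norm_inner N f f = of_real ((N f)\<^sup>2)"
    and N_nonneg: "f \<in> H \<Longrightarrow> N f \<ge> 0"
    and outside: "f \<in> H \<Longrightarrow> x \<notin> \<Omega> \<Longrightarrow> f x = 0"
    and k_mem: "w \<in> \<Omega> \<Longrightarrow> k w \<in> H"
    and reproduce: "w \<in> \<Omega> \<Longrightarrow> f \<in> H \<Longrightarrow> norm_inner N f (k w) = f w"
begin

lemma inner_lin_right:
  assumes "f \<in> H" "g \<in> H" "h \<in> H"
  shows "norm_inner N h (\<lambda>x. f x + c * g x) = norm_inner N h f + cnj c * norm_inner N h g"
  using inner_cnj[of "\<lambda>x. f x + c * g x" h] inner_lin[of f g h c] inner_cnj[of f h] inner_cnj[of g h] assms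
    lin_mem[of f g c] by simp

lemma norm_inner_le:
  assumes f: "f \<in> H" and g: "g \<in> H"
  shows "cmod (norm_inner N f g) \<le> N f * N g"
proof -
  let ?p = "norm_inner N f g"
  have key: "0 \<le> (N f)\<^sup>2 + 2 * Re (cnj c * ?p) + (cmod c)\<^sup>2 * (N g)\<^sup>2" for c
  proof -
    let ?u = "\<lambda>x. f x + c * g x"
    have u: "?u \<in> H" by (rule lin_mem[OF f g])
    have "of_real ((N ?u)\<^sup>2) = norm_inner N ?u ?u" by (simp add: inner_self[OF u])
    also have "\<dots> = norm_inner N f ?u + c * norm_inner N g ?u"
      by (rule inner_lin[OF f g u])
    also have "\<dots> = of_real ((N f)\<^sup>2) + cnj c * ?p + c * (cnj ?p + cnj c * of_real ((N g)\<^sup>2))"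
      by (simp add: inner_lin_right[OF f g] f g inner_self inner_cnj[OF f g])
    finally have "Re (of_real ((N ?u)\<^sup>2)) = Re (of_real ((N f)\<^sup>2) + cnj c * ?p + c * (cnj ?p + cnj c * of_real ((N g)\<^sup>2)))"
      by simp
    then have "(N ?u)\<^sup>2 = (N f)\<^sup>2 + 2 * Re (cnj c * ?p) + (cmod c)\<^sup>2 * (N g)\<^sup>2"
      by (simp add: cmod_power2 algebra_simps) (simp add: power2_eq_square algebra_simps)
    then show ?thesis by (metis zero_le_power2)
  qed
  let ?q = "cmod ?p"
  have key': "0 \<le> (N f)\<^sup>2 - 2 * t * ?q\<^sup>2 + t\<^sup>2 * ?q\<^sup>2 * (N g)\<^sup>2" for t :: real
  proof -
    have "Re (cnj (- of_real t * ?p) * ?p) = - (t * ?q\<^sup>2)"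
      by (simp add: cmod_power2) (simp add: power2_eq_square algebra_simps)
    moreover have "(cmod (- of_real t * ?p))\<^sup>2 = t\<^sup>2 * ?q\<^sup>2"
      by (simp add: norm_mult power_mult_distrib)
    ultimately show ?thesis using key[of "- of_real t * ?p"] by simp
  qed
  show ?thesis
  proof (cases "N g = 0")
    case True
    have "?q\<^sup>2 = 0"
    proof (rule ccontr)
      assume "?q\<^sup>2 \<noteq> 0"
      moreover have "2 * (X / (2 * Q)) * Q = X" if "Q \<noteq> 0" for X Q :: real
        using that by simp
      ultimately have "2 * (((N f)\<^sup>2 + 1) / (2 * ?q\<^sup>2)) * ?q\<^sup>2 = (N f)\<^sup>2 + 1" by blast
      with key'[of "((N f)\<^sup>2 + 1) / (2 * ?q\<^sup>2)"] True show False by (simp del: times_divide_eq_right)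
    qed
    then show ?thesis using True by simp
  next
    case False
    then have Ng: "(N g)\<^sup>2 > 0" by simp
    have "0 \<le> (N f)\<^sup>2 - ?q\<^sup>2 / (N g)\<^sup>2"
      using key'[of "1 / (N g)\<^sup>2"] False by (simp add: field_simps power2_eq_square)
    then have "?q\<^sup>2 \<le> (N f * N g)\<^sup>2" using Ng by (simp add: field_simps power_mult_distrib)
    then show ?thesis
      using N_nonneg[OF f] N_nonneg[OF g] by (simp add: abs_le_square_iff[symmetric])
  qed
qed

lemma reproducing_kernel_eq:
  assumes w: "w \<in> \<Omega>"
  shows "reproducing_kernel H N w = k w"
  unfolding reproducing_kernel_def
proof (rule the_equality)
  show "k w \<in> H \<and> (\<forall>f\<in>H. f w = norm_inner N f (k w))"
    using k_mem[OF w] reproduce[OF w] by auto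
next
  fix k' assume k': "k' \<in> H \<and> (\<forall>f\<in>H. f w = norm_inner N f k')"
  define u where "u x = k' x + (-1) * k w x" for x
  have u: "u \<in> H" unfolding u_def using k' k_mem[OF w] by (intro lin_mem) auto
  have "norm_inner N u u = norm_inner N u k' - norm_inner N u (k w)"
    using inner_lin_right[of k' "k w" u "-1"] k' k_mem[OF w] u unfolding u_def by simp
  also have "\<dots> = 0" using k' u reproduce[OF w u] by auto
  finally have N0: "N u = 0" using inner_self[OF u] by simp
  have "u x = 0" for x
  proof (cases "x \<in> \<Omega>")
    case True
    have "cmod (u x) \<le> N u * N (k x)"
      using norm_inner_le[OF u k_mem[OF True]] reproduce[OF True u] by simp
    then show ?thesis using N0 by simp
  qed (use outside[OF u] in auto)
  then show "k' = k w" by (auto simp: u_def)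
qed

lemma norm_kernel_sq: "w \<in> \<Omega> \<Longrightarrow> of_real ((N (k w))\<^sup>2) = k w w"
  using inner_self[OF k_mem] reproduce[OF _ k_mem] by metis

lemma kernel_sum_mem:
  fixes n :: nat
  assumes "\<And>j. s j \<in> \<Omega>"
  shows "(\<lambda>x. \<Sum>j<n. c j * k (s j) x) \<in> H"
proof (induction n)
  case (Suc n)
  then show ?case using lin_mem[OF Suc k_mem[OF assms[of n]], of "c n"] by simp
qed (simp add: zero_mem)

lemma inner_kernel_sum:
  fixes n :: nat
  assumes "\<And>j. s j \<in> \<Omega>" "f \<in> H"
  shows "norm_inner N f (\<lambda>x. \<Sum>j<n. c j * k (s j) x) = (\<Sum>j<n. cnj (c j) * f (s j))"
proof (induction n)
  case 0
  have "norm_inner N f (\<lambda>x. 0 + 0 * 0) = norm_inner N f (\<lambda>x. 0) + cnj 0 * norm_inner N f (\<lambda>x. 0)"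
    by (rule inner_lin_right[OF zero_mem zero_mem assms(2)])
  moreover have "norm_inner N f (\<lambda>x. 0 + 1 * 0) = norm_inner N f (\<lambda>x. 0) + cnj 1 * norm_inner N f (\<lambda>x. 0)"
    by (rule inner_lin_right[OF zero_mem zero_mem assms(2)])
  ultimately show ?case by simp
next
  case (Suc n)
  show ?case
    using inner_lin_right[where c = "c n", OF kernel_sum_mem[where n = n and c = c, OF assms(1)]
        k_mem[OF assms(1)[of n]] assms(2)] Suc
      reproduce[OF assms(1) assms(2)] by simp
qed

text \<open>
  The duality behind all later estimates: values of \<open>f\<close> are tested against finite sums of kernels.
\<close>

lemma kernel_sum_bound:
  fixes n :: nat
  assumes "\<And>j. s j \<in> \<Omega>" "f \<in> H"
  shows "cmod (\<Sum>j<n. cnj (c j) * f (s j)) \<le> N f * N (\<lambda>x. \<Sum>j<n. c j * k (s j) x)"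
  using norm_inner_le[OF assms(2) kernel_sum_mem[where n = n and c = c, OF assms(1)]]
    inner_kernel_sum[where n = n and c = c, OF assms]
  by simp

lemma norm_kernel_sum_sq:
  fixes n :: nat
  assumes "\<And>j. s j \<in> \<Omega>"
  shows "of_real ((N (\<lambda>x. \<Sum>j<n. c j * k (s j) x))\<^sup>2) =
    (\<Sum>i<n. \<Sum>j<n. cnj (c i) * c j * k (s j) (s i))"
  using inner_self[OF kernel_sum_mem[where n = n and c = c, OF assms]]
    inner_kernel_sum[where n = n and c = c, OF assms kernel_sum_mem[where n = n and c = c, OF assms]]
  by (simp add: sum_distrib_left mult.assoc)

end

section \<open>Boundedness and Cauchy's formula in the Hardy space\<close>

lemma polarization:
  "(\<Sum>k<4. \<i> ^ k * complex_of_real ((cmod (a + \<i> ^ k * b))\<^sup>2)) / 4 = a * cnj b"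
proof -
  have 4: "{..<4::nat} = {0,1,2,3}" by auto
  have i3: "\<i> ^ 3 = - \<i>" by (simp add: eval_nat_numeral)
  show ?thesis
    by (simp add: 4 i3 complex_eq_iff cmod_power2) (simp add: power2_eq_square algebra_simps)
qed

definition line_sq :: "(complex \<Rightarrow> complex) \<Rightarrow> real \<Rightarrow> ennreal" where
  "line_sq f \<sigma> = (\<integral>\<^sup>+ t. ennreal ((cmod (f (Complex \<sigma> t)))\<^sup>2) \<partial>lborel)"

lemma half_plane_simps: "open half_plane" "convex half_plane" "z \<in> half_plane \<longleftrightarrow> 1/2 < Re z"
  by (simp_all only: half_plane_def open_halfspace_Re_gt convex_halfspace_Re_gt mem_Collect_eq)

lemma hardy_line_measurable:
  assumes "f holomorphic_on half_plane" "\<sigma> > 1/2"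
  shows "(\<lambda>t. f (Complex \<sigma> t)) \<in> borel_measurable lborel"
  by (rule line_measurable[OF assms(1)]) (use assms in \<open>simp add: half_plane_simps\<close>)

lemma hardy_sq_norm_line: "hardy_sq_norm f = (SUP \<sigma>\<in>{1/2<..}. ennreal (1 / (2 * pi)) * line_sq f \<sigma>)"
  by (simp add: hardy_sq_norm_def line_sq_def)

lemma line_sq_le_norm:
  assumes "\<sigma> > 1/2"
  shows "line_sq f \<sigma> \<le> ennreal (2 * pi) * hardy_sq_norm f"
proof -
  have "line_sq f \<sigma> = ennreal (2 * pi) * (ennreal (1 / (2 * pi)) * line_sq f \<sigma>)"
    by (simp add: mult.assoc[symmetric] ennreal_mult[symmetric])
  also have "\<dots> \<le> ennreal (2 * pi) * hardy_sq_norm f"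
    unfolding hardy_sq_norm_line using assms by (intro mult_left_mono SUP_upper) auto
  finally show ?thesis .
qed

lemma hardy_mem_iff:
  "f \<in> hardy_space \<longleftrightarrow> f holomorphic_on half_plane \<and> (\<forall>s. s \<notin> half_plane \<longrightarrow> f s = 0) \<and>
     (\<exists>M\<ge>0. \<forall>\<sigma>>1/2. line_sq f \<sigma> \<le> ennreal M)"
proof -
  have "hardy_sq_norm f < \<infinity> \<longleftrightarrow> (\<exists>M\<ge>0. \<forall>\<sigma>>1/2. line_sq f \<sigma> \<le> ennreal M)"
  proof
    assume a: "hardy_sq_norm f < \<infinity>"
    then obtain r where r: "hardy_sq_norm f = ennreal r" "r \<ge> 0" by (cases "hardy_sq_norm f") auto
    have "line_sq f \<sigma> \<le> ennreal (2 * pi * r)" if "\<sigma> > 1/2" for \<sigma>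
      using line_sq_le_norm[OF that, of f] r by (simp add: ennreal_mult)
    then show "\<exists>M\<ge>0. \<forall>\<sigma>>1/2. line_sq f \<sigma> \<le> ennreal M"
      using r by (intro exI[of _ "2 * pi * r"]) auto
  next
    assume "\<exists>M\<ge>0. \<forall>\<sigma>>1/2. line_sq f \<sigma> \<le> ennreal M"
    then obtain M where "\<And>\<sigma>. \<sigma> > 1/2 \<Longrightarrow> line_sq f \<sigma> \<le> ennreal M" by blast
    then have "hardy_sq_norm f \<le> ennreal (1 / (2 * pi)) * ennreal M"
      unfolding hardy_sq_norm_line by (intro SUP_least mult_left_mono) auto
    also have "\<dots> < \<infinity>" by (simp add: ennreal_mult_less_top)
    finally show "hardy_sq_norm f < \<infinity>" .
  qed
  then show ?thesis unfolding hardy_space_def by auto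
qed

lemma line_sq_integrable:
  assumes "f holomorphic_on half_plane" "\<sigma> > 1/2" "line_sq f \<sigma> \<le> ennreal M" "M \<ge> 0"
  shows "integrable lborel (\<lambda>t. (cmod (f (Complex \<sigma> t)))\<^sup>2)"
    and "(\<integral>t. (cmod (f (Complex \<sigma> t)))\<^sup>2 \<partial>lborel) \<le> M"
proof -
  note [measurable] = hardy_line_measurable[OF assms(1,2)]
  show i: "integrable lborel (\<lambda>t. (cmod (f (Complex \<sigma> t)))\<^sup>2)"
    using assms(3) unfolding line_sq_def
    by (intro integrableI_nonneg) (auto intro: le_less_trans)
  have "ennreal (\<integral>t. (cmod (f (Complex \<sigma> t)))\<^sup>2 \<partial>lborel) = line_sq f \<sigma>"
    unfolding line_sq_def by (rule nn_integral_eq_integral[symmetric, OF i]) auto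
  then have "ennreal (\<integral>t. (cmod (f (Complex \<sigma> t)))\<^sup>2 \<partial>lborel) \<le> ennreal M" using assms(3) by simp
  then show "(\<integral>t. (cmod (f (Complex \<sigma> t)))\<^sup>2 \<partial>lborel) \<le> M" using assms(4) by simp
qed

text \<open>
  With a primitive \<open>\<Phi>\<close> of \<open>f\<close>, the increments \<open>\<Phi>(z + ih) - \<Phi>(z)\<close> with \<open>0 < h \<le> 1\<close> are integrals of \<open>f\<close> over vertical segments and so are
  bounded.  Cauchy's estimate then bounds their derivatives \<open>f(z + ih) - f(z)\<close>, and averaging over \<open>h\<close> bounds \<open>f(z)\<close> by a
  line integral of \<open>|f|\<^sup>2\<close>.
\<close>

lemma hardy_bounded:
  assumes f: "f \<in> hardy_space" and \<sigma>0: "\<sigma>0 > 1/2"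
  obtains C where "\<And>z. \<sigma>0 \<le> Re z \<Longrightarrow> cmod (f z) \<le> C"
proof -
  obtain M where hol: "f holomorphic_on half_plane" and M: "M \<ge> 0" "\<And>\<sigma>. \<sigma> > 1/2 \<Longrightarrow> line_sq f \<sigma> \<le> ennreal M"
    using f unfolding hardy_mem_iff by blast
  note int = line_sq_integrable[OF hol _ M(2) M(1)]
  obtain \<Phi> where \<Phi>: "\<And>x. x \<in> half_plane \<Longrightarrow> (\<Phi> has_field_derivative f x) (at x within half_plane)"
    using holomorphic_convex_primitive'[OF half_plane_simps(2,1) hol] by blast
  have \<Phi>': "(\<Phi> has_field_derivative f x) (at x)" if "x \<in> half_plane" for x
    using \<Phi>[OF that] at_within_open[OF that half_plane_simps(1)] by simp
  define B where "B = (1 + M) / 2"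
  have B: "B \<ge> 0" using M by (simp add: B_def)
  have incr: "cmod (\<Phi> (z + \<i> * of_real h) - \<Phi> z) \<le> B"
    if z: "z \<in> half_plane" and h: "0 < h" "h \<le> 1" for z h
  proof -
    let ?\<sigma> = "Re z" and ?y = "Im z"
    have \<sigma>: "?\<sigma> > 1/2" using z by (simp add: half_plane_simps)
    note [measurable] = hardy_line_measurable[OF hol \<sigma>]
    have sub: "path_image (linepath z (z + \<i> * of_real h)) \<subseteq> half_plane"
      using z by (auto simp: half_plane_simps closed_segment_same_Re)
    have "(f has_contour_integral (\<Phi> (z + \<i> * of_real h) - \<Phi> z)) (linepath z (z + \<i> * of_real h))"
      using contour_integral_primitive[of half_plane \<Phi> f "linepath z (z + \<i> * of_real h)"] \<Phi> sub by simp
    then have "((\<lambda>x. f (Complex ?\<sigma> x)) has_integral (- \<i> * (\<Phi> (z + \<i> * of_real h) - \<Phi> z))) {?y..?y+h}"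
      using h by (subst (asm) has_contour_integral_linepath_same_Re_iff[where c="?\<sigma>" and a="?y" and b="?y+h"]) auto
    then have eq: "integral {?y..?y+h} (\<lambda>x. f (Complex ?\<sigma> x)) = - \<i> * (\<Phi> (z + \<i> * of_real h) - \<Phi> z)"
      by (rule integral_unique)
    have cont: "continuous_on UNIV (\<lambda>t. f (Complex ?\<sigma> t))"
      by (rule continuous_on_compose2[OF holomorphic_on_imp_continuous_on[OF hol]])
        (use \<sigma> in \<open>auto simp: Complex_eq half_plane_simps intro!: continuous_intros\<close>)
    have si: "set_integrable lborel {?y..?y+h} (\<lambda>x. f (Complex ?\<sigma> x))"
      by (rule borel_integrable_atLeastAtMost')
        (rule continuous_on_subset[OF cont subset_UNIV])
    have "integral {?y..?y+h} (\<lambda>x. f (Complex ?\<sigma> x)) = (\<integral>x. indicator {?y..?y+h} x *\<^sub>R f (Complex ?\<sigma> x) \<partial>lborel)"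
      using set_borel_integral_eq_integral(2)[OF si] by (simp add: set_lebesgue_integral_def)
    also have "cmod \<dots> \<le> (\<integral>x. cmod (indicator {?y..?y+h} x *\<^sub>R f (Complex ?\<sigma> x)) \<partial>lborel)"
      by (rule integral_norm_bound)
    also have "\<dots> \<le> (\<integral>x. (indicator {?y..?y+h} x + (cmod (f (Complex ?\<sigma> x)))\<^sup>2) / 2 \<partial>lborel)"
    proof (rule integral_mono)
      show "integrable lborel (\<lambda>x. cmod (indicat_real {?y..?y+h} x *\<^sub>R f (Complex ?\<sigma> x)))"
        by (rule integrable_norm) (use si in \<open>simp add: set_integrable_def\<close>)
      show "integrable lborel (\<lambda>x. (indicat_real {?y..?y+h} x + (cmod (f (Complex ?\<sigma> x)))\<^sup>2) / 2)"
        by (intro integrable_divide Bochner_Integration.integrable_add int(1)[OF \<sigma> \<sigma>] integrable_real_indicator) (auto simp: emeasure_lborel_Icc_eq)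
      show "cmod (indicat_real {?y..?y+h} x *\<^sub>R f (Complex ?\<sigma> x)) \<le> (indicat_real {?y..?y+h} x + (cmod (f (Complex ?\<sigma> x)))\<^sup>2) / 2" for x
        using sum_squares_bound[of 1 "cmod (f (Complex ?\<sigma> x))"] by (simp split: split_indicator)
    qed
    also have "\<dots> = (h + (\<integral>x. (cmod (f (Complex ?\<sigma> x)))\<^sup>2 \<partial>lborel)) / 2"
      using int(1)[OF \<sigma> \<sigma>] h by simp
    also have "\<dots> \<le> B" using int(2)[OF \<sigma> \<sigma>] h by (simp add: B_def)
    finally show ?thesis by (simp add: eq norm_mult)
  qed
  \<comment> \<open>half the distance to the boundary, so that the discs used in Cauchy's estimate stay inside\<close>
  define r where "r = (\<sigma>0 - 1/2) / 2"
  have r: "r > 0" using \<sigma>0 by (simp add: r_def)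
  have shift: "cmod (f (z + \<i> * of_real h) - f z) \<le> B / r" if z: "\<sigma>0 \<le> Re z" and h: "0 < h" "h \<le> 1" for z h
  proof -
    define g where "g z = \<Phi> (z + \<i> * of_real h) - \<Phi> z" for z
    have cb: "cball z r \<subseteq> half_plane"
    proof
      fix u assume "u \<in> cball z r"
      then have "\<bar>Re (z - u)\<bar> \<le> r" using abs_Re_le_cmod[of "z - u"] by (simp add: dist_norm)
      then have "Re z - Re u \<le> (\<sigma>0 - 1/2) / 2"
        unfolding r_def minus_complex.sel by linarith
      then show "u \<in> half_plane" using z \<sigma>0 unfolding half_plane_simps by argo
    qed
    have dg: "(g has_field_derivative (f (u + \<i> * of_real h) - f u)) (at u)" if "u \<in> half_plane" for u
    proof -
      have "u + \<i> * of_real h \<in> half_plane" using that by (simp add: half_plane_simps)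
      then have "((\<lambda>u. \<Phi> (u + \<i> * of_real h)) has_field_derivative f (u + \<i> * of_real h) * 1) (at u)"
        by (intro DERIV_chain2[where f = \<Phi> and g = "\<lambda>u. u + \<i> * of_real h"] \<Phi>')
          (auto intro!: derivative_eq_intros)
      then have "((\<lambda>u. \<Phi> (u + \<i> * of_real h)) has_field_derivative f (u + \<i> * of_real h)) (at u)"
        by simp
      then show ?thesis unfolding g_def by (intro DERIV_diff \<Phi>' that)
    qed
    have hg: "g holomorphic_on half_plane"
      using dg by (meson field_differentiable_at_within field_differentiable_def holomorphic_onI)
    have "cmod ((deriv ^^ 1) g z) \<le> fact 1 * B / r ^ 1"
    proof (rule Cauchy_inequality[OF _ _ r])
      show "g holomorphic_on ball z r" using hg cb by (meson ball_subset_cball holomorphic_on_subset)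
      show "continuous_on (cball z r) g" using hg cb by (meson holomorphic_on_imp_continuous_on holomorphic_on_subset)
      fix u assume "cmod (z - u) = r"
      then have "u \<in> half_plane" using cb by (auto simp: dist_norm)
      then show "cmod (g u) \<le> B" unfolding g_def by (rule incr[OF _ h])
    qed
    moreover have "deriv g z = f (z + \<i> * of_real h) - f z"
      by (rule DERIV_imp_deriv, rule dg) (use z \<sigma>0 in \<open>simp add: half_plane_simps\<close>)
    ultimately show ?thesis by simp
  qed
  \<comment> \<open>from \<open>|f(z)|\<^sup>2 \<le> 2 |f(z + ih)|\<^sup>2 + 2 (B / r)\<^sup>2\<close>, to be integrated over \<open>h\<close> from 0 to 1\<close>
  define K where "K = 2 * (B / r)\<^sup>2"
  have "cmod (f z) \<le> 2 * M + K + 1" if z: "\<sigma>0 \<le> Re z" for z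
  proof -
    let ?\<sigma> = "Re z" and ?y = "Im z"
    have \<sigma>: "?\<sigma> > 1/2" using z \<sigma>0 by simp
    have pt: "(cmod (f z))\<^sup>2 - K \<le> 2 * (cmod (f (Complex ?\<sigma> t)))\<^sup>2" if t: "t \<in> {?y..?y+1}" for t
    proof (cases "t = ?y")
      case True
      then show ?thesis by (simp add: K_def)
        (smt (verit) zero_le_power2)
    next
      case False
      have eq: "z + \<i> * of_real (t - ?y) = Complex ?\<sigma> t" by (simp add: complex_eq_iff)
      have "cmod (f (Complex ?\<sigma> t) - f z) \<le> B / r"
        using shift[OF z, of "t - ?y"] t False unfolding eq by auto
      then have "cmod (f z) \<le> cmod (f (Complex ?\<sigma> t)) + B / r"
        by (metis norm_minus_commute norm_triangle_sub add_left_mono order_trans)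
      then have "(cmod (f z))\<^sup>2 \<le> (cmod (f (Complex ?\<sigma> t)) + B / r)\<^sup>2" by (simp add: power_mono)
      also have "\<dots> \<le> 2 * (cmod (f (Complex ?\<sigma> t)))\<^sup>2 + 2 * (B / r)\<^sup>2"
        using sum_squares_bound[of "cmod (f (Complex ?\<sigma> t))" "B / r"] by (simp only: power2_sum)
      finally show ?thesis by (simp add: K_def)
    qed
    have "(cmod (f z))\<^sup>2 - K = (\<integral>t. indicator {?y..?y+1} t * ((cmod (f z))\<^sup>2 - K) \<partial>lborel)"
      by simp
    also have "\<dots> \<le> (\<integral>t. 2 * (cmod (f (Complex ?\<sigma> t)))\<^sup>2 \<partial>lborel)"
    proof (rule integral_mono)
      show "integrable lborel (\<lambda>t. indicat_real {?y..?y+1} t * ((cmod (f z))\<^sup>2 - K))" by simp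
      show "integrable lborel (\<lambda>t. 2 * (cmod (f (Complex ?\<sigma> t)))\<^sup>2)" using int(1)[OF \<sigma> \<sigma>] by simp
      show "indicat_real {?y..?y+1} t * ((cmod (f z))\<^sup>2 - K) \<le> 2 * (cmod (f (Complex ?\<sigma> t)))\<^sup>2" for t
        using pt[of t] by (simp split: split_indicator)
    qed
    also have "\<dots> \<le> 2 * M" using int(2)[OF \<sigma> \<sigma>] by simp
    finally have "(cmod (f z))\<^sup>2 \<le> 2 * M + K" by simp
    moreover have "cmod (f z) \<le> (cmod (f z))\<^sup>2 + 1"
      using sum_squares_bound[of "cmod (f z)" 1] norm_ge_zero[of "f z"] by (simp only: one_power2 mult_1_right)
    ultimately show ?thesis by simp
  qed
  then show ?thesis using that by blast
qed

text \<open>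
  \<open>f\<close> is only bounded on half-planes to the right of the line, so the previous form of Cauchy's formula is applied to \<open>f(z) A / (z + A)\<close>, and
  \<open>A\<close> tends to infinity by dominated convergence.
\<close>

lemma hardy_cauchy:
  fixes f :: "complex \<Rightarrow> complex"
  assumes f: "f \<in> hardy_space" and \<sigma>: "1/2 < \<sigma>" "\<sigma> < Re w"
  shows "(\<integral>t. f (Complex \<sigma> t) / (w - Complex \<sigma> t) \<partial>lborel) = 2 * pi * f w"
proof -
  let ?z = "Complex \<sigma>"
  obtain M where hol: "f holomorphic_on half_plane" and M: "M \<ge> 0" "\<And>\<sigma>. \<sigma> > 1/2 \<Longrightarrow> line_sq f \<sigma> \<le> ennreal M"
    using f unfolding hardy_mem_iff by blast
  note mf[measurable] = hardy_line_measurable[OF hol \<sigma>(1)]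
  have mw[measurable]: "(\<lambda>t. 1 / (w - ?z t)) \<in> borel_measurable lborel"
    by (simp add: Complex_eq)
  obtain C where C: "\<And>z. \<sigma> \<le> Re z \<Longrightarrow> cmod (f z) \<le> C" using hardy_bounded[OF f \<sigma>(1)] by blast
  have C0: "C \<ge> 0" using C[of "of_real \<sigma>"] by (smt (verit) Re_complex_of_real norm_ge_zero)
  have int: "integrable lborel (\<lambda>t. f (?z t) * (1 / (w - ?z t)))"
    by (rule integrable_mult_of_squares[OF line_sq_integrable(1)[OF hol \<sigma>(1) M(2)[OF \<sigma>(1)] M(1)]
          integrable_inverse_line_sq[OF \<sigma>(2)]]) auto
  define A where "A n = complex_of_real (real n + 1)" for n
  have A: "Re (A n) = real n + 1" "Im (A n) = 0" "cmod (A n) = real n + 1" for n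
    unfolding A_def norm_of_real by simp_all
  have mC[measurable]: "Complex \<sigma> \<in> borel_measurable lborel"
    by (simp add: Complex_eq[abs_def])
  have nA: "cmod (A n / (z + A n)) \<le> 1" if "Re z > 0" for n z
  proof -
    have "real n + 1 \<le> Re (z + A n)" using that by (simp add: A)
    also have "\<dots> \<le> cmod (z + A n)" by (rule complex_Re_le_cmod)
    finally have "cmod (A n) \<le> cmod (z + A n)" by (simp add: A)
    moreover have "cmod (z + A n) > 0" using that by (auto simp: A complex_eq_iff)
    ultimately show ?thesis by (simp add: norm_divide)
  qed
  have eq: "(\<integral>t. f (?z t) * (A n / (?z t + A n)) / (w - ?z t) \<partial>lborel)
      = 2 * pi * (f w * (A n / (w + A n)))" for n
  proof (rule cauchy_line_decay(2)[where \<tau> = "1/2" and C = "2 * C * (real n + 1)"])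
    show "(\<lambda>z. f z * (A n / (z + A n))) holomorphic_on {z. 1/2 < Re z}"
      using hol unfolding half_plane_def
      by (intro holomorphic_intros) (auto simp: A_def complex_eq_iff)
    fix z assume z: "\<sigma> \<le> Re z"
    have 1: "1 + cmod z \<le> 2 * cmod (z + A n)"
    proof -
      have "Re (z + A n) \<ge> 1" using z \<sigma> by (simp add: A)
      then have "1 \<le> cmod (z + A n)" using complex_Re_le_cmod[of "z + A n"] by linarith
      moreover have "(cmod z)\<^sup>2 \<le> (cmod (z + A n))\<^sup>2"
        using z \<sigma> by (simp add: cmod_power2 A power_mono)
      then have "cmod z \<le> cmod (z + A n)" by (rule power2_le_imp_le) simp
      ultimately show ?thesis by simp
    qed
    have 2: "cmod (z + A n) > 0" using z \<sigma> by (auto simp: A complex_eq_iff)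
    have "cmod (f z * (A n / (z + A n))) * (1 + cmod z) =
        cmod (f z) * (real n + 1) * ((1 + cmod z) / cmod (z + A n))"
      by (simp add: norm_mult norm_divide A)
    also have "\<dots> \<le> C * (real n + 1) * 2"
      using 1 2 C[OF z] C0 by (intro mult_mono) (auto simp: divide_simps)
    finally show "cmod (f z * (A n / (z + A n))) * (1 + cmod z) \<le> 2 * C * (real n + 1)" by simp
  qed (use \<sigma> in auto)
  have limA: "(\<lambda>n. A n / (z + A n)) \<longlonglongrightarrow> 1" if "Re z > 0" for z
  proof -
    have "(\<lambda>n. 1 / (z * of_real (1 / (real n + 1)) + 1)) \<longlonglongrightarrow> 1 / (z * of_real 0 + 1)"
      by (intro tendsto_intros tendsto_of_real) 
        (use lim_inverse_n' LIMSEQ_inverse_real_of_nat in \<open>auto simp: inverse_eq_divide add.commute\<close>)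
    moreover have "1 / (z * of_real (1 / (real n + 1)) + 1) = A n / (z + A n)" for n
    proof -
      have "complex_of_real (real n + 1) \<noteq> 0" by (metis of_nat_Suc of_real_of_nat_eq of_nat_neq_0 add.commute)
      then show ?thesis by (simp add: A_def field_simps)
    qed
    ultimately show ?thesis by simp
  qed
  have "(\<lambda>n. \<integral>t. f (?z t) * (A n / (?z t + A n)) / (w - ?z t) \<partial>lborel) \<longlonglongrightarrow>
     (\<integral>t. f (?z t) / (w - ?z t) \<partial>lborel)"
  proof (rule integral_dominated_convergence)
    show "integrable lborel (\<lambda>t. cmod (f (?z t) * (1 / (w - ?z t))))" using int by (rule integrable_norm)
    show "AE t in lborel. (\<lambda>n. f (?z t) * (A n / (?z t + A n)) / (w - ?z t))
        \<longlonglongrightarrow> f (?z t) / (w - ?z t)"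
    proof (rule AE_I2)
      fix t
      have "w - ?z t \<noteq> 0" using \<sigma> by (auto simp: complex_eq_iff)
      then have "(\<lambda>n. f (?z t) * (A n / (?z t + A n)) / (w - ?z t))
        \<longlonglongrightarrow> f (?z t) * 1 / (w - ?z t)"
        by (intro tendsto_divide tendsto_mult tendsto_const limA) (use \<sigma> in auto)
      then show "(\<lambda>n. f (?z t) * (A n / (?z t + A n)) / (w - ?z t))
        \<longlonglongrightarrow> f (?z t) / (w - ?z t)" by simp
    qed
    show "AE t in lborel. cmod (f (?z t) * (A n / (?z t + A n)) / (w - ?z t))
        \<le> cmod (f (?z t) * (1 / (w - ?z t)))" for n
    proof (rule AE_I2)
      fix t
      have "cmod (f (?z t) * (A n / (?z t + A n)) / (w - ?z t)) =
         cmod (f (?z t) * (1 / (w - ?z t))) * cmod (A n / (?z t + A n))"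
        by (simp add: norm_mult norm_divide)
      also have "\<dots> \<le> cmod (f (?z t) * (1 / (w - ?z t))) * 1"
        using nA[of "?z t" n] \<sigma> by (intro mult_left_mono) auto
      finally show "cmod (f (?z t) * (A n / (?z t + A n)) / (w - ?z t))
        \<le> cmod (f (?z t) * (1 / (w - ?z t)))" by simp
    qed
  qed measurable
  moreover have "(\<lambda>n. \<integral>t. f (?z t) * (A n / (?z t + A n)) / (w - ?z t) \<partial>lborel) \<longlonglongrightarrow>
     complex_of_real (2 * pi) * (f w * 1)"
    unfolding eq by (intro tendsto_mult tendsto_const limA) (use \<sigma> in auto)
  ultimately show ?thesis using LIMSEQ_unique by fastforce
qed

section \<open>Poisson's formula and the Hardy inner product\<close>

text \<open>
  On the line \<open>Re z = \<sigma>\<close> conjugation agrees with the holomorphic map \<open>z \<mapsto> 2\<sigma> - z\<close>.  So the reflected point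
  \<open>w\<^sup>* = 2\<sigma> - cnj w\<close> satisfies \<open>(z - w\<^sup>*)(w - z) = |w - z|\<^sup>2\<close> there.
\<close>

lemma line_reflect:
  fixes w :: complex
  shows "(Complex \<sigma> t - (2 * of_real \<sigma> - cnj w)) = cnj (w - Complex \<sigma> t)"
  by (simp add: complex_eq_iff)

text \<open>
  Cauchy's formula at \<open>w\<close> for the function \<open>f(z) / (z - w\<^sup>*)\<close>, where \<open>w\<^sup>*\<close> is the reflection of \<open>w\<close> in the line.  The factor
  \<open>1 / (z - w\<^sup>*)\<close> supplies the decay that Cauchy's formula requires.
\<close>

lemma poisson_line:
  fixes f :: "complex \<Rightarrow> complex"
  assumes hol: "f holomorphic_on half_plane" and \<sigma>: "1/2 < \<sigma>" "\<sigma> < Re w"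
    and C: "\<And>z. \<sigma> \<le> Re z \<Longrightarrow> cmod (f z) \<le> C"
  shows "integrable lborel (\<lambda>t. f (Complex \<sigma> t) * of_real ((cmod (1 / (w - Complex \<sigma> t)))\<^sup>2))"
    and "(\<integral>t. f (Complex \<sigma> t) * of_real ((cmod (1 / (w - Complex \<sigma> t)))\<^sup>2) \<partial>lborel) =
      complex_of_real (pi / (Re w - \<sigma>)) * f w"
proof -
  define v where "v = 2 * of_real \<sigma> - cnj w"
  define x where "x = Re w - \<sigma>"
  have x: "x > 0" using \<sigma> by (simp add: x_def)
  have Rev: "Re v = \<sigma> - x" by (simp add: v_def x_def)
  have C0: "C \<ge> 0" using C[of "of_real \<sigma>"] by (smt (verit) Re_complex_of_real norm_ge_zero)
  have hol': "(\<lambda>z. f z / (z - v)) holomorphic_on {z. max (1/2) (\<sigma> - x) < Re z}"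
    by (intro holomorphic_intros holomorphic_on_subset[OF hol]) (auto simp: half_plane_def Rev complex_eq_iff)
  have decay: "cmod (f z / (z - v)) * (1 + cmod z) \<le> C * ((1 + cmod v) / x + 1)" if z: "\<sigma> \<le> Re z" for z
  proof -
    have 1: "x \<le> cmod (z - v)" using complex_Re_le_cmod[of "z - v"] z by (simp add: Rev)
    have "1 + cmod z \<le> (1 + cmod v) + cmod (z - v)"
      by (metis add.commute add.left_commute add_left_mono norm_triangle_sub)
    also have "1 + cmod v \<le> (1 + cmod v) / x * cmod (z - v)"
      using 1 x mult_left_mono[OF 1, of "(1 + cmod v) / x"] by simp
    finally have "1 + cmod z \<le> ((1 + cmod v) / x + 1) * cmod (z - v)" by (simp add: algebra_simps)
    moreover have "0 < cmod (z - v)" using 1 x by linarith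
    ultimately have "(1 + cmod z) / cmod (z - v) \<le> (1 + cmod v) / x + 1"
      by (simp only: pos_divide_le_eq)
    moreover have "cmod (f z / (z - v)) * (1 + cmod z) = cmod (f z) * ((1 + cmod z) / cmod (z - v))"
      by (simp add: norm_divide)
    ultimately show ?thesis using C[OF z] C0 by (simp only:) (intro mult_mono; simp)
  qed
  have eq: "f (Complex \<sigma> t) / (Complex \<sigma> t - v) / (w - Complex \<sigma> t) =
     f (Complex \<sigma> t) * of_real ((cmod (1 / (w - Complex \<sigma> t)))\<^sup>2)" for t
  proof -
    have "(Complex \<sigma> t - v) * (w - Complex \<sigma> t) = of_real ((cmod (w - Complex \<sigma> t))\<^sup>2)"
      unfolding v_def line_reflect using complex_norm_square[of "w - Complex \<sigma> t"] by (simp add: mult.commute)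
    then show ?thesis by (simp add: norm_divide power_divide)
  qed
  note L = cauchy_line_decay[OF hol' _ \<sigma>(2) _ decay, unfolded eq]
  show "integrable lborel (\<lambda>t. f (Complex \<sigma> t) * of_real ((cmod (1 / (w - Complex \<sigma> t)))\<^sup>2))"
    by (rule L(1)) (use \<sigma> x in auto)
  have "(\<integral>t. f (Complex \<sigma> t) * of_real ((cmod (1 / (w - Complex \<sigma> t)))\<^sup>2) \<partial>lborel) = 2 * pi * (f w / (w - v))"
    by (rule L(2)) (use \<sigma> x in auto)
  also have "w - v = of_real (2 * x)" by (simp add: v_def x_def complex_eq_iff)
  also have "2 * pi * (f w / of_real (2 * x)) = complex_of_real (pi / x) * f w" using x by simp
  finally show "(\<integral>t. f (Complex \<sigma> t) * of_real ((cmod (1 / (w - Complex \<sigma> t)))\<^sup>2) \<partial>lborel) =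
      complex_of_real (pi / (Re w - \<sigma>)) * f w"
    unfolding x_def .
qed

text \<open>
  The case \<open>f = 1\<close> of Poisson's formula.
\<close>

lemma poisson_kernel_integral:
  assumes \<sigma>: "1/2 < \<sigma>" "\<sigma> < Re w"
  shows "(\<integral>\<^sup>+t. ennreal ((cmod (1 / (w - Complex \<sigma> t)))\<^sup>2) \<partial>lborel) = ennreal (pi / (Re w - \<sigma>))"
proof -
  have "complex_of_real (\<integral>t. (cmod (1 / (w - Complex \<sigma> t)))\<^sup>2 \<partial>lborel) =
     (\<integral>t. 1 * of_real ((cmod (1 / (w - Complex \<sigma> t)))\<^sup>2) \<partial>lborel)"
    by (simp only: mult_1_left integral_complex_of_real)
  also have "\<dots> = complex_of_real (pi / (Re w - \<sigma>)) * 1"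
    by (rule poisson_line(2)[of "\<lambda>_. 1" \<sigma> w 1]) (use \<sigma> in auto)
  finally have "complex_of_real (\<integral>t. (cmod (1 / (w - Complex \<sigma> t)))\<^sup>2 \<partial>lborel) = of_real (pi / (Re w - \<sigma>))"
    by (simp only: mult_1_right)
  then have "(\<integral>t. (cmod (1 / (w - Complex \<sigma> t)))\<^sup>2 \<partial>lborel) = pi / (Re w - \<sigma>)"
    by (simp only: of_real_eq_iff)
  then show ?thesis
    using nn_integral_eq_integral[OF integrable_inverse_line_sq[OF \<sigma>(2)]] by simp
qed

text \<open>
  The values of \<open>f\<close> on the line at \<open>\<sigma>'\<close> are averages of those at \<open>\<sigma>\<close> against the Poisson kernel, which has total mass 1
  in either variable; Cauchy-Schwarz and Tonelli finish the argument.
\<close>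

lemma line_sq_antimono:
  assumes f: "f \<in> hardy_space" and \<sigma>: "1/2 < \<sigma>" "\<sigma> \<le> \<sigma>'"
  shows "line_sq f \<sigma>' \<le> line_sq f \<sigma>"
proof (cases "\<sigma> = \<sigma>'")
  case False
  let ?F = "\<lambda>t. ennreal ((cmod (f (Complex \<sigma> t)))\<^sup>2)" and ?P = "\<lambda>k y t. ennreal ((k y t)\<^sup>2)"
  define x where "x = \<sigma>' - \<sigma>"
  have x: "x > 0" using \<sigma> False by (simp add: x_def)
  have hol: "f holomorphic_on half_plane" using f by (simp add: hardy_space_def)
  obtain C where C: "\<And>z. \<sigma> \<le> Re z \<Longrightarrow> cmod (f z) \<le> C" using hardy_bounded[OF f \<sigma>(1)] by blast
  note [measurable] = hardy_line_measurable[OF hol \<sigma>(1)]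
  define k where "k y t = cmod (1 / (Complex \<sigma>' y - Complex \<sigma> t))" for y t
  have k0: "k y t \<ge> 0" for y t by (simp add: k_def)
  have ksym: "k y t = k t y" for y t
  proof -
    have "cmod (Complex \<sigma>' y - Complex \<sigma> t) = cmod (Complex \<sigma>' t - Complex \<sigma> y)"
      by (simp add: cmod_def power2_commute)
    then show ?thesis by (simp add: k_def norm_divide)
  qed
  have [measurable]: "(\<lambda>(y, t). k y t) \<in> borel_measurable (lborel \<Otimes>\<^sub>M lborel)"
    unfolding k_def Complex_eq by measurable
  have [measurable]: "k y \<in> borel_measurable lborel" for y
    unfolding k_def[abs_def] Complex_eq by measurable
  have kint: "(\<integral>\<^sup>+t. ?P k y t \<partial>lborel) = ennreal (pi / x)" for y
    unfolding k_def x_def using poisson_kernel_integral[of \<sigma> "Complex \<sigma>' y"] \<sigma> x by (simp add: x_def)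
  have pt: "ennreal ((cmod (f (Complex \<sigma>' y)))\<^sup>2) \<le> ennreal (x / pi) *
      (\<integral>\<^sup>+t. ?F t * ?P k y t \<partial>lborel)" for y
  proof -
    let ?w = "Complex \<sigma>' y"
    have w: "\<sigma> < Re ?w" using x by (simp add: x_def)
    note P = poisson_line[OF hol \<sigma>(1) w C]
    have "(\<integral>t. f (Complex \<sigma> t) * of_real ((k y t)\<^sup>2) \<partial>lborel) = complex_of_real (pi / x) * f ?w"
      using P(2) unfolding k_def x_def by simp
    then have "cmod (\<integral>t. f (Complex \<sigma> t) * of_real ((k y t)\<^sup>2) \<partial>lborel) = pi / x * cmod (f ?w)"
      using x by (simp only: norm_mult norm_of_real) simp
    then have "ennreal (pi / x * cmod (f ?w)) = ennreal (cmod (\<integral>t. f (Complex \<sigma> t) * of_real ((k y t)\<^sup>2) \<partial>lborel))"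
      by simp
    also have "\<dots> \<le> (\<integral>\<^sup>+t. ennreal (cmod (f (Complex \<sigma> t) * of_real ((k y t)\<^sup>2))) \<partial>lborel)"
      using P(1) unfolding k_def by (rule integral_norm_bound_ennreal)
    also have "\<dots> = (\<integral>\<^sup>+t. ennreal (cmod (f (Complex \<sigma> t)) * k y t) * ennreal (k y t) \<partial>lborel)"
      using k0 by (intro nn_integral_cong) (simp add: norm_mult power2_eq_square ennreal_mult[symmetric] mult.assoc)
    finally have "(ennreal (pi / x * cmod (f ?w)))\<^sup>2 \<le>
       (\<integral>\<^sup>+t. ennreal (cmod (f (Complex \<sigma> t)) * k y t) * ennreal (k y t) \<partial>lborel)\<^sup>2"
      by (rule power_mono) simp
    also have "\<dots> \<le> (\<integral>\<^sup>+t. (ennreal (cmod (f (Complex \<sigma> t)) * k y t))\<^sup>2 \<partial>lborel) *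
       (\<integral>\<^sup>+t. (ennreal (k y t))\<^sup>2 \<partial>lborel)"
      by (rule Cauchy_Schwarz_nn_integral) measurable
    also have "\<dots> = (\<integral>\<^sup>+t. ?F t * ?P k y t \<partial>lborel) * ennreal (pi / x)"
      using k0 kint[of y] by (simp add: ennreal_power power_mult_distrib ennreal_mult)
    finally have *: "(ennreal (pi / x * cmod (f ?w)))\<^sup>2 \<le>
      (\<integral>\<^sup>+t. ?F t * ?P k y t \<partial>lborel) * ennreal (pi / x)" .
    have "ennreal ((cmod (f ?w))\<^sup>2) = ennreal ((x / pi)\<^sup>2) * (ennreal (pi / x * cmod (f ?w)))\<^sup>2"
      using x by (simp add: ennreal_power ennreal_mult[symmetric] power_mult_distrib power_divide field_simps)
    also have "\<dots> \<le> ennreal ((x / pi)\<^sup>2) *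
      ((\<integral>\<^sup>+t. ?F t * ?P k y t \<partial>lborel) * ennreal (pi / x))"
      by (rule mult_left_mono[OF *]) simp
    also have "\<dots> = (ennreal ((x / pi)\<^sup>2) * ennreal (pi / x)) *
      (\<integral>\<^sup>+t. ?F t * ?P k y t \<partial>lborel)"
      by (simp add: mult_ac)
    also have "ennreal ((x / pi)\<^sup>2) * ennreal (pi / x) = ennreal (x / pi)"
      using x by (simp add: ennreal_mult[symmetric] power2_eq_square field_simps)
    finally show ?thesis .
  qed
  have "line_sq f \<sigma>' \<le> (\<integral>\<^sup>+y. ennreal (x / pi) *
      (\<integral>\<^sup>+t. ?F t * ?P k y t \<partial>lborel) \<partial>lborel)"
    unfolding line_sq_def by (rule nn_integral_mono) (rule pt)
  also have "\<dots> = ennreal (x / pi) * (\<integral>\<^sup>+y. \<integral>\<^sup>+t. ?F t * ?P k y t \<partial>lborel \<partial>lborel)"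
    by (rule nn_integral_cmult) measurable
  also have "(\<integral>\<^sup>+y. \<integral>\<^sup>+t. ?F t * ?P k y t \<partial>lborel \<partial>lborel) =
     (\<integral>\<^sup>+t. \<integral>\<^sup>+y. ?F t * ?P k y t \<partial>lborel \<partial>lborel)"
    by (rule lborel_pair.Fubini') measurable
  also have "\<dots> = (\<integral>\<^sup>+t. ?F t * ennreal (pi / x) \<partial>lborel)"
  proof (rule nn_integral_cong)
    fix t
    have "(\<integral>\<^sup>+y. ?F t * ?P k y t \<partial>lborel) =
      (\<integral>\<^sup>+y. ?F t * ?P k t y \<partial>lborel)"
      by (simp only: ksym[of _ t])
    also have "\<dots> = ?F t * (\<integral>\<^sup>+y. ?P k t y \<partial>lborel)"
      by (rule nn_integral_cmult) measurable
    finally show "(\<integral>\<^sup>+y. ?F t * ?P k y t \<partial>lborel) =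
      ?F t * ennreal (pi / x)" by (simp add: kint)
  qed
  also have "\<dots> = line_sq f \<sigma> * ennreal (pi / x)"
    unfolding line_sq_def by (rule nn_integral_multc) measurable
  also have "ennreal (x / pi) * (line_sq f \<sigma> * ennreal (pi / x)) = line_sq f \<sigma> * (ennreal (x / pi) * ennreal (pi / x))"
    by (simp add: mult_ac)
  also have "ennreal (x / pi) * ennreal (pi / x) = 1"
    using x by (simp add: ennreal_mult[symmetric])
  finally show ?thesis by simp
qed simp

text \<open>
  Any sequence decreasing to \<open>1/2\<close> would do; by monotonicity it computes the supremum over all lines.
\<close>

definition abscissa :: "nat \<Rightarrow> real" where
  "abscissa n = 1/2 + 1 / (real n + 1)"

lemma abscissa: "abscissa n > 1/2" "m \<le> n \<Longrightarrow> abscissa n \<le> abscissa m" "abscissa \<longlonglongrightarrow> 1/2"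
proof -
  show "abscissa n > 1/2" "m \<le> n \<Longrightarrow> abscissa n \<le> abscissa m" by (auto simp: abscissa_def frac_le)
  have "(\<lambda>n. 1/2 + 1 / (real n + 1)) \<longlonglongrightarrow> 1/2 + 0"
    using LIMSEQ_inverse_real_of_nat by (intro tendsto_intros) (simp add: inverse_eq_divide add.commute)
  then show "abscissa \<longlonglongrightarrow> 1/2" by (simp add: abscissa_def[abs_def])
qed

definition line_inner :: "nat \<Rightarrow> (complex \<Rightarrow> complex) \<Rightarrow> (complex \<Rightarrow> complex) \<Rightarrow> complex" where
  "line_inner n f g = (\<integral>t. f (Complex (abscissa n) t) * cnj (g (Complex (abscissa n) t)) \<partial>lborel) / (2 * pi)"

lemma hardy_space_integrable:
  assumes f: "f \<in> hardy_space" and \<sigma>: "1/2 < \<sigma>"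
  shows "integrable lborel (\<lambda>t. (cmod (f (Complex \<sigma> t)))\<^sup>2)"
  using f \<sigma> unfolding hardy_mem_iff using line_sq_integrable(1) by blast

lemma hardy_norm_tendsto:
  assumes f: "f \<in> hardy_space"
  shows "(\<lambda>n. (\<integral>t. (cmod (f (Complex (abscissa n) t)))\<^sup>2 \<partial>lborel) / (2 * pi)) \<longlonglongrightarrow> (hardy_norm f)\<^sup>2"
proof -
  let ?c = "ennreal (1 / (2 * pi))"
  let ?I = "\<lambda>n. \<integral>t. (cmod (f (Complex (abscissa n) t)))\<^sup>2 \<partial>lborel"
  have fin: "hardy_sq_norm f < \<infinity>" using f by (simp add: hardy_space_def)
  have eq: "?c * line_sq f (abscissa n) = ennreal (?I n / (2 * pi))" for n
    unfolding line_sq_def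
    by (subst nn_integral_eq_integral[OF hardy_space_integrable[OF f abscissa(1)]])
      (auto simp: ennreal_mult[symmetric])
  have inc: "incseq (\<lambda>n. ?c * line_sq f (abscissa n))"
    by (intro incseq_SucI mult_left_mono line_sq_antimono[OF f] abscissa) auto
  have "hardy_sq_norm f = (SUP n. ?c * line_sq f (abscissa n))"
    unfolding hardy_sq_norm_line
  proof (rule antisym)
    show "(SUP \<sigma>\<in>{1/2<..}. ?c * line_sq f \<sigma>) \<le> (SUP n. ?c * line_sq f (abscissa n))"
    proof (rule SUP_least)
      fix \<sigma> :: real assume "\<sigma> \<in> {1/2<..}"
      then have "1/2 < \<sigma>" by simp
      then obtain n where "abscissa n \<le> \<sigma>"
        using order_tendstoD(2)[OF abscissa(3)] by (meson eventually_sequentially less_imp_le order_refl)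
      then have "?c * line_sq f \<sigma> \<le> ?c * line_sq f (abscissa n)"
        by (intro mult_left_mono line_sq_antimono[OF f] abscissa) auto
      then show "?c * line_sq f \<sigma> \<le> (SUP n. ?c * line_sq f (abscissa n))"
        by (rule SUP_upper2[OF UNIV_I])
    qed
    show "(SUP n. ?c * line_sq f (abscissa n)) \<le> (SUP \<sigma>\<in>{1/2<..}. ?c * line_sq f \<sigma>)"
      by (rule SUP_least, rule SUP_upper) (use abscissa(1) in auto)
  qed
  then have "(\<lambda>n. ?c * line_sq f (abscissa n)) \<longlonglongrightarrow> hardy_sq_norm f"
    using LIMSEQ_SUP[OF inc] by simp
  then have "(\<lambda>n. enn2real (?c * line_sq f (abscissa n))) \<longlonglongrightarrow> enn2real (hardy_sq_norm f)"
    using fin by (intro tendsto_enn2real) auto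
  then show ?thesis
    unfolding eq by (simp add: hardy_norm_def)
qed

lemma hardy_norm_nonneg: "hardy_norm f \<ge> 0"
  by (simp add: hardy_norm_def)

lemma norm_add_sq_le: "(cmod (a + b))\<^sup>2 \<le> 2 * (cmod a)\<^sup>2 + 2 * (cmod b)\<^sup>2"
proof -
  have "(cmod (a + b))\<^sup>2 \<le> (cmod a + cmod b)\<^sup>2" by (simp add: norm_triangle_ineq power_mono)
  then show ?thesis
    using sum_squares_bound[of "cmod a" "cmod b"] by (simp only: power2_sum)
qed

lemma hardy_space_lin:
  assumes f: "f \<in> hardy_space" and g: "g \<in> hardy_space"
  shows "(\<lambda>z. f z + c * g z) \<in> hardy_space"
proof -
  obtain M where hf: "f holomorphic_on half_plane" and M: "M \<ge> 0" "\<And>\<sigma>. \<sigma> > 1/2 \<Longrightarrow> line_sq f \<sigma> \<le> ennreal M"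
    using f unfolding hardy_mem_iff by blast
  obtain M' where hg: "g holomorphic_on half_plane" and M': "M' \<ge> 0" "\<And>\<sigma>. \<sigma> > 1/2 \<Longrightarrow> line_sq g \<sigma> \<le> ennreal M'"
    using g unfolding hardy_mem_iff by blast
  have "line_sq (\<lambda>z. f z + c * g z) \<sigma> \<le> ennreal (2 * M + 2 * (cmod c)\<^sup>2 * M')" if \<sigma>: "\<sigma> > 1/2" for \<sigma>
  proof -
    note [measurable] = hardy_line_measurable[OF hf \<sigma>] hardy_line_measurable[OF hg \<sigma>]
    have "line_sq (\<lambda>z. f z + c * g z) \<sigma> \<le> (\<integral>\<^sup>+t. ennreal 2 * ennreal ((cmod (f (Complex \<sigma> t)))\<^sup>2) +
       ennreal (2 * (cmod c)\<^sup>2) * ennreal ((cmod (g (Complex \<sigma> t)))\<^sup>2) \<partial>lborel)"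
      unfolding line_sq_def
    proof (rule nn_integral_mono)
      fix t
      have "(cmod (f (Complex \<sigma> t) + c * g (Complex \<sigma> t)))\<^sup>2 \<le>
          2 * (cmod (f (Complex \<sigma> t)))\<^sup>2 + 2 * (cmod c)\<^sup>2 * (cmod (g (Complex \<sigma> t)))\<^sup>2"
        using norm_add_sq_le[of "f (Complex \<sigma> t)" "c * g (Complex \<sigma> t)"]
        by (simp add: norm_mult power_mult_distrib)
      then show "ennreal ((cmod (f (Complex \<sigma> t) + c * g (Complex \<sigma> t)))\<^sup>2) \<le>
        ennreal 2 * ennreal ((cmod (f (Complex \<sigma> t)))\<^sup>2) + ennreal (2 * (cmod c)\<^sup>2) * ennreal ((cmod (g (Complex \<sigma> t)))\<^sup>2)"
        by (simp only: ennreal_mult[symmetric] ennreal_plus[symmetric] ennreal_leI zero_le_power2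
            mult_nonneg_nonneg zero_le_numeral)
    qed
    also have "\<dots> = ennreal 2 * line_sq f \<sigma> + ennreal (2 * (cmod c)\<^sup>2) * line_sq g \<sigma>"
      unfolding line_sq_def by (subst nn_integral_add) (auto simp: nn_integral_cmult)
    also have "\<dots> \<le> ennreal 2 * ennreal M + ennreal (2 * (cmod c)\<^sup>2) * ennreal M'"
      by (intro add_mono mult_left_mono M M' \<sigma>) auto
    also have "\<dots> = ennreal (2 * M + 2 * (cmod c)\<^sup>2 * M')"
      using M M' by (simp only: ennreal_mult[symmetric] ennreal_plus[symmetric] zero_le_power2
            mult_nonneg_nonneg zero_le_numeral)
    finally show ?thesis .
  qed
  moreover have "(\<lambda>z. f z + c * g z) holomorphic_on half_plane"
    by (intro holomorphic_intros hf hg)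
  moreover have "0 \<le> 2 * M + 2 * (cmod c)\<^sup>2 * M'" using M M' by simp
  moreover have "\<forall>s. s \<notin> half_plane \<longrightarrow> f s + c * g s = 0"
    using f g by (simp add: hardy_space_def)
  ultimately show ?thesis unfolding hardy_mem_iff by blast
qed

lemma line_mult_integrable:
  assumes "f \<in> hardy_space" "g \<in> hardy_space" "1/2 < \<sigma>"
  shows "integrable lborel (\<lambda>t. f (Complex \<sigma> t) * cnj (g (Complex \<sigma> t)))"
proof (rule integrable_mult_of_squares)
  show "(\<lambda>t. f (Complex \<sigma> t)) \<in> borel_measurable lborel"
    by (rule hardy_line_measurable) (use assms in \<open>auto simp: hardy_space_def\<close>)
  have "(\<lambda>t. g (Complex \<sigma> t)) \<in> borel_measurable lborel"
    by (rule hardy_line_measurable) (use assms in \<open>auto simp: hardy_space_def\<close>)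
  then show "(\<lambda>t. cnj (g (Complex \<sigma> t))) \<in> borel_measurable lborel"
    by (rule measurable_compose[OF _ borel_measurable_continuous_onI]) (intro continuous_intros)
qed (use hardy_space_integrable assms in auto)

text \<open>
  Polarization turns the convergence of the line norms into that of the line inner products, so that all properties of an
  inner product pass to the limit.
\<close>

lemma line_inner_tendsto:
  assumes f: "f \<in> hardy_space" and g: "g \<in> hardy_space"
  shows "(\<lambda>n. line_inner n f g) \<longlonglongrightarrow> norm_inner hardy_norm f g"
proof -
  let ?u = "\<lambda>k z. f z + \<i> ^ k * g z"
  have u: "?u k \<in> hardy_space" for k by (rule hardy_space_lin[OF f g])
  have "(\<lambda>n. (\<Sum>k<4. \<i> ^ k * complex_of_real ((\<integral>t. (cmod (?u k (Complex (abscissa n) t)))\<^sup>2 \<partial>lborel) / (2 * pi))) / 4)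
     \<longlonglongrightarrow> (\<Sum>k<4. \<i> ^ k * complex_of_real ((hardy_norm (?u k))\<^sup>2)) / 4"
    by (intro tendsto_divide tendsto_sum tendsto_mult tendsto_const tendsto_of_real hardy_norm_tendsto u) auto
  moreover have "(\<Sum>k<4. \<i> ^ k * complex_of_real ((\<integral>t. (cmod (?u k (Complex (abscissa n) t)))\<^sup>2 \<partial>lborel) / (2 * pi))) / 4
    = line_inner n f g" for n
  proof -
    let ?z = "Complex (abscissa n)"
    have i: "integrable lborel (\<lambda>t. \<i> ^ k * complex_of_real ((cmod (?u k (?z t)))\<^sup>2))" for k
      by (intro integrable_mult_right integrable_of_real hardy_space_integrable[OF u abscissa(1)])
    have "(\<Sum>k<4. \<i> ^ k * complex_of_real ((\<integral>t. (cmod (?u k (?z t)))\<^sup>2 \<partial>lborel) / (2 * pi))) / 4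
      = (\<Sum>k<4. \<integral>t. \<i> ^ k * complex_of_real ((cmod (?u k (?z t)))\<^sup>2) \<partial>lborel) / 4 / (2 * pi)"
      by (simp add: sum_divide_distrib mult.commute flip: integral_complex_of_real)
    also have "(\<Sum>k<4. \<integral>t. \<i> ^ k * complex_of_real ((cmod (?u k (?z t)))\<^sup>2) \<partial>lborel) / 4 =
      (\<integral>t. (\<Sum>k<4. \<i> ^ k * complex_of_real ((cmod (?u k (?z t)))\<^sup>2)) / 4 \<partial>lborel)"
      using i by (subst integral_divide_zero) (simp add: Bochner_Integration.integral_sum)
    finally show ?thesis
      unfolding polarization line_inner_def .
  qed
  ultimately show ?thesis unfolding norm_inner_def by simp
qed

definition hardy_kernel :: "complex \<Rightarrow> complex \<Rightarrow> complex" where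
  "hardy_kernel w z = (if z \<in> half_plane then 1 / (z + cnj w - 1) else 0)"

lemma hardy_kernel_mem:
  assumes w: "w \<in> half_plane"
  shows "hardy_kernel w \<in> hardy_space"
  unfolding hardy_mem_iff
proof (intro conjI allI impI)
  have nz: "z + cnj w - 1 \<noteq> 0" if "z \<in> half_plane" for z
    using that w by (auto simp: half_plane_simps complex_eq_iff)
  have "(\<lambda>z. 1 / (z + cnj w - 1)) holomorphic_on half_plane"
    by (intro holomorphic_intros) (use nz in auto)
  then show "hardy_kernel w holomorphic_on half_plane"
    by (rule holomorphic_transform) (simp add: hardy_kernel_def)
  show "\<exists>M\<ge>0. \<forall>\<sigma>>1/2. line_sq (hardy_kernel w) \<sigma> \<le> ennreal M"
  proof (intro exI conjI allI impI)
    let ?x = "Re w - 1/2"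
    have x: "?x > 0" using w by (simp add: half_plane_simps)
    show "pi / ?x \<ge> 0" using x by simp
    fix \<sigma> :: real assume \<sigma>: "\<sigma> > 1/2"
    \<comment> \<open>the point to the right of the line at which the kernel has the modulus of a Cauchy kernel\<close>
    let ?v = "Complex (2 * \<sigma> - 1 + Re w) (Im w)"
    have "line_sq (hardy_kernel w) \<sigma> = (\<integral>\<^sup>+t. ennreal ((cmod (1 / (?v - Complex \<sigma> t)))\<^sup>2) \<partial>lborel)"
      unfolding line_sq_def
    proof (rule nn_integral_cong)
      fix t
      have "cmod (Complex \<sigma> t + cnj w - 1) = cmod (?v - Complex \<sigma> t)"
        by (simp add: cmod_def power2_commute algebra_simps)
      then show "ennreal ((cmod (hardy_kernel w (Complex \<sigma> t)))\<^sup>2) = ennreal ((cmod (1 / (?v - Complex \<sigma> t)))\<^sup>2)"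
        using \<sigma> by (simp add: hardy_kernel_def half_plane_simps norm_divide)
    qed
    also have "\<dots> = ennreal (pi / (Re ?v - \<sigma>))"
      by (rule poisson_kernel_integral) (use \<sigma> x in auto)
    also have "\<dots> \<le> ennreal (pi / ?x)"
      using \<sigma> x by (intro ennreal_leI divide_left_mono) auto
    finally show "line_sq (hardy_kernel w) \<sigma> \<le> ennreal (pi / ?x)" .
  qed
qed (auto simp: hardy_kernel_def)

text \<open>
  On the line \<open>Re z = \<sigma>\<close> the conjugate of the kernel is \<open>1 / (w + 2\<sigma> - 1 - z)\<close>, so the line inner product is
  \<open>f(w + 2\<sigma> - 1)\<close> by Cauchy's formula.
\<close>

lemma hardy_reproduce:
  assumes w: "w \<in> half_plane" and f: "f \<in> hardy_space"
  shows "norm_inner hardy_norm f (hardy_kernel w) = f w"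
proof -
  have hol: "f holomorphic_on half_plane" using f by (simp add: hardy_space_def)
  have eq: "line_inner n f (hardy_kernel w) = f (w + 2 * of_real (abscissa n) - 1)" for n
  proof -
    let ?\<sigma> = "abscissa n"
    let ?v = "w + 2 * of_real ?\<sigma> - 1"
    have "cnj (hardy_kernel w (Complex ?\<sigma> t)) = 1 / (?v - Complex ?\<sigma> t)" for t
    proof -
      have "cnj (Complex ?\<sigma> t + cnj w - 1) = ?v - Complex ?\<sigma> t" by (simp add: complex_eq_iff)
      then show ?thesis using abscissa(1)[of n] by (simp add: hardy_kernel_def half_plane_simps)
    qed
    then have "line_inner n f (hardy_kernel w) = (\<integral>t. f (Complex ?\<sigma> t) / (?v - Complex ?\<sigma> t) \<partial>lborel) / (2 * pi)"
      by (simp add: line_inner_def)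
    also have "(\<integral>t. f (Complex ?\<sigma> t) / (?v - Complex ?\<sigma> t) \<partial>lborel) = 2 * pi * f ?v"
      by (rule hardy_cauchy[OF f abscissa(1)]) (use abscissa(1)[of n] w in \<open>auto simp: half_plane_simps\<close>)
    finally show ?thesis by simp
  qed
  have "(\<lambda>n. f (w + 2 * of_real (abscissa n) - 1)) \<longlonglongrightarrow> f (w + 2 * of_real (1/2) - 1)"
  proof (rule isCont_tendsto_compose[where g = f])
    show "isCont f (w + 2 * complex_of_real (1 / 2) - 1)"
      using w continuous_on_interior[OF holomorphic_on_imp_continuous_on[OF hol]]
      by (simp add: interior_open half_plane_simps(1))
    show "(\<lambda>n. w + 2 * complex_of_real (abscissa n) - 1) \<longlonglongrightarrow> w + 2 * complex_of_real (1 / 2) - 1"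
      by (intro tendsto_intros abscissa)
  qed
  then have "(\<lambda>n. line_inner n f (hardy_kernel w)) \<longlonglongrightarrow> f w" unfolding eq by simp
  with line_inner_tendsto[OF f hardy_kernel_mem[OF w]] show ?thesis
    using LIMSEQ_unique by blast
qed

lemma zero_mem_hardy: "(\<lambda>_. 0) \<in> hardy_space"
  by (auto simp: hardy_mem_iff line_sq_def)

interpretation hardy: kernel_space half_plane hardy_space hardy_norm hardy_kernel
proof
  fix f g h :: "complex \<Rightarrow> complex" and c
  assume f: "f \<in> hardy_space" and g: "g \<in> hardy_space" and h: "h \<in> hardy_space"
  have eq: "line_inner n (\<lambda>x. f x + c * g x) h = line_inner n f h + c * line_inner n g h" for n
  proof -
    let ?z = "Complex (abscissa n)"
    have "(\<integral>t. (f (?z t) + c * g (?z t)) * cnj (h (?z t)) \<partial>lborel) =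
      (\<integral>t. f (?z t) * cnj (h (?z t)) + c * (g (?z t) * cnj (h (?z t))) \<partial>lborel)"
      by (simp add: algebra_simps)
    also have "\<dots> = (\<integral>t. f (?z t) * cnj (h (?z t)) \<partial>lborel) + c * (\<integral>t. g (?z t) * cnj (h (?z t)) \<partial>lborel)"
      using line_mult_integrable[OF f h abscissa(1)] line_mult_integrable[OF g h abscissa(1)] by simp
    finally show ?thesis by (simp add: line_inner_def add_divide_distrib)
  qed
  have lim: "(\<lambda>n. line_inner n f h + c * line_inner n g h) \<longlonglongrightarrow>
     norm_inner hardy_norm f h + c * norm_inner hardy_norm g h"
    by (intro tendsto_intros line_inner_tendsto f g h)
  show "norm_inner hardy_norm (\<lambda>x. f x + c * g x) h = norm_inner hardy_norm f h + c * norm_inner hardy_norm g h"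
    by (rule LIMSEQ_unique[OF line_inner_tendsto[OF hardy_space_lin[OF f g] h, of c, unfolded eq] lim])
next
  fix f g :: "complex \<Rightarrow> complex"
  assume f: "f \<in> hardy_space" and g: "g \<in> hardy_space"
  have eq: "line_inner n g f = cnj (line_inner n f g)" for n
  proof -
    let ?z = "Complex (abscissa n)"
    have "cnj (\<integral>t. f (?z t) * cnj (g (?z t)) \<partial>lborel) = (\<integral>t. cnj (f (?z t) * cnj (g (?z t))) \<partial>lborel)"
      by (rule Bochner_Integration.integral_cnj[symmetric])
    then show ?thesis by (simp add: line_inner_def mult.commute)
  qed
  have lim: "(\<lambda>n. cnj (line_inner n f g)) \<longlonglongrightarrow> cnj (norm_inner hardy_norm f g)"
    by (intro tendsto_intros line_inner_tendsto f g)
  show "norm_inner hardy_norm g f = cnj (norm_inner hardy_norm f g)"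
    by (rule LIMSEQ_unique[OF line_inner_tendsto[OF g f, unfolded eq] lim])
next
  fix f :: "complex \<Rightarrow> complex"
  assume f: "f \<in> hardy_space"
  have eq: "line_inner n f f = complex_of_real ((\<integral>t. (cmod (f (Complex (abscissa n) t)))\<^sup>2 \<partial>lborel) / (2 * pi))" for n
    unfolding line_inner_def complex_norm_square[symmetric]
    by (simp flip: integral_complex_of_real)
  have lim: "(\<lambda>n. complex_of_real ((\<integral>t. (cmod (f (Complex (abscissa n) t)))\<^sup>2 \<partial>lborel) / (2 * pi)))
     \<longlonglongrightarrow> complex_of_real ((hardy_norm f)\<^sup>2)"
    by (intro tendsto_of_real hardy_norm_tendsto f)
  show "norm_inner hardy_norm f f = complex_of_real ((hardy_norm f)\<^sup>2)"
    by (rule LIMSEQ_unique[OF line_inner_tendsto[OF f f, unfolded eq] lim])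
next
  fix f :: "complex \<Rightarrow> complex" and x
  assume "f \<in> hardy_space" "x \<notin> half_plane"
  then show "f x = 0" by (simp add: hardy_space_def)
qed (simp_all add: hardy_norm_nonneg hardy_reproduce hardy_kernel_mem zero_mem_hardy hardy_space_lin)

section \<open>The Hilbert space of Dirichlet series\<close>

lemma l2_mult_summable:
  fixes a b :: "nat \<Rightarrow> complex"
  assumes "summable (\<lambda>n. (cmod (a n))\<^sup>2)" "summable (\<lambda>n. (cmod (b n))\<^sup>2)"
  shows "summable (\<lambda>n. cmod (a n) * cmod (b n))"
proof (rule summable_comparison_test')
  show "summable (\<lambda>n. (cmod (a n))\<^sup>2 + (cmod (b n))\<^sup>2)" by (intro summable_add assms)
  fix n
  have "2 * (cmod (a n) * cmod (b n)) \<le> (cmod (a n))\<^sup>2 + (cmod (b n))\<^sup>2"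
    using sum_squares_bound[of "cmod (a n)" "cmod (b n)"] by simp
  moreover have "0 \<le> cmod (a n) * cmod (b n)" by simp
  ultimately show "norm (cmod (a n) * cmod (b n)) \<le> (cmod (a n))\<^sup>2 + (cmod (b n))\<^sup>2"
    unfolding real_norm_def by linarith
qed

lemma l2_mult_summable':
  fixes a b :: "nat \<Rightarrow> complex"
  assumes "summable (\<lambda>n. (cmod (a n))\<^sup>2)" "summable (\<lambda>n. (cmod (b n))\<^sup>2)"
  shows "summable (\<lambda>n. a n * b n)"
  using l2_mult_summable[OF assms] unfolding norm_mult[symmetric] by (rule summable_norm_cancel)

lemma cauchy_schwarz_sum:
  fixes a b :: "'a \<Rightarrow> complex"
  shows "(\<Sum>n\<in>A. cmod (a n) * cmod (b n)) \<le> sqrt (\<Sum>n\<in>A. (cmod (a n))\<^sup>2) * sqrt (\<Sum>n\<in>A. (cmod (b n))\<^sup>2)"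
  using L2_set_mult_ineq[of "\<lambda>n. cmod (a n)" "\<lambda>n. cmod (b n)" A] by (simp add: L2_set_def)

lemma l2_lin_summable:
  fixes a b :: "nat \<Rightarrow> complex"
  assumes "summable (\<lambda>n. (cmod (a n))\<^sup>2)" "summable (\<lambda>n. (cmod (b n))\<^sup>2)"
  shows "summable (\<lambda>n. (cmod (a n + c * b n))\<^sup>2)"
proof (rule summable_comparison_test')
  show "summable (\<lambda>n. 2 * (cmod (a n))\<^sup>2 + 2 * (cmod c)\<^sup>2 * (cmod (b n))\<^sup>2)"
    by (intro summable_add summable_mult assms)
  show "norm ((cmod (a n + c * b n))\<^sup>2) \<le> 2 * (cmod (a n))\<^sup>2 + 2 * (cmod c)\<^sup>2 * (cmod (b n))\<^sup>2" for n
    using norm_add_sq_le[of "a n" "c * b n"] by (simp add: norm_mult power_mult_distrib)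
qed

text \<open>
  \<open>x\<^sup>-\<^sup>s\<close> for a positive real base, written as an exponential so that the laws of exponents hold without side conditions.
\<close>

definition xpow :: "real \<Rightarrow> complex \<Rightarrow> complex" where
  "xpow x s = exp (- (s * of_real (ln x)))"

lemma norm_xpow: "cmod (xpow x s) = exp (- (Re s * ln x))"
  by (simp add: xpow_def)

lemma norm_xpow_powr: "x > 0 \<Longrightarrow> cmod (xpow x s) = x powr (- Re s)"
  by (simp add: norm_xpow powr_def)

lemma xpow_add: "xpow x (s + t) = xpow x s * xpow x t"
  by (simp add: xpow_def exp_add[symmetric] algebra_simps)

lemma cnj_xpow: "cnj (xpow x s) = xpow x (cnj s)"
  by (simp add: xpow_def exp_cnj)

lemma xpow_of_nat: "x > 0 \<Longrightarrow> xpow x (of_nat m) = 1 / of_real x ^ m"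
  by (simp add: xpow_def exp_minus exp_of_nat_mult exp_of_real inverse_eq_divide)

lemma norm_xpow_of_nat: "x > 0 \<Longrightarrow> cmod (xpow x (of_nat m)) = 1 / x ^ m"
  by (simp add: xpow_of_nat norm_divide norm_power)

lemma norm_xpow_shift: "x > 0 \<Longrightarrow> cmod (xpow x (of_nat (m + 2))) = cmod (xpow x 2) * (1 / x ^ m)"
  using norm_xpow_of_nat[of x "m + 2"] norm_xpow_of_nat[of x 2] by (simp add: power2_eq_square)

lemma xpow_holomorphic [holomorphic_intros]: "(\<lambda>s. xpow x s) holomorphic_on A"
  unfolding xpow_def by (intro holomorphic_intros)

lemma powr_conv_xpow: "of_nat (Suc n) powr (- s) = xpow (real (Suc n)) s"
proof -
  have "Ln (of_nat (Suc n)) = of_real (ln (real (Suc n)))"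
    using Ln_of_real[of "real (Suc n)"] by simp
  then show ?thesis by (simp only: powr_def xpow_def) (simp del: of_nat_Suc)
qed

lemma has_dirichlet_coeffs_xpow:
  "has_dirichlet_coeffs f a \<longleftrightarrow> summable (\<lambda>n. (cmod (a n))\<^sup>2) \<and>
     (\<forall>s\<in>half_plane. (\<lambda>n. a n * xpow (real (Suc n)) s) sums f s)"
  unfolding has_dirichlet_coeffs_def powr_conv_xpow ..

lemma xpow_l2:
  assumes "Re s > 1/2"
  shows "summable (\<lambda>n. (cmod (xpow (real (Suc n)) s))\<^sup>2)"
proof -
  have "summable (\<lambda>n. real (Suc n) powr (- 2 * Re s))"
    using assms by (subst summable_Suc_iff) (simp add: summable_real_powr_iff)
  moreover have "(cmod (xpow (real (Suc n)) s))\<^sup>2 = real (Suc n) powr (- 2 * Re s)" for n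
    by (subst norm_xpow_powr) (simp_all add: powr_power mult.commute)
  ultimately show ?thesis by (simp only:)
qed

lemma xpow_norm_mono: "x \<ge> 1 \<Longrightarrow> Re s \<le> Re t \<Longrightarrow> cmod (xpow x t) \<le> cmod (xpow x s)"
  by (simp add: norm_xpow mult_right_mono)

lemma dirichlet_abs_summable:
  assumes "summable (\<lambda>n. (cmod (a n))\<^sup>2)" "Re s > 1/2"
  shows "summable (\<lambda>n. cmod (a n * xpow (real (Suc n)) s))"
  using l2_mult_summable[OF assms(1) xpow_l2[OF assms(2)]] by (simp add: norm_mult)

text \<open>
  At \<open>s = m + 2\<close> the terms after the first nonzero one, of index \<open>N\<close>, are smaller by the factor \<open>((N + 1) / (N + 2))\<^sup>m\<close>, up
  to a constant.
\<close>

lemma dirichlet_coeffs_zero: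
  assumes c: "summable (\<lambda>n. (cmod (c n))\<^sup>2)"
    and z: "\<And>s. s \<in> half_plane \<Longrightarrow> (\<lambda>n. c n * xpow (real (Suc n)) s) sums 0"
  shows "c n = 0"
proof (induction n rule: less_induct)
  case (less N)
  define B where "B = (\<Sum>n. cmod (c (n + Suc N) * xpow (real (Suc (n + Suc N))) 2))"
  have sB: "summable (\<lambda>n. cmod (c (n + Suc N) * xpow (real (Suc (n + Suc N))) 2))"
    using dirichlet_abs_summable[OF c, of 2]
    by (subst summable_iff_shift[where f = "\<lambda>n. cmod (c n * xpow (real (Suc n)) 2)"]) simp
  have bound: "cmod (c N) \<le> (real N + 1)\<^sup>2 * B * ((real N + 1) / (real N + 2)) ^ m" for m
  proof -
    \<comment> \<open>two of the \<open>m + 2\<close> powers are kept to make the tail summable\<close>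
    let ?s = "of_nat (m + 2) :: complex"
    let ?t = "\<lambda>n. c n * xpow (real (Suc n)) ?s"
    have s: "?s \<in> half_plane" by (simp add: half_plane_simps)
    have sm: "summable (\<lambda>n. cmod (?t n))" using dirichlet_abs_summable[OF c, of ?s] s by (simp add: half_plane_simps)
    have "?t sums 0" by (rule z[OF s])
    then have "(\<lambda>n. ?t (n + Suc N)) sums (0 - (\<Sum>i<Suc N. ?t i))" by (rule sums_split_initial_segment)
    moreover have "(\<Sum>i<Suc N. ?t i) = ?t N" using less by simp
    ultimately have "(\<lambda>n. ?t (n + Suc N)) sums (- ?t N)" by simp
    then have "cmod (?t N) = cmod (\<Sum>n. ?t (n + Suc N))" by (simp add: sums_unique[symmetric])
    also have "\<dots> \<le> (\<Sum>n. cmod (?t (n + Suc N)))"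
      using sm by (intro summable_norm) (subst summable_iff_shift[where f = "\<lambda>n. cmod (?t n)"], simp)
    also have "\<dots> \<le> (\<Sum>n. cmod (c (n + Suc N) * xpow (real (Suc (n + Suc N))) 2) * (1 / (real N + 2) ^ m))"
    proof (rule suminf_le)
      fix n
      let ?x = "real (Suc (n + Suc N))"
      have x: "?x \<ge> real N + 2" by simp
      have "cmod (?t (n + Suc N)) = cmod (c (n + Suc N) * xpow ?x 2) * (1 / ?x ^ m)"
        unfolding norm_mult by (subst norm_xpow_shift) (simp, simp only: mult.assoc)
      also have "\<dots> \<le> cmod (c (n + Suc N) * xpow ?x 2) * (1 / (real N + 2) ^ m)"
        using x by (intro mult_left_mono divide_left_mono power_mono) (auto intro!: mult_pos_pos zero_less_power)
      finally show "cmod (?t (n + Suc N)) \<le> cmod (c (n + Suc N) * xpow ?x 2) * (1 / (real N + 2) ^ m)" .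
    next
      show "summable (\<lambda>n. cmod (?t (n + Suc N)))"
        using sm by (subst summable_iff_shift[where f = "\<lambda>n. cmod (?t n)"], simp)
    qed (intro summable_mult2 sB)
    also have "\<dots> = B * (1 / (real N + 2) ^ m)" unfolding B_def using sB by (rule suminf_mult2[symmetric])
    finally have "cmod (?t N) \<le> B * (1 / (real N + 2) ^ m)" .
    moreover have "cmod (?t N) = cmod (c N) / (real N + 1) ^ (m + 2)"
    proof -
      have "real N + 1 = real (Suc N)" by simp
      moreover have "cmod (?t N) = cmod (c N) * (1 / real (Suc N) ^ (m + 2))"
        unfolding norm_mult by (subst norm_xpow_of_nat) (simp, rule refl)
      ultimately show ?thesis by (simp only: times_divide_eq_right mult_1_right)
    qed
    ultimately have "cmod (c N) \<le> B * (1 / (real N + 2) ^ m) * (real N + 1) ^ (m + 2)"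
      by (simp add: pos_divide_le_eq)
    also have "\<dots> = (real N + 1)\<^sup>2 * B * ((real N + 1) / (real N + 2)) ^ m"
      by (simp add: power_divide power_add power2_eq_square)
    finally show ?thesis .
  qed
  have lim: "(\<lambda>m. (real N + 1)\<^sup>2 * B * ((real N + 1) / (real N + 2)) ^ m) \<longlonglongrightarrow> (real N + 1)\<^sup>2 * B * 0"
    by (intro tendsto_mult tendsto_const LIMSEQ_power_zero) simp
  have "cmod (c N) \<le> (real N + 1)\<^sup>2 * B * 0"
    by (rule LIMSEQ_le_const[OF lim]) (use bound in blast)
  then show ?case by simp
qed

lemma dirichlet_coeffs_lin:
  assumes "has_dirichlet_coeffs f a" "has_dirichlet_coeffs g b"
  shows "has_dirichlet_coeffs (\<lambda>z. f z + c * g z) (\<lambda>n. a n + c * b n)"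
  unfolding has_dirichlet_coeffs_xpow
proof (intro conjI ballI)
  show "summable (\<lambda>n. (cmod (a n + c * b n))\<^sup>2)"
    using assms unfolding has_dirichlet_coeffs_def by (intro l2_lin_summable) auto
  fix s assume "s \<in> half_plane"
  then have "(\<lambda>n. a n * xpow (real (Suc n)) s + c * (b n * xpow (real (Suc n)) s)) sums (f s + c * g s)"
    using assms unfolding has_dirichlet_coeffs_xpow by (intro sums_add sums_mult) auto
  then show "(\<lambda>n. (a n + c * b n) * xpow (real (Suc n)) s) sums (f s + c * g s)"
    by (simp add: algebra_simps)
qed

lemma dirichlet_coeffs_eq:
  assumes a: "has_dirichlet_coeffs f a"
  shows "dirichlet_coeffs f = a"
  unfolding dirichlet_coeffs_def
proof (rule the_equality[of "has_dirichlet_coeffs f", OF a])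
  fix b assume b: "has_dirichlet_coeffs f b"
  have *: "has_dirichlet_coeffs (\<lambda>z. f z + (-1) * f z) (\<lambda>n. b n + (-1) * a n)"
    by (rule dirichlet_coeffs_lin[OF b a])
  have "b n + (-1) * a n = 0" for n
    by (rule dirichlet_coeffs_zero[of "\<lambda>n. b n + (-1) * a n"])
      (use * in \<open>auto simp: has_dirichlet_coeffs_xpow\<close>)
  then show "b = a" by auto
qed

lemma dirichlet_norm_sq:
  assumes "has_dirichlet_coeffs f a"
  shows "(dirichlet_norm f)\<^sup>2 = (\<Sum>n. (cmod (a n))\<^sup>2)"
  using assms unfolding dirichlet_norm_def dirichlet_coeffs_eq[OF assms]
  by (simp add: suminf_nonneg has_dirichlet_coeffs_def)

lemma dirichlet_norm_inner:
  assumes a: "has_dirichlet_coeffs f a" and b: "has_dirichlet_coeffs g b"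
  shows "norm_inner dirichlet_norm f g = (\<Sum>n. a n * cnj (b n))"
proof -
  have s: "summable (\<lambda>n. (cmod (a n + \<i> ^ k * b n))\<^sup>2)" for k
    using dirichlet_coeffs_lin[OF a b, of "\<i> ^ k"] by (simp add: has_dirichlet_coeffs_def)
  have "(\<lambda>n. (\<Sum>k<4. \<i> ^ k * complex_of_real ((cmod (a n + \<i> ^ k * b n))\<^sup>2)) / 4) sums
      ((\<Sum>k<4. \<i> ^ k * complex_of_real (\<Sum>n. (cmod (a n + \<i> ^ k * b n))\<^sup>2)) / 4)"
    by (intro sums_divide sums_sum sums_mult sums_of_real summable_sums s)
  then show ?thesis
    unfolding polarization norm_inner_def dirichlet_norm_sq[OF dirichlet_coeffs_lin[OF a b]]
    by (rule sums_unique)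
qed

definition dirichlet_kernel :: "complex \<Rightarrow> complex \<Rightarrow> complex" where
  "dirichlet_kernel w z = (if z \<in> half_plane then \<Sum>n. cnj (xpow (real (Suc n)) w) * xpow (real (Suc n)) z else 0)"

lemma dirichlet_kernel_coeffs:
  assumes w: "w \<in> half_plane"
  shows "has_dirichlet_coeffs (dirichlet_kernel w) (\<lambda>n. cnj (xpow (real (Suc n)) w))"
  unfolding has_dirichlet_coeffs_xpow
proof (intro conjI ballI)
  show 1: "summable (\<lambda>n. (cmod (cnj (xpow (real (Suc n)) w)))\<^sup>2)"
    unfolding complex_mod_cnj by (rule xpow_l2) (use w in \<open>simp add: half_plane_simps\<close>)
  fix s assume s: "s \<in> half_plane"
  then show "(\<lambda>n. cnj (xpow (real (Suc n)) w) * xpow (real (Suc n)) s) sums dirichlet_kernel w s"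
    unfolding dirichlet_kernel_def using l2_mult_summable'[OF 1 xpow_l2, of s]
    by (simp add: half_plane_simps summable_sums del: of_nat_Suc)
qed

lemma mem_dirichlet_space:
  "f \<in> dirichlet_space \<longleftrightarrow> (\<exists>a. has_dirichlet_coeffs f a) \<and> (\<forall>s. s \<notin> half_plane \<longrightarrow> f s = 0)"
  by (simp add: dirichlet_space_def)

interpretation dirichlet: kernel_space half_plane dirichlet_space dirichlet_norm dirichlet_kernel
proof
  show "(\<lambda>_. 0) \<in> dirichlet_space"
    unfolding mem_dirichlet_space has_dirichlet_coeffs_def by (auto intro!: exI[of _ "\<lambda>_. 0"])
next
  fix f g :: "complex \<Rightarrow> complex" and c
  assume "f \<in> dirichlet_space" "g \<in> dirichlet_space"
  then show "(\<lambda>x. f x + c * g x) \<in> dirichlet_space"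
    unfolding mem_dirichlet_space using dirichlet_coeffs_lin[of f _ g _ c] by auto
next
  fix f g h :: "complex \<Rightarrow> complex" and c
  assume "f \<in> dirichlet_space" "g \<in> dirichlet_space" "h \<in> dirichlet_space"
  then obtain a b e where abc: "has_dirichlet_coeffs f a" "has_dirichlet_coeffs g b" "has_dirichlet_coeffs h e"
    unfolding mem_dirichlet_space by auto
  have "summable (\<lambda>n. a n * cnj (e n))" "summable (\<lambda>n. b n * cnj (e n))"
    using abc by (auto intro!: l2_mult_summable' simp: has_dirichlet_coeffs_def)
  then have "(\<Sum>n. a n * cnj (e n) + c * (b n * cnj (e n))) = (\<Sum>n. a n * cnj (e n)) + c * (\<Sum>n. b n * cnj (e n))"
    by (subst suminf_add[symmetric]) (auto simp: suminf_mult intro: summable_mult)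
  then show "norm_inner dirichlet_norm (\<lambda>x. f x + c * g x) h =
      norm_inner dirichlet_norm f h + c * norm_inner dirichlet_norm g h"
    using dirichlet_norm_inner[OF dirichlet_coeffs_lin[OF abc(1,2)] abc(3), of c]
      dirichlet_norm_inner[OF abc(1,3)] dirichlet_norm_inner[OF abc(2,3)]
    by (simp add: algebra_simps)
next
  fix f g :: "complex \<Rightarrow> complex"
  assume "f \<in> dirichlet_space" "g \<in> dirichlet_space"
  then obtain a b where ab: "has_dirichlet_coeffs f a" "has_dirichlet_coeffs g b"
    unfolding mem_dirichlet_space by auto
  have "summable (\<lambda>n. a n * cnj (b n))"
    using ab by (auto intro!: l2_mult_summable' simp: has_dirichlet_coeffs_def)
  then have "(\<lambda>n. cnj (a n * cnj (b n))) sums cnj (\<Sum>n. a n * cnj (b n))"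
    unfolding sums_cnj by (rule summable_sums)
  then show "norm_inner dirichlet_norm g f = cnj (norm_inner dirichlet_norm f g)"
    unfolding dirichlet_norm_inner[OF ab] dirichlet_norm_inner[OF ab(2,1)]
    by (simp add: sums_iff mult.commute)
next
  fix f :: "complex \<Rightarrow> complex"
  assume "f \<in> dirichlet_space"
  then obtain a where a: "has_dirichlet_coeffs f a" unfolding mem_dirichlet_space by auto
  then have "summable (\<lambda>n. (cmod (a n))\<^sup>2)" by (simp add: has_dirichlet_coeffs_def)
  then show "norm_inner dirichlet_norm f f = complex_of_real ((dirichlet_norm f)\<^sup>2)"
    unfolding dirichlet_norm_inner[OF a a] dirichlet_norm_sq[OF a] complex_norm_square[symmetric]
    by (rule suminf_of_real[symmetric])
  show "dirichlet_norm f \<ge> 0"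
    unfolding dirichlet_norm_def dirichlet_coeffs_eq[OF a] using a
    by (simp add: suminf_nonneg has_dirichlet_coeffs_def)
next
  fix f :: "complex \<Rightarrow> complex" and x
  assume "f \<in> dirichlet_space" "x \<notin> half_plane"
  then show "f x = 0" by (simp add: mem_dirichlet_space)
next
  fix w assume w: "w \<in> half_plane"
  show "dirichlet_kernel w \<in> dirichlet_space"
    unfolding mem_dirichlet_space
  proof (intro conjI allI impI)
    show "\<exists>a. has_dirichlet_coeffs (dirichlet_kernel w) a" using dirichlet_kernel_coeffs[OF w] by blast
    show "dirichlet_kernel w s = 0" if "s \<notin> half_plane" for s using that by (simp add: dirichlet_kernel_def)
  qed
  fix f assume "f \<in> dirichlet_space"
  then obtain a where a: "has_dirichlet_coeffs f a" unfolding mem_dirichlet_space by auto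
  then have "(\<lambda>n. a n * xpow (real (Suc n)) w) sums f w"
    using w by (simp add: has_dirichlet_coeffs_xpow)
  then show "norm_inner dirichlet_norm f (dirichlet_kernel w) = f w"
    using dirichlet_norm_inner[OF a dirichlet_kernel_coeffs[OF w]] by (simp add: sums_iff)
qed

lemma powr_telescope:
  fixes d :: real
  assumes "d > 0"
  shows "(\<lambda>n. real (Suc n) powr (-d) - real (Suc (Suc n)) powr (-d)) sums 1"
proof -
  have "(\<lambda>n. real (Suc n) powr (-d)) \<longlonglongrightarrow> 0"
    using assms by (intro tendsto_neg_powr filterlim_compose[OF filterlim_real_sequentially filterlim_Suc]) auto
  from telescope_sums'[OF this] show ?thesis by simp
qed

lemma powr_diff_bounds:
  fixes d x :: real
  assumes "d > 0" "x > 0"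
  shows "d * (x + 1) powr (- d - 1) \<le> x powr (-d) - (x + 1) powr (-d)"
    and "x powr (-d) - (x + 1) powr (-d) \<le> d * x powr (- d - 1)"
proof -
  have "\<exists>z>x. z < x + 1 \<and> (x + 1) powr (-d) - x powr (-d) = (x + 1 - x) * (- d * z powr (- d - 1))"
    by (rule MVT2) (use assms in \<open>auto intro!: derivative_eq_intros simp: algebra_simps powr_diff\<close>)
  then obtain z where z: "x < z" "z < x + 1" "(x + 1) powr (-d) - x powr (-d) = - d * z powr (- d - 1)" by auto
  have "z powr (- d - 1) \<le> x powr (- d - 1)" "(x + 1) powr (- d - 1) \<le> z powr (- d - 1)"
    using z assms by (auto intro!: powr_mono2')
  then have "d * z powr (- d - 1) \<le> d * x powr (- d - 1)"
    "d * (x + 1) powr (- d - 1) \<le> d * z powr (- d - 1)"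
    using assms by (auto intro: mult_left_mono)
  then show "d * (x + 1) powr (- d - 1) \<le> x powr (-d) - (x + 1) powr (-d)"
    "x powr (-d) - (x + 1) powr (-d) \<le> d * x powr (- d - 1)"
    using z(3) by (simp_all only: mult_minus_left)
qed

text \<open>
  \<open>\<zeta>(1 + d)\<close> is compared with \<open>1 / d\<close> by telescoping \<open>n\<^sup>-\<^sup>d - (n + 1)\<^sup>-\<^sup>d\<close>, which the mean value theorem traps between the values
  of \<open>d x\<^sup>-\<^sup>d\<^sup>-\<^sup>1\<close> at \<open>n + 1\<close> and at \<open>n\<close>.
\<close>

lemma dirichlet_kernel_norm:
  assumes w: "w \<in> half_plane"
  defines "d \<equiv> 2 * Re w - 1"
  shows "1 / d \<le> (dirichlet_norm (dirichlet_kernel w))\<^sup>2" "(dirichlet_norm (dirichlet_kernel w))\<^sup>2 \<le> 1 + 1 / d"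
proof -
  have d: "d > 0" using w by (simp add: d_def half_plane_simps)
  define f where "f n = real (Suc n) powr (- d - 1)" for n
  have f: "(cmod (cnj (xpow (real (Suc n)) w)))\<^sup>2 = f n" for n
    unfolding complex_mod_cnj f_def d_def by (subst norm_xpow_powr) (simp_all add: powr_power mult.commute)
  have sf: "summable f"
  proof -
    have "summable (\<lambda>n. (cmod (cnj (xpow (real (Suc n)) w)))\<^sup>2)"
      unfolding complex_mod_cnj by (rule xpow_l2) (use w in \<open>simp add: half_plane_simps\<close>)
    then show ?thesis unfolding f .
  qed
  have f0: "f 0 = 1" by (simp add: f_def)
  have pos: "0 < real (Suc n)" for n by simp
  have e: "real (Suc n) + 1 = real (Suc (Suc n))" for n by simp
  have N: "(dirichlet_norm (dirichlet_kernel w))\<^sup>2 = suminf f"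
    using dirichlet_norm_sq[OF dirichlet_kernel_coeffs[OF w]] unfolding f .
  let ?t = "\<lambda>n. real (Suc n) powr (-d) - real (Suc (Suc n)) powr (-d)"
  have "1 = suminf ?t" using powr_telescope[OF d] by (simp add: sums_iff)
  also have "\<dots> \<le> (\<Sum>n. d * f n)"
  proof (rule suminf_le)
    show "?t n \<le> d * f n" for n
      using powr_diff_bounds(2)[OF d pos, of n] unfolding f_def e .
    show "summable ?t" by (rule sums_summable[OF powr_telescope[OF d]])
    show "summable (\<lambda>n. d * f n)" by (rule summable_mult[OF sf])
  qed
  also have "\<dots> = d * suminf f" by (rule suminf_mult[OF sf])
  finally show "1 / d \<le> (dirichlet_norm (dirichlet_kernel w))\<^sup>2"
    unfolding N using d by (simp add: pos_divide_le_eq mult.commute)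
  have sf': "summable (\<lambda>n. f (Suc n))" using sf by (simp add: summable_Suc_iff)
  have "d * (\<Sum>n. f (Suc n)) = (\<Sum>n. d * f (Suc n))" by (rule suminf_mult[OF sf', symmetric])
  also have "\<dots> \<le> suminf ?t"
  proof (rule suminf_le)
    show "d * f (Suc n) \<le> ?t n" for n
      using powr_diff_bounds(1)[OF d pos, of n] unfolding f_def e .
    show "summable ?t" by (rule sums_summable[OF powr_telescope[OF d]])
    show "summable (\<lambda>n. d * f (Suc n))" by (rule summable_mult[OF sf'])
  qed
  also have "\<dots> = 1" using powr_telescope[OF d] by (simp add: sums_iff)
  finally have "(\<Sum>n. f (Suc n)) \<le> 1 / d" using d by (simp add: pos_le_divide_eq mult.commute)
  then show "(dirichlet_norm (dirichlet_kernel w))\<^sup>2 \<le> 1 + 1 / d"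
    unfolding N using suminf_split_head[OF sf] f0 by linarith
qed

section \<open>Embedding Dirichlet series into the Hardy space\<close>

definition embedded_term :: "nat \<Rightarrow> complex \<Rightarrow> complex" where
  "embedded_term n z = xpow (real (Suc n)) z / (z + 1)"

text \<open>
  Dividing by \<open>s + 1\<close> rather than by \<open>s\<close> gains the factor \<open>min / max\<close>, so that the row sums of this matrix are bounded and
  Schur's test works with constant weights.
\<close>

definition gram_bound :: "nat \<Rightarrow> nat \<Rightarrow> real" where
  "gram_bound m n = real (Suc (min m n)) / (real (Suc (max m n)))\<^sup>2"

lemma gram_bound_sym: "gram_bound m n = gram_bound n m"
  by (simp add: gram_bound_def min.commute max.commute)

lemma gram_bound_row_sum: "(\<Sum>n<N. gram_bound m n) \<le> 2"
proof -
  have 1: "(\<Sum>n<k. gram_bound m n) \<le> 1" if "k \<le> Suc m" for k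
  proof -
    have "(\<Sum>n<k. gram_bound m n) \<le> (\<Sum>n<k. 1 / real (Suc m))"
    proof (rule sum_mono)
      fix n assume "n \<in> {..<k}"
      then have nm: "n \<le> m" using that by auto
      have "gram_bound m n = real (Suc n) / (real (Suc m))\<^sup>2" using nm by (simp add: gram_bound_def min_def max_def)
      also have "\<dots> \<le> real (Suc m) / (real (Suc m))\<^sup>2" using nm by (intro divide_right_mono) auto
      also have "\<dots> = 1 / real (Suc m)" by (simp add: power2_eq_square del: of_nat_Suc)
      finally show "gram_bound m n \<le> 1 / real (Suc m)" .
    qed
    also have "\<dots> = real k / real (Suc m)" by simp
    also have "\<dots> \<le> 1" using that by simp
    finally show ?thesis .
  qed
  have 2: "(\<Sum>n<Suc m + k. gram_bound m n) \<le> 1 + real (Suc m) * (1 / real (Suc m) - 1 / real (Suc m + k))" for k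
  proof (induction k)
    case 0
    then show ?case using 1[of "Suc m"] by simp
  next
    case (Suc k)
    let ?x = "real (Suc m + k)"
    have x: "?x > 0" by simp
    have "gram_bound m (Suc m + k) = real (Suc m) / (?x + 1)\<^sup>2" by (simp add: gram_bound_def min_def max_def add.commute)
    also have "\<dots> \<le> real (Suc m) / (?x * (?x + 1))"
      using x by (intro divide_left_mono) (auto simp: power2_eq_square)
    also have "\<dots> = real (Suc m) * (1 / ?x - 1 / (?x + 1))"
      using x by (simp add: field_simps del: of_nat_Suc of_nat_add)
    finally have "gram_bound m (Suc m + k) \<le> real (Suc m) * (1 / ?x - 1 / (?x + 1))" .
    moreover have "(\<Sum>n<Suc m + Suc k. gram_bound m n) = (\<Sum>n<Suc m + k. gram_bound m n) + gram_bound m (Suc m + k)" by simp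
    moreover have "real (Suc m + Suc k) = ?x + 1" by simp
    ultimately show ?case using Suc.IH by (simp only: right_diff_distrib)
  qed
  show ?thesis
  proof (cases "N \<le> Suc m")
    case True
    then show ?thesis using 1[of N] by simp
  next
    case False
    then obtain k where N: "N = Suc m + k" by (metis le_add_diff_inverse nat_le_linear)
    have "real (Suc m) * (1 / real (Suc m) - 1 / real (Suc m + k)) \<le> real (Suc m) * (1 / real (Suc m))"
      by (intro mult_left_mono) auto
    also have "\<dots> = 1" by simp
    finally show ?thesis using 2[of k] unfolding N by linarith
  qed
qed

lemma gram_bound_schur:
  fixes a :: "nat \<Rightarrow> complex"
  shows "(\<Sum>m<N. \<Sum>n<N. cmod (a m) * cmod (a n) * gram_bound m n) \<le> 2 * (\<Sum>n<N. (cmod (a n))\<^sup>2)"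
proof -
  have b0: "gram_bound m n \<ge> 0" for m n by (simp add: gram_bound_def)
  have "(\<Sum>m<N. \<Sum>n<N. cmod (a m) * cmod (a n) * gram_bound m n) \<le>
     (\<Sum>m<N. \<Sum>n<N. (cmod (a m))\<^sup>2 / 2 * gram_bound m n + (cmod (a n))\<^sup>2 / 2 * gram_bound m n)"
  proof (intro sum_mono)
    fix m n
    have "cmod (a m) * cmod (a n) \<le> (cmod (a m))\<^sup>2 / 2 + (cmod (a n))\<^sup>2 / 2"
      using sum_squares_bound[of "cmod (a m)" "cmod (a n)"] by simp
    from mult_right_mono[OF this b0[of m n]]
    show "cmod (a m) * cmod (a n) * gram_bound m n \<le> (cmod (a m))\<^sup>2 / 2 * gram_bound m n + (cmod (a n))\<^sup>2 / 2 * gram_bound m n"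
      by (simp add: distrib_right)
  qed
  also have "\<dots> = (\<Sum>m<N. \<Sum>n<N. (cmod (a m))\<^sup>2 / 2 * gram_bound m n) + (\<Sum>m<N. \<Sum>n<N. (cmod (a n))\<^sup>2 / 2 * gram_bound m n)"
    by (simp add: sum.distrib)
  also have "(\<Sum>m<N. \<Sum>n<N. (cmod (a n))\<^sup>2 / 2 * gram_bound m n) = (\<Sum>m<N. \<Sum>n<N. (cmod (a m))\<^sup>2 / 2 * gram_bound m n)"
    by (subst sum.swap) (simp add: gram_bound_sym)
  also have "(\<Sum>m<N. \<Sum>n<N. (cmod (a m))\<^sup>2 / 2 * gram_bound m n) + (\<Sum>m<N. \<Sum>n<N. (cmod (a m))\<^sup>2 / 2 * gram_bound m n)
     = (\<Sum>m<N. (cmod (a m))\<^sup>2 * (\<Sum>n<N. gram_bound m n))"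
    by (simp add: sum_distrib_left flip: sum.distrib) (simp add: mult.commute)
  also have "\<dots> \<le> (\<Sum>m<N. (cmod (a m))\<^sup>2 * 2)"
    by (intro sum_mono mult_left_mono gram_bound_row_sum) auto
  finally show ?thesis by (simp add: sum_distrib_left mult.commute)
qed

text \<open>
  On the line, \<open>cnj z = 2\<sigma> - z\<close> turns the product into a constant times \<open>g(z) / (2\<sigma> + 1 - z)\<close>, where \<open>g(z)\<close> is
  \<open>((m + 1) / (n + 1))\<^sup>-\<^sup>z / (z + 1)\<close>.  For \<open>n \<le> m\<close> this \<open>g\<close> decays in the half-plane, so Cauchy's formula evaluates the integral.
\<close>

lemma embedded_term_inner_le:
  assumes \<sigma>: "1/2 < \<sigma>" and nm: "n \<le> m"
  shows "integrable lborel (\<lambda>t. embedded_term m (Complex \<sigma> t) * cnj (embedded_term n (Complex \<sigma> t)))"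
    and "cmod (\<integral>t. embedded_term m (Complex \<sigma> t) * cnj (embedded_term n (Complex \<sigma> t)) \<partial>lborel) \<le> 2 * pi * gram_bound m n"
proof -
  let ?e = "\<lambda>n t. embedded_term n (Complex \<sigma> t)"
  define lm ln' where "lm = ln (real (Suc m))" and "ln' = ln (real (Suc n))"
  have l: "0 \<le> ln'" "ln' \<le> lm" using nm by (auto simp: lm_def ln'_def)
  define w where "w = complex_of_real (2 * \<sigma> + 1)"
  define g where "g z = exp (- (z * of_real (lm - ln'))) / (z + 1)" for z :: complex
  have eq: "?e m t * cnj (?e n t) =
     of_real (exp (- (2 * \<sigma> * ln'))) * (g (Complex \<sigma> t) / (w - Complex \<sigma> t))" for t
  proof -
    let ?z = "Complex \<sigma> t"
    have 1: "cnj ?z + 1 = w - ?z" by (simp add: w_def complex_eq_iff)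
    have 2: "cnj ?z = of_real (2 * \<sigma>) - ?z" by (simp add: complex_eq_iff)
    have "exp (- (?z * of_real lm)) * exp (- (cnj ?z * of_real ln')) =
       of_real (exp (- (2 * \<sigma> * ln'))) * exp (- (?z * of_real (lm - ln')))"
      unfolding 2 exp_of_real[symmetric] exp_add[symmetric] by (rule arg_cong[where f = exp]) (simp add: algebra_simps)
    then show ?thesis
      unfolding embedded_term_def g_def complex_cnj_divide cnj_xpow complex_cnj_add complex_cnj_one 1
      by (simp add: xpow_def lm_def ln'_def)
  qed
  have hol: "g holomorphic_on {z. 0 < Re z}"
    unfolding g_def by (intro holomorphic_intros) (auto simp: complex_eq_iff)
  have decay: "cmod (g z) * (1 + cmod z) \<le> 2" if z: "\<sigma> \<le> Re z" for z
  proof -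
    have "0 < Re z" using z \<sigma> by simp
    then have "cmod (exp (- (z * of_real (lm - ln')))) \<le> 1" using l by simp
    moreover have 1: "1 \<le> cmod (z + 1)" using complex_Re_le_cmod[of "z + 1"] \<open>0 < Re z\<close> by simp
    moreover have "cmod z \<le> cmod (z + 1)"
      by (rule power2_le_imp_le) (use \<open>0 < Re z\<close> in \<open>simp_all add: cmod_power2 power_mono\<close>)
    then have "(1 + cmod z) / cmod (z + 1) \<le> 2" using 1 by (subst pos_divide_le_eq) linarith+
    moreover have "cmod (g z) * (1 + cmod z) = cmod (exp (- (z * of_real (lm - ln')))) * ((1 + cmod z) / cmod (z + 1))"
      by (simp add: g_def norm_divide del: norm_exp_eq_Re)
    ultimately show ?thesis
      using mult_mono[of "cmod (exp (- (z * of_real (lm - ln'))))" 1 "(1 + cmod z) / cmod (z + 1)" 2] by simp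
  qed
  have w: "\<sigma> < Re w" using \<sigma> by (simp add: w_def)
  have 0: "0 < \<sigma>" using \<sigma> by simp
  note L = cauchy_line_decay[OF hol 0 w 0 decay]
  show "integrable lborel (\<lambda>t. ?e m t * cnj (?e n t))"
    unfolding eq by (rule integrable_mult_right[OF L(1)])
  have "(\<integral>t. ?e m t * cnj (?e n t) \<partial>lborel) =
      of_real (exp (- (2 * \<sigma> * ln'))) * (2 * pi * g w)"
    unfolding eq by (simp only: integral_mult_right_zero) (simp add: L(2))
  then have "cmod (\<integral>t. ?e m t * cnj (?e n t) \<partial>lborel) =
      exp (- (2 * \<sigma> * ln')) * (2 * pi) * cmod (g w)"
    by (simp add: norm_mult)
  also have "cmod (g w) = exp (- ((2 * \<sigma> + 1) * (lm - ln'))) / (2 * \<sigma> + 2)"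
  proof -
    have "w + 1 = of_real (2 * \<sigma> + 2)" by (simp add: w_def)
    then have "cmod (w + 1) = 2 * \<sigma> + 2" using \<sigma> by (simp only: norm_of_real)
    then show ?thesis by (simp add: g_def norm_divide w_def)
  qed
  also have "exp (- (2 * \<sigma> * ln')) * (2 * pi) * (exp (- ((2 * \<sigma> + 1) * (lm - ln'))) / (2 * \<sigma> + 2)) \<le>
     2 * pi * exp (ln' - 2 * lm)"
  proof -
    have "exp (- (2 * \<sigma> * ln')) * (2 * pi) * (exp (- ((2 * \<sigma> + 1) * (lm - ln'))) / (2 * \<sigma> + 2)) =
       2 * pi * (exp (ln' - (2 * \<sigma> + 1) * lm) / (2 * \<sigma> + 2))"
      by (simp add: exp_add[symmetric] algebra_simps)
    also have "exp (ln' - (2 * \<sigma> + 1) * lm) / (2 * \<sigma> + 2) \<le> exp (ln' - 2 * lm) / 1"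
      using \<sigma> l by (intro frac_le) (auto intro!: mult_right_mono)
    finally show ?thesis by simp
  qed
  also have "exp (ln' - 2 * lm) = gram_bound m n"
    using nm by (simp add: exp_diff lm_def ln'_def gram_bound_def min_def max_def exp_double del: of_nat_Suc)
  finally show "cmod (\<integral>t. ?e m t * cnj (?e n t) \<partial>lborel) \<le> 2 * pi * gram_bound m n" .
qed

lemma embedded_term_inner:
  assumes \<sigma>: "1/2 < \<sigma>"
  shows "integrable lborel (\<lambda>t. embedded_term m (Complex \<sigma> t) * cnj (embedded_term n (Complex \<sigma> t)))"
    and "cmod (\<integral>t. embedded_term m (Complex \<sigma> t) * cnj (embedded_term n (Complex \<sigma> t)) \<partial>lborel) \<le> 2 * pi * gram_bound m n"
proof -
  let ?e = "\<lambda>n t. embedded_term n (Complex \<sigma> t)"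
  have "integrable lborel (\<lambda>t. ?e m t * cnj (?e n t)) \<and>
    cmod (\<integral>t. ?e m t * cnj (?e n t) \<partial>lborel) \<le> 2 * pi * gram_bound m n"
  proof (cases "n \<le> m")
    case True
    then show ?thesis using embedded_term_inner_le[OF \<sigma> True] by blast
  next
    case False
    then have mn: "m \<le> n" by simp
    have eq: "?e m t * cnj (?e n t) =
       cnj (?e n t * cnj (?e m t))" for t by simp
    show ?thesis
      unfolding eq Bochner_Integration.integral_cnj complex_mod_cnj gram_bound_sym[of m]
      using embedded_term_inner_le[OF \<sigma> mn] integrable_cnj by blast
  qed
  then show "integrable lborel (\<lambda>t. ?e m t * cnj (?e n t))"
    "cmod (\<integral>t. ?e m t * cnj (?e n t) \<partial>lborel) \<le> 2 * pi * gram_bound m n"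
    by auto
qed

lemma embedded_partial_sum_line_sq:
  assumes \<sigma>: "1/2 < \<sigma>"
  shows "line_sq (\<lambda>z. \<Sum>n<N. a n * embedded_term n z) \<sigma> \<le> ennreal (4 * pi * (\<Sum>n<N. (cmod (a n))\<^sup>2))"
proof -
  let ?z = "Complex \<sigma>"
  let ?e = "\<lambda>m n t. embedded_term m (?z t) * cnj (embedded_term n (?z t))"
  let ?S = "\<lambda>t. \<Sum>n<N. a n * embedded_term n (?z t)"
  have i: "integrable lborel (\<lambda>t. a m * cnj (a n) * ?e m n t)" for m n
    by (intro integrable_mult_right embedded_term_inner(1)[OF \<sigma>])
  have eq: "complex_of_real ((cmod (?S t))\<^sup>2) = (\<Sum>m<N. \<Sum>n<N. a m * cnj (a n) * ?e m n t)" for t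
    unfolding complex_norm_square by (simp add: sum_product mult_ac)
  have ci: "integrable lborel (\<lambda>t. complex_of_real ((cmod (?S t))\<^sup>2))"
    unfolding eq by (intro Bochner_Integration.integrable_sum i)
  then have ri: "integrable lborel (\<lambda>t. (cmod (?S t))\<^sup>2)" by (simp only: complex_of_real_integrable_eq)
  have "complex_of_real (\<integral>t. (cmod (?S t))\<^sup>2 \<partial>lborel) = (\<integral>t. (\<Sum>m<N. \<Sum>n<N. a m * cnj (a n) * ?e m n t) \<partial>lborel)"
    unfolding eq[symmetric] by (rule integral_complex_of_real[symmetric])
  also have "\<dots> = (\<Sum>m<N. \<Sum>n<N. a m * cnj (a n) * (\<integral>t. ?e m n t \<partial>lborel))"
    using i by (simp add: Bochner_Integration.integral_sum Bochner_Integration.integrable_sum embedded_term_inner(1)[OF \<sigma>])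
  finally have "cmod (complex_of_real (\<integral>t. (cmod (?S t))\<^sup>2 \<partial>lborel)) \<le>
     (\<Sum>m<N. \<Sum>n<N. cmod (a m * cnj (a n) * (\<integral>t. ?e m n t \<partial>lborel)))"
    by (simp only:) (intro order.trans[OF norm_sum] sum_mono norm_sum order_refl)
  also have "\<dots> \<le> (\<Sum>m<N. \<Sum>n<N. 2 * pi * (cmod (a m) * cmod (a n) * gram_bound m n))"
  proof (intro sum_mono)
    fix m n
    have "cmod (a m * cnj (a n) * (\<integral>t. ?e m n t \<partial>lborel)) \<le> cmod (a m) * cmod (a n) * (2 * pi * gram_bound m n)"
      unfolding norm_mult complex_mod_cnj by (intro mult_left_mono embedded_term_inner(2)[OF \<sigma>]) auto
    then show "cmod (a m * cnj (a n) * (\<integral>t. ?e m n t \<partial>lborel)) \<le> 2 * pi * (cmod (a m) * cmod (a n) * gram_bound m n)"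
      by (simp add: mult_ac)
  qed
  also have "\<dots> = 2 * pi * (\<Sum>m<N. \<Sum>n<N. cmod (a m) * cmod (a n) * gram_bound m n)"
    by (simp add: sum_distrib_left)
  also have "\<dots> \<le> 2 * pi * (2 * (\<Sum>n<N. (cmod (a n))\<^sup>2))"
    by (intro mult_left_mono gram_bound_schur) auto
  finally have "\<bar>\<integral>t. (cmod (?S t))\<^sup>2 \<partial>lborel\<bar> \<le> 4 * pi * (\<Sum>n<N. (cmod (a n))\<^sup>2)" by simp
  then have le: "(\<integral>t. (cmod (?S t))\<^sup>2 \<partial>lborel) \<le> 4 * pi * (\<Sum>n<N. (cmod (a n))\<^sup>2)" by linarith
  have "line_sq (\<lambda>z. \<Sum>n<N. a n * embedded_term n z) \<sigma> = ennreal (\<integral>t. (cmod (?S t))\<^sup>2 \<partial>lborel)"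
    unfolding line_sq_def by (rule nn_integral_eq_integral[OF ri]) auto
  then show ?thesis using le by (simp add: ennreal_leI)
qed

lemma dirichlet_holomorphic:
  assumes f: "has_dirichlet_coeffs f a"
  shows "f holomorphic_on half_plane"
proof (rule holomorphic_uniform_sequence[OF half_plane_simps(1)])
  show "(\<lambda>z. \<Sum>n<N. a n * xpow (real (Suc n)) z) holomorphic_on half_plane" for N
    by (intro holomorphic_intros)
  fix x assume x: "x \<in> half_plane"
  define d where "d = (Re x - 1/2) / 2"
  have d: "d > 0" using x by (simp add: d_def half_plane_simps)
  have re: "1/2 + d \<le> Re z" if "z \<in> cball x d" for z
  proof -
    have "\<bar>Re (x - z)\<bar> \<le> d" using that abs_Re_le_cmod[of "x - z"] by (simp add: dist_norm)
    then show ?thesis unfolding d_def minus_complex.sel by argo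
  qed
  let ?s = "complex_of_real (1/2 + d)"
  have u: "uniform_limit (cball x d) (\<lambda>N z. \<Sum>n<N. a n * xpow (real (Suc n)) z)
      (\<lambda>z. \<Sum>n. a n * xpow (real (Suc n)) z) sequentially"
  proof (rule Weierstrass_m_test)
    show "summable (\<lambda>n. cmod (a n * xpow (real (Suc n)) ?s))"
      by (rule dirichlet_abs_summable) (use f d in \<open>auto simp: has_dirichlet_coeffs_def\<close>)
    fix n z assume "z \<in> cball x d"
    then show "cmod (a n * xpow (real (Suc n)) z) \<le> cmod (a n * xpow (real (Suc n)) ?s)"
      unfolding norm_mult using re by (intro mult_left_mono xpow_norm_mono) auto
  qed
  have sub: "cball x d \<subseteq> half_plane"
    using re d by (force simp: half_plane_simps)
  have e: "(\<Sum>n. a n * xpow (real (Suc n)) z) = f z" if "z \<in> cball x d" for z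
    using f sub that unfolding has_dirichlet_coeffs_xpow by (intro sums_unique[symmetric]) blast
  have "uniform_limit (cball x d) (\<lambda>N z. \<Sum>n<N. a n * xpow (real (Suc n)) z) f sequentially"
    by (rule iffD1[OF uniform_limit_cong'[OF refl e] u])
  then show "\<exists>d>0. cball x d \<subseteq> half_plane \<and>
      uniform_limit (cball x d) (\<lambda>N z. \<Sum>n<N. a n * xpow (real (Suc n)) z) f sequentially"
    using d sub by blast
qed

text \<open>
  The partial sums are bounded in the Hardy norm by Schur's test, and Fatou's lemma passes the bound to the limit.
\<close>

lemma dirichlet_embedding:
  assumes f: "f \<in> dirichlet_space"
  shows "(\<lambda>z. f z / (z + 1)) \<in> hardy_space"
proof -
  obtain a where a: "has_dirichlet_coeffs f a" and out: "\<And>s. s \<notin> half_plane \<Longrightarrow> f s = 0"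
    using f unfolding mem_dirichlet_space by blast
  define M where "M = 4 * pi * (\<Sum>n. (cmod (a n))\<^sup>2)"
  have sa: "summable (\<lambda>n. (cmod (a n))\<^sup>2)" using a by (simp add: has_dirichlet_coeffs_def)
  have M0: "M \<ge> 0" by (simp add: M_def suminf_nonneg[OF sa])
  have "line_sq (\<lambda>z. f z / (z + 1)) \<sigma> \<le> ennreal M" if \<sigma>: "\<sigma> > 1/2" for \<sigma>
  proof -
    let ?S = "\<lambda>N z. \<Sum>n<N. a n * embedded_term n z"
    have hS: "?S N holomorphic_on half_plane" for N
      unfolding embedded_term_def
      by (intro holomorphic_intros) (auto simp: half_plane_simps complex_eq_iff)
    have lim: "(\<lambda>N. ?S N (Complex \<sigma> t)) \<longlonglongrightarrow> f (Complex \<sigma> t) / (Complex \<sigma> t + 1)" for t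
    proof -
      have "(\<lambda>n. a n * xpow (real (Suc n)) (Complex \<sigma> t)) sums f (Complex \<sigma> t)"
        using a \<sigma> by (simp add: has_dirichlet_coeffs_xpow half_plane_simps)
      from sums_divide[OF this, of "Complex \<sigma> t + 1"] show ?thesis
        by (simp add: embedded_term_def sums_def)
    qed
    have "line_sq (\<lambda>z. f z / (z + 1)) \<sigma> =
       (\<integral>\<^sup>+t. liminf (\<lambda>N. ennreal ((cmod (?S N (Complex \<sigma> t)))\<^sup>2)) \<partial>lborel)"
      unfolding line_sq_def
    proof (rule nn_integral_cong)
      fix t
      have "(\<lambda>N. ennreal ((cmod (?S N (Complex \<sigma> t)))\<^sup>2)) \<longlonglongrightarrow>
         ennreal ((cmod (f (Complex \<sigma> t) / (Complex \<sigma> t + 1)))\<^sup>2)"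
        by (intro tendsto_ennrealI tendsto_power tendsto_norm lim)
      then show "ennreal ((cmod (f (Complex \<sigma> t) / (Complex \<sigma> t + 1)))\<^sup>2) =
         liminf (\<lambda>N. ennreal ((cmod (?S N (Complex \<sigma> t)))\<^sup>2))"
        by (intro lim_imp_Liminf[symmetric]) auto
    qed
    also have "\<dots> \<le> liminf (\<lambda>N. \<integral>\<^sup>+t. ennreal ((cmod (?S N (Complex \<sigma> t)))\<^sup>2) \<partial>lborel)"
    proof (rule nn_integral_liminf)
      fix N
      note [measurable] = hardy_line_measurable[OF hS \<sigma>]
      show "(\<lambda>t. ennreal ((cmod (?S N (Complex \<sigma> t)))\<^sup>2)) \<in> borel_measurable lborel" by measurable
    qed
    also have "\<dots> \<le> ennreal M"
    proof (rule Liminf_le)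
      have "(\<integral>\<^sup>+t. ennreal ((cmod (?S N (Complex \<sigma> t)))\<^sup>2) \<partial>lborel) \<le> ennreal M" for N
      proof -
        have "4 * pi * (\<Sum>n<N. (cmod (a n))\<^sup>2) \<le> M"
          unfolding M_def by (intro mult_left_mono sum_le_suminf sa) auto
        then show ?thesis
          using embedded_partial_sum_line_sq[OF \<sigma>, where a = a and N = N] unfolding line_sq_def
          by (meson ennreal_leI order_trans)
      qed
      then show "\<forall>\<^sub>F N in sequentially. (\<integral>\<^sup>+t. ennreal ((cmod (?S N (Complex \<sigma> t)))\<^sup>2) \<partial>lborel) \<le> ennreal M"
        by (intro always_eventually) blast
    qed simp
    finally show ?thesis .
  qed
  moreover have "(\<lambda>z. f z / (z + 1)) holomorphic_on half_plane"
    by (intro holomorphic_intros dirichlet_holomorphic[OF a]) (auto simp: half_plane_simps complex_eq_iff)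
  ultimately show ?thesis
    unfolding hardy_mem_iff using M0 out by auto
qed

section \<open>The lower bound given by interpolation in the Hardy space\<close>

text \<open>
  Partial sums of \<open>\<Sum> \<theta>\<^sub>m 4\<^sup>-\<^sup>m c\<^sub>m\<close>, where \<open>\<theta>\<^sub>m \<in> {0, 1}\<close> is chosen such that the inner product with \<open>c\<^sub>m\<close> is at least
  \<open>4\<^sup>-\<^sup>m / 2\<close> after step \<open>m\<close>.
\<close>

primrec hump :: "(nat \<Rightarrow> nat \<Rightarrow> complex) \<Rightarrow> (nat \<Rightarrow> nat) \<Rightarrow> nat \<Rightarrow> nat \<Rightarrow> complex" where
  "hump c J 0 = (\<lambda>j. 0)"
| "hump c J (Suc m) = (\<lambda>j. hump c J m j +
     (if cmod (\<Sum>i<J m. cnj (c m i) * hump c J m i) \<ge> (1/4) ^ m / 2 then 0 else (1/4) ^ m * c m j))"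

lemma L2_set_triangle_cmod:
  fixes f g :: "'a \<Rightarrow> complex"
  shows "L2_set (\<lambda>j. cmod (f j + g j)) A \<le> L2_set (\<lambda>j. cmod (f j)) A + L2_set (\<lambda>j. cmod (g j)) A"
proof -
  have "L2_set (\<lambda>j. cmod (f j + g j)) A \<le> L2_set (\<lambda>j. cmod (f j) + cmod (g j)) A"
    by (rule L2_set_mono) (auto intro: norm_triangle_ineq)
  also have "\<dots> \<le> L2_set (\<lambda>j. cmod (f j)) A + L2_set (\<lambda>j. cmod (g j)) A" by (rule L2_set_triangle_ineq)
  finally show ?thesis .
qed

text \<open>
  The uniform boundedness principle for finitely supported functionals on square-summable sequences.  The steps after step \<open>m\<close> change the
  inner product with \<open>c\<^sub>m\<close> by at most \<open>4\<^sup>-\<^sup>m / 3\<close>, which leaves \<open>4\<^sup>-\<^sup>m / 2 - 4\<^sup>-\<^sup>m / 3 = 4\<^sup>-\<^sup>m / 6\<close>.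
\<close>

lemma gliding_hump:
  assumes unit: "\<And>m. (\<Sum>j<J m. (cmod (c m j))\<^sup>2) = 1"
    and zero: "\<And>m j. J m \<le> j \<Longrightarrow> c m j = 0"
  obtains b :: "nat \<Rightarrow> complex" where "summable (\<lambda>j. (cmod (b j))\<^sup>2)"
    "\<And>m. (1/4) ^ m / 6 \<le> cmod (\<Sum>j<J m. cnj (c m j) * b j)"
proof -
  let ?x = "hump c J"
  have cA: "L2_set (\<lambda>j. cmod (c m j)) A \<le> 1" if "finite A" for m A
  proof -
    have "(\<Sum>j\<in>A. (cmod (c m j))\<^sup>2) = (\<Sum>j\<in>A \<inter> {..<J m}. (cmod (c m j))\<^sup>2)"
      using that by (intro sum.mono_neutral_right) (auto simp: zero not_less)
    also have "\<dots> \<le> (\<Sum>j<J m. (cmod (c m j))\<^sup>2)" by (intro sum_mono2) auto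
    finally show ?thesis unfolding unit by (simp add: L2_set_def)
  qed
  have step: "L2_set (\<lambda>j. cmod (?x (Suc m) j - ?x m j)) A \<le> (1/4) ^ m" if A: "finite A" for m A
  proof (cases "cmod (\<Sum>i<J m. cnj (c m i) * hump c J m i) \<ge> (1/4) ^ m / 2")
    case True
    then show ?thesis by (simp add: L2_set_def)
  next
    case False
    then have "L2_set (\<lambda>j. cmod (?x (Suc m) j - ?x m j)) A = L2_set (\<lambda>j. (1/4) ^ m * cmod (c m j)) A"
      by (simp add: norm_mult norm_power norm_divide)
    also have "\<dots> = (1/4) ^ m * L2_set (\<lambda>j. cmod (c m j)) A" by (rule L2_set_right_distrib[symmetric]) simp
    also have "\<dots> \<le> (1/4) ^ m * 1" by (intro mult_left_mono cA A) simp
    finally show ?thesis by simp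
  qed
  have far: "L2_set (\<lambda>j. cmod (?x (m + k) j - ?x m j)) A \<le> (4/3) * (1/4) ^ m * (1 - (1/4) ^ k)" if A: "finite A" for m k A
  proof (induction k)
    case (Suc k)
    have "L2_set (\<lambda>j. cmod (?x (m + Suc k) j - ?x m j)) A =
      L2_set (\<lambda>j. cmod ((?x (m + k) j - ?x m j) + (?x (Suc (m + k)) j - ?x (m + k) j))) A"
      by (simp add: algebra_simps del: hump.simps)
    also have "\<dots> \<le> L2_set (\<lambda>j. cmod (?x (m + k) j - ?x m j)) A + L2_set (\<lambda>j. cmod (?x (Suc (m + k)) j - ?x (m + k) j)) A"
      by (rule L2_set_triangle_cmod)
    also have "\<dots> \<le> (4/3) * (1/4) ^ m * (1 - (1/4) ^ k) + (1/4) ^ (m + k)"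
      by (intro add_mono Suc step A)
    also have "\<dots> = (4/3) * (1/4) ^ m * (1 - (1/4) ^ Suc k)"
      by (simp add: power_add field_simps)
    finally show ?case .
  qed (simp add: L2_set_def)
  have far': "L2_set (\<lambda>j. cmod (?x (m + k) j - ?x m j)) A \<le> (4/3) * (1/4) ^ m" if A: "finite A" for m k A
  proof -
    have "(4/3) * (1/4) ^ m * (1 - (1/4) ^ k) \<le> (4/3) * (1/4::real) ^ m * 1" by (intro mult_left_mono) auto
    then show ?thesis using far[OF A, of m k] by linarith
  qed
  have conv: "convergent (\<lambda>n. ?x n j)" for j
  proof -
    have "cmod (?x (Suc m) j - ?x m j) \<le> (1/4) ^ m" for m using step[of "{j}" m] by (simp add: L2_set_def)
    then have "summable (\<lambda>m. ?x (Suc m) j - ?x m j)"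
      by (rule summable_comparison_test'[where g = "\<lambda>m. (1/4) ^ m" and N = 0, rotated])
        (rule summable_geometric, simp)
    then have "convergent (\<lambda>n. \<Sum>m<n. ?x (Suc m) j - ?x m j)" by (simp add: summable_iff_convergent)
    moreover have "(\<Sum>m<n. ?x (Suc m) j - ?x m j) = ?x n j" for n
      using sum_lessThan_telescope[of "\<lambda>n. ?x n j" n] by (simp del: hump.simps(2))
    ultimately show ?thesis by (simp only:)
  qed
  define b where "b j = lim (\<lambda>n. ?x n j)" for j
  have lim: "(\<lambda>n. ?x n j) \<longlonglongrightarrow> b j" for j using conv unfolding b_def by (simp add: convergent_LIMSEQ_iff)
  have bfar: "L2_set (\<lambda>j. cmod (b j - ?x m j)) A \<le> (4/3) * (1/4) ^ m" if A: "finite A" for m A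
  proof (rule LIMSEQ_le_const2)
    show "(\<lambda>k. L2_set (\<lambda>j. cmod (?x (k + m) j - ?x m j)) A) \<longlonglongrightarrow> L2_set (\<lambda>j. cmod (b j - ?x m j)) A"
      unfolding L2_set_def by (intro tendsto_intros LIMSEQ_ignore_initial_segment lim)
    show "\<exists>N. \<forall>k\<ge>N. L2_set (\<lambda>j. cmod (?x (k + m) j - ?x m j)) A \<le> (4/3) * (1/4) ^ m"
      using far'[OF A, of m] by (simp add: add.commute)
  qed
  show ?thesis
  proof (rule that)
    show "summable (\<lambda>j. (cmod (b j))\<^sup>2)"
    proof (rule summableI_nonneg_bounded)
      fix n
      have "sqrt (\<Sum>j<n. (cmod (b j))\<^sup>2) \<le> 4/3" using bfar[of "{..<n}" 0] by (simp add: L2_set_def)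
      then show "(\<Sum>j<n. (cmod (b j))\<^sup>2) \<le> (4/3)\<^sup>2" by (rule sqrt_le_D)
    qed simp
    fix m
    let ?y = "\<Sum>j<J m. cnj (c m j) * ?x (Suc m) j"
    have y: "(1/4) ^ m / 2 \<le> cmod ?y"
    proof (cases "cmod (\<Sum>i<J m. cnj (c m i) * hump c J m i) \<ge> (1/4) ^ m / 2")
      case True
      then show ?thesis by simp
    next
      case False
      have "?y = (\<Sum>i<J m. cnj (c m i) * ?x m i) + (1/4) ^ m * (\<Sum>i<J m. c m i * cnj (c m i))"
        using False by (simp add: algebra_simps sum.distrib sum_distrib_left)
      also have "(\<Sum>i<J m. c m i * cnj (c m i)) = of_real (\<Sum>i<J m. (cmod (c m i))\<^sup>2)"
        unfolding of_real_sum complex_norm_square ..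
      finally have "?y = (\<Sum>i<J m. cnj (c m i) * ?x m i) + (1/4) ^ m" unfolding unit by simp
      then have "(1/4) ^ m = ?y - (\<Sum>i<J m. cnj (c m i) * ?x m i)" by simp
      then have "cmod ((1/4) ^ m) \<le> cmod ?y + cmod (\<Sum>i<J m. cnj (c m i) * ?x m i)"
        by (simp only: norm_triangle_ineq4)
      moreover have "cmod ((1/4) ^ m) = (1/4) ^ m" by (simp add: norm_power norm_divide)
      ultimately show ?thesis using False by linarith
    qed
    have "cmod (\<Sum>j<J m. cnj (c m j) * (b j - ?x (Suc m) j)) \<le> (\<Sum>j<J m. cmod (c m j) * cmod (b j - ?x (Suc m) j))"
      by (rule order.trans[OF norm_sum]) (simp add: norm_mult)
    also have "\<dots> \<le> L2_set (\<lambda>j. cmod (c m j)) {..<J m} * L2_set (\<lambda>j. cmod (b j - ?x (Suc m) j)) {..<J m}"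
      using L2_set_mult_ineq[of "\<lambda>j. cmod (c m j)" "\<lambda>j. cmod (b j - ?x (Suc m) j)"] by simp
    also have "\<dots> \<le> 1 * ((4/3) * (1/4) ^ Suc m)"
      by (intro mult_mono cA bfar) auto
    finally have z: "cmod (\<Sum>j<J m. cnj (c m j) * (b j - ?x (Suc m) j)) \<le> (1/4) ^ m / 3" by simp
    have "?y = (\<Sum>j<J m. cnj (c m j) * b j) - (\<Sum>j<J m. cnj (c m j) * (b j - ?x (Suc m) j))"
      by (simp only: right_diff_distrib sum_subtractf) simp
    then have "cmod ?y \<le> cmod (\<Sum>j<J m. cnj (c m j) * b j) + cmod (\<Sum>j<J m. cnj (c m j) * (b j - ?x (Suc m) j))"
      by (simp only: norm_triangle_ineq4)
    then show "(1/4) ^ m / 6 \<le> cmod (\<Sum>j<J m. cnj (c m j) * b j)" using y z by linarith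
  qed
qed

lemma hardy_kernel_norm:
  assumes "w \<in> half_plane"
  shows "(hardy_norm (hardy_kernel w))\<^sup>2 = 1 / (2 * Re w - 1)"
proof -
  have "w + cnj w - 1 = of_real (2 * Re w - 1)" by (simp add: complex_eq_iff)
  then have "complex_of_real ((hardy_norm (hardy_kernel w))\<^sup>2) = of_real (1 / (2 * Re w - 1))"
    unfolding hardy.norm_kernel_sq[OF assms] using assms by (simp add: hardy_kernel_def)
  then show ?thesis by (simp only: of_real_eq_iff)
qed

lemma interpolating_hardy_iff:
  assumes s: "inj s" "range s \<subseteq> half_plane"
  shows "interpolating_sequence half_plane hardy_space hardy_norm s \<longleftrightarrow>
    (\<forall>a. summable (\<lambda>j. (cmod (a j))\<^sup>2 * (2 * Re (s j) - 1)) \<longrightarrow> (\<exists>f\<in>hardy_space. \<forall>j. f (s j) = a j))"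
proof -
  have sj: "s j \<in> half_plane" for j using s by auto
  have "(cmod (a j) / hardy_norm (reproducing_kernel half_plane' hardy_norm (s j)))\<^sup>2 = (cmod (a j))\<^sup>2 * (2 * Re (s j) - 1)"
    if "half_plane' = hardy_space" for a :: "nat \<Rightarrow> complex" and j half_plane'
    unfolding that hardy.reproducing_kernel_eq[OF sj] power_divide hardy_kernel_norm[OF sj] by simp
  then show ?thesis
    unfolding interpolating_sequence_def using s by simp
qed

text \<open>
  If there were no lower bound, there would be unit vectors \<open>c\<^sub>m\<close> whose kernel sums have norm below \<open>8\<^sup>-\<^sup>m\<close>.  Interpolating the
  sequence \<open>b\<close> of the gliding hump by \<open>F\<close> gives \<open>4\<^sup>-\<^sup>m / 6 \<le> |\<langle>F, kernel sum\<rangle>| \<le> 8\<^sup>-\<^sup>m \<parallel>F\<parallel>\<close> for all \<open>m\<close>, which is absurd.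
\<close>

lemma hardy_lower_bound:
  assumes s: "inj s" "range s \<subseteq> half_plane"
    and int: "interpolating_sequence half_plane hardy_space hardy_norm s"
  shows "\<exists>\<delta>>0. \<forall>J c. \<delta> * (\<Sum>j<J. (cmod (c j))\<^sup>2) \<le>
      (hardy_norm (\<lambda>z. \<Sum>j<J. (c j * of_real (sqrt (2 * Re (s j) - 1))) * hardy_kernel (s j) z))\<^sup>2"
proof (rule ccontr)
  assume contra: "\<not> ?thesis"
  have sj: "s j \<in> half_plane" for j using s by auto
  define r where "r j = sqrt (2 * Re (s j) - 1)" for j
  have r: "r j > 0" "(r j)\<^sup>2 = 2 * Re (s j) - 1" for j using sj[of j] by (auto simp: r_def half_plane_simps)
  define g where "g c J z = (\<Sum>j<J. (c j * of_real (r j)) * hardy_kernel (s j) z)" for c J z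
  have "\<exists>c J. (hardy_norm (g c J))\<^sup>2 < \<delta> * (\<Sum>j<J. (cmod (c j))\<^sup>2)" if "\<delta> > 0" for \<delta>
  proof (rule ccontr)
    assume "\<not> ?thesis"
    then have le: "\<delta> * (\<Sum>j<J. (cmod (c j))\<^sup>2) \<le> (hardy_norm (g c J))\<^sup>2" for c J
      by (metis not_le)
    then have "\<exists>\<delta>>0. \<forall>J c. \<delta> * (\<Sum>j<J. (cmod (c j))\<^sup>2) \<le> (hardy_norm (g c J))\<^sup>2"
      using \<open>\<delta> > 0\<close> by (intro exI[of _ \<delta>] conjI allI)
    then show False using contra unfolding g_def[abs_def] r_def by (rule notE[rotated])
  qed
  then have "\<forall>m. \<exists>c J. (hardy_norm (g c J))\<^sup>2 < ((1/8) ^ m)\<^sup>2 * (\<Sum>j<J. (cmod (c j))\<^sup>2)" by simp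
  from choice[OF this] obtain c' where
    "\<forall>m. \<exists>J. (hardy_norm (g (c' m) J))\<^sup>2 < ((1/8) ^ m)\<^sup>2 * (\<Sum>j<J. (cmod (c' m j))\<^sup>2)" ..
  from choice[OF this] obtain J where c':
    "\<And>m. (hardy_norm (g (c' m) (J m)))\<^sup>2 < ((1/8) ^ m)\<^sup>2 * (\<Sum>j<J m. (cmod (c' m j))\<^sup>2)" by blast
  define n where "n m = sqrt (\<Sum>j<J m. (cmod (c' m j))\<^sup>2)" for m
  have n2: "(n m)\<^sup>2 = (\<Sum>j<J m. (cmod (c' m j))\<^sup>2)" for m by (simp add: n_def sum_nonneg)
  have n: "n m > 0" for m
  proof -
    have "0 \<le> (hardy_norm (g (c' m) (J m)))\<^sup>2" by simp
    then have "0 < ((1/8) ^ m)\<^sup>2 * (n m)\<^sup>2" using c'[of m] unfolding n2 by linarith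
    then have "n m \<noteq> 0" by auto
    moreover have "n m \<ge> 0" by (simp add: n_def sum_nonneg)
    ultimately show ?thesis by simp
  qed
  define c where "c m j = (if j < J m then c' m j / of_real (n m) else 0)" for m j
  have unit: "(\<Sum>j<J m. (cmod (c m j))\<^sup>2) = 1" for m
  proof -
    have "(\<Sum>j<J m. (cmod (c m j))\<^sup>2) = (\<Sum>j<J m. (cmod (c' m j))\<^sup>2 / (n m)\<^sup>2)"
      by (intro sum.cong) (auto simp: c_def norm_divide power_divide)
    also have "\<dots> = 1" using n[of m] unfolding sum_divide_distrib[symmetric] n2[symmetric] by simp
    finally show ?thesis .
  qed
  have zero: "J m \<le> j \<Longrightarrow> c m j = 0" for m j by (simp add: c_def)
  obtain b where b: "summable (\<lambda>j. (cmod (b j))\<^sup>2)"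
    "\<And>m. (1/4) ^ m / 6 \<le> cmod (\<Sum>j<J m. cnj (c m j) * b j)"
    by (rule gliding_hump[where J = J and c = c, OF unit zero]) (simp, blast)
  \<comment> \<open>dividing by \<open>r\<close> turns a square-summable sequence into admissible data\<close>
  have "(cmod (b j / of_real (r j)))\<^sup>2 * (2 * Re (s j) - 1) = (cmod (b j))\<^sup>2" for j
    using r(1)[of j] unfolding r(2)[symmetric] by (simp add: norm_divide power_divide)
  then have "summable (\<lambda>j. (cmod (b j / of_real (r j)))\<^sup>2 * (2 * Re (s j) - 1))"
    using b(1) by (simp only:)
  moreover have "\<forall>a. summable (\<lambda>j. (cmod (a j))\<^sup>2 * (2 * Re (s j) - 1)) \<longrightarrow> (\<exists>f\<in>hardy_space. \<forall>j. f (s j) = a j)"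
    using int unfolding interpolating_hardy_iff[OF s] .
  from spec[OF this, of "\<lambda>j. b j / of_real (r j)"]
  have "summable (\<lambda>j. (cmod (b j / of_real (r j)))\<^sup>2 * (2 * Re (s j) - 1)) \<Longrightarrow>
     \<exists>f\<in>hardy_space. \<forall>j. f (s j) = b j / of_real (r j)" by blast
  ultimately obtain F where F: "F \<in> hardy_space" "\<And>j. F (s j) = b j / of_real (r j)" by blast
  have "(2::real) ^ m \<le> 6 * hardy_norm F" for m
  proof -
    have "(\<Sum>j<J m. cnj (c m j) * b j) = of_real (1 / n m) * (\<Sum>j<J m. cnj (c' m j * of_real (r j)) * F (s j))"
      unfolding sum_distrib_left
    proof (intro sum.cong refl)
      fix j assume "j \<in> {..<J m}"
      moreover have "r j \<noteq> 0" using r(1)[of j] by simp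
      ultimately show "cnj (c m j) * b j = of_real (1 / n m) * (cnj (c' m j * of_real (r j)) * F (s j))"
        by (simp add: c_def F(2))
    qed
    then have "(1/4) ^ m / 6 \<le> 1 / n m * cmod (\<Sum>j<J m. cnj (c' m j * of_real (r j)) * F (s j))"
      using b(2)[of m] n[of m] by (simp add: norm_mult norm_divide)
    also have "\<dots> \<le> 1 / n m * (hardy_norm F * hardy_norm (g (c' m) (J m)))"
      unfolding g_def[abs_def] using n[of m] sj by (intro mult_left_mono hardy.kernel_sum_bound F(1)) auto
    also have "hardy_norm (g (c' m) (J m)) \<le> (1/8) ^ m * n m"
    proof (rule power2_le_imp_le)
      show "(hardy_norm (g (c' m) (J m)))\<^sup>2 \<le> ((1/8) ^ m * n m)\<^sup>2"
        using c'[of m] unfolding n2[symmetric] power_mult_distrib by simp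
    qed (use n[of m] in simp)
    finally have "(1/4) ^ m / 6 \<le> 1 / n m * (hardy_norm F * ((1/8) ^ m * n m))"
      using n[of m] hardy_norm_nonneg[of F] by (simp add: mult_left_mono divide_right_mono)
    then have "(1/4) ^ m \<le> 6 * hardy_norm F * (1/8) ^ m" using n[of m] by simp
    then have "8 ^ m * (1/4) ^ m \<le> 8 ^ m * (6 * hardy_norm F * (1/8) ^ m)" by (rule mult_left_mono) simp
    also have "\<dots> = 6 * hardy_norm F * (8 * (1/8)) ^ m" by (simp only: power_mult_distrib mult_ac)
    also have "8 ^ m * (1/4) ^ m = (2::real) ^ m" by (subst power_mult_distrib[symmetric]) simp
    finally show ?thesis by simp
  qed
  moreover obtain m where "6 * hardy_norm F < 2 ^ m" using real_arch_pow[of 2 "6 * hardy_norm F"] by auto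
  ultimately show False by (meson not_le)
qed

section \<open>The Blaschke condition\<close>

lemma hardy_norm_mono:
  assumes f: "f \<in> hardy_space" and le: "\<And>z. z \<in> half_plane \<Longrightarrow> cmod (g z) \<le> cmod (f z)"
  shows "hardy_norm g \<le> hardy_norm f"
proof -
  have "hardy_sq_norm g \<le> hardy_sq_norm f"
    unfolding hardy_sq_norm_def
    by (intro SUP_subset_mono order_refl) (auto intro!: mult_left_mono nn_integral_mono ennreal_leI power_mono le simp: half_plane_simps)
  then show ?thesis using f by (simp add: hardy_norm_def enn2real_mono hardy_space_def)
qed

text \<open>
  The product of the kernel at \<open>s\<^sub>0\<close> with the Blaschke factors \<open>(z - s\<^sub>i) / (z + cnj s\<^sub>i - 1) = 1 - d\<^sub>i k\<^sub>i(z)\<close> of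
  \<open>s\<^sub>1, \<dots>, s\<^sub>n\<close> is a linear combination of the kernels, by the partial fraction identity
  \<open>k\<^sub>i k\<^sub>j = (k\<^sub>i - k\<^sub>j) / (cnj s\<^sub>j - cnj s\<^sub>i)\<close>.  It is dominated by the kernel at \<open>s\<^sub>0\<close>, since Blaschke factors have modulus at most
  1.  For its coefficient \<open>e\<^sub>0\<close> at \<open>s\<^sub>0\<close>, the number \<open>|e\<^sub>0|\<^sup>2\<close> is the product of the factors
  \<open>1 + d\<^sub>0 d\<^sub>i / |s\<^sub>0 - s\<^sub>i|\<^sup>2\<close>, and a product of numbers \<open>1 + x\<^sub>i\<close> with \<open>x\<^sub>i \<ge> 0\<close> is at least \<open>1 + \<Sum> x\<^sub>i\<close>.
\<close>

lemma kernel_blaschke_expansion: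
  assumes s: "inj s" "\<And>j. s j \<in> half_plane"
  shows "\<exists>e. (\<forall>z\<in>half_plane. cmod (\<Sum>j<Suc n. e j * hardy_kernel (s j) z) \<le> cmod (hardy_kernel (s 0) z)) \<and>
     1 + (\<Sum>i<n. (2 * Re (s 0) - 1) * (2 * Re (s (Suc i)) - 1) / (cmod (s 0 - s (Suc i)))\<^sup>2) \<le> (cmod (e 0))\<^sup>2"
proof (induction n)
  case 0
  show ?case by (rule exI[of _ "\<lambda>_. 1"]) simp
next
  case (Suc n)
  define x where "x i = (2 * Re (s 0) - 1) * (2 * Re (s (Suc i)) - 1) / (cmod (s 0 - s (Suc i)))\<^sup>2" for i
  from Suc obtain e where e: "\<And>z. z \<in> half_plane \<Longrightarrow> cmod (\<Sum>j<Suc n. e j * hardy_kernel (s j) z) \<le> cmod (hardy_kernel (s 0) z)"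
    "1 + (\<Sum>i<n. x i) \<le> (cmod (e 0))\<^sup>2" unfolding x_def by blast
  define p where "p = s (Suc n)"
  define d where "d = complex_of_real (2 * Re p - 1)"
  have p: "Re p > 1/2" using s(2) by (simp add: p_def half_plane_simps)
  have ne: "cnj p - cnj (s j) \<noteq> 0" if "j < Suc n" for j
    using s(1) that by (auto simp: p_def inj_eq)
  define e' where "e' j = (if j < Suc n then e j * (1 - d / (cnj p - cnj (s j)))
    else \<Sum>i<Suc n. e i * d / (cnj p - cnj (s i)))" for j
  have exp: "(\<Sum>j<Suc (Suc n). e' j * hardy_kernel (s j) z) =
      (\<Sum>j<Suc n. e j * hardy_kernel (s j) z) * (1 - d * hardy_kernel p z)" if z: "z \<in> half_plane" for z
  proof -
    have kk: "hardy_kernel (s j) z * hardy_kernel p z = (hardy_kernel (s j) z - hardy_kernel p z) / (cnj p - cnj (s j))"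
      if "j < Suc n" for j
    proof -
      have "z + cnj (s j) - 1 \<noteq> 0" "z + cnj p - 1 \<noteq> 0"
        using z s(2)[of j] p by (auto simp: half_plane_simps complex_eq_iff)
      moreover have "1 / A * (1 / B) = (1 / A - 1 / B) / (B - A)" if "A \<noteq> 0" "B \<noteq> 0" "B - A \<noteq> 0" for A B :: complex
      proof -
        have "1 / A - 1 / B = (B - A) / (A * B)" using that by (simp add: diff_divide_distrib)
        then show ?thesis using that(3) by simp
      qed
      from this[of "z + cnj (s j) - 1" "z + cnj p - 1"]
      have "z + cnj (s j) - 1 \<noteq> 0 \<Longrightarrow> z + cnj p - 1 \<noteq> 0 \<Longrightarrow>
         1 / (z + cnj (s j) - 1) * (1 / (z + cnj p - 1)) =
         (1 / (z + cnj (s j) - 1) - 1 / (z + cnj p - 1)) / (cnj p - cnj (s j))"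
        using ne[OF that] by simp
      ultimately show ?thesis using z by (simp only: hardy_kernel_def if_True not_False_eq_True)
    qed
    have "(\<Sum>j<Suc (Suc n). e' j * hardy_kernel (s j) z) = (\<Sum>j<Suc n. e' j * hardy_kernel (s j) z) + e' (Suc n) * hardy_kernel p z"
      by (simp add: p_def)
    also have "\<dots> = (\<Sum>j<Suc n. e j * (1 - d / (cnj p - cnj (s j))) * hardy_kernel (s j) z + e j * d / (cnj p - cnj (s j)) * hardy_kernel p z)"
      unfolding sum.distrib by (simp add: e'_def sum_distrib_right del: sum.lessThan_Suc)
    also have "\<dots> = (\<Sum>j<Suc n. e j * hardy_kernel (s j) z * (1 - d * hardy_kernel p z))"
    proof (rule sum.cong[OF refl])
      fix j assume "j \<in> {..<Suc n}"
      then have j: "j < Suc n" by simp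
      have A: "e j * hardy_kernel (s j) z * (1 - d * hardy_kernel p z) = e j * hardy_kernel (s j) z - e j * d * (hardy_kernel (s j) z * hardy_kernel p z)"
        by (simp add: algebra_simps)
      show "e j * (1 - d / (cnj p - cnj (s j))) * hardy_kernel (s j) z + e j * d / (cnj p - cnj (s j)) * hardy_kernel p z =
         e j * hardy_kernel (s j) z * (1 - d * hardy_kernel p z)"
        unfolding A kk[OF j] by (simp add: algebra_simps diff_divide_distrib)
    qed
    finally show ?thesis by (simp only: sum_distrib_right)
  qed
  have b1: "cmod (1 - d * hardy_kernel p z) \<le> 1" if z: "z \<in> half_plane" for z
  proof -
    have nz: "z + cnj p - 1 \<noteq> 0" using z p by (auto simp: half_plane_simps complex_eq_iff)
    have "1 - d * hardy_kernel p z = (z - p) / (z + cnj p - 1)"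
    proof -
      have "z + cnj p - 1 - d = z - p" by (simp add: d_def complex_eq_iff)
      then show ?thesis using nz z by (simp add: hardy_kernel_def field_simps)
    qed
    moreover have "cmod (z - p) \<le> cmod (z + cnj p - 1)"
    proof (rule power2_le_imp_le)
      have "\<bar>Re z - Re p\<bar> \<le> \<bar>Re z + Re p - 1\<bar>" using z p by (auto simp: half_plane_simps)
      then have "(Re z - Re p)\<^sup>2 \<le> (Re z + Re p - 1)\<^sup>2" by (simp only: abs_le_square_iff)
      then show "(cmod (z - p))\<^sup>2 \<le> (cmod (z + cnj p - 1))\<^sup>2" by (simp add: cmod_power2)
    qed simp
    ultimately show ?thesis using nz by (simp add: norm_divide)
  qed
  have "(cmod (e' 0))\<^sup>2 = (cmod (e 0))\<^sup>2 * (1 + x n)"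
  proof -
    let ?u = "s 0"
    have up: "?u - p \<noteq> 0" using ne[of 0] by auto
    have "1 - d / (cnj p - cnj ?u) = (1 - cnj ?u - p) / (cnj p - cnj ?u)"
    proof -
      have "cnj p - cnj ?u - d = 1 - cnj ?u - p" by (simp add: d_def complex_eq_iff)
      then show ?thesis using ne[of 0] by (simp add: field_simps)
    qed
    then have "(cmod (1 - d / (cnj p - cnj ?u)))\<^sup>2 = (cmod (1 - cnj ?u - p))\<^sup>2 / (cmod (cnj p - cnj ?u))\<^sup>2"
      by (simp add: norm_divide power_divide)
    also have "cmod (cnj p - cnj ?u) = cmod (?u - p)"
      by (simp only: complex_cnj_diff[symmetric] complex_mod_cnj norm_minus_commute)
    also have "(cmod (1 - cnj ?u - p))\<^sup>2 = (cmod (?u - p))\<^sup>2 + (2 * Re ?u - 1) * (2 * Re p - 1)"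
      by (simp add: cmod_power2) (simp add: power2_eq_square algebra_simps)
    also have "\<dots> / (cmod (?u - p))\<^sup>2 = 1 + x n"
      using up by (simp add: x_def p_def add_divide_distrib)
    finally show ?thesis by (simp add: e'_def norm_mult power_mult_distrib)
  qed
  moreover have "1 + (\<Sum>i<Suc n. x i) \<le> (cmod (e 0))\<^sup>2 * (1 + x n)"
  proof -
    have x0: "x i \<ge> 0" for i
      unfolding x_def using s(2)[of 0] s(2)[of "Suc i"] by (simp add: half_plane_simps)
    have "1 + (\<Sum>i<Suc n. x i) \<le> (1 + (\<Sum>i<n. x i)) * (1 + x n)"
      using x0[of n] sum_nonneg[of "{..<n}" x] x0 by (simp add: algebra_simps)
    also have "\<dots> \<le> (cmod (e 0))\<^sup>2 * (1 + x n)" using e(2) x0[of n] by (intro mult_right_mono) auto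
    finally show ?thesis .
  qed
  moreover have "cmod (\<Sum>j<Suc (Suc n). e' j * hardy_kernel (s j) z) \<le> cmod (hardy_kernel (s 0) z)" if z: "z \<in> half_plane" for z
  proof -
    have "cmod (\<Sum>j<Suc n. e j * hardy_kernel (s j) z) * cmod (1 - d * hardy_kernel p z) \<le> cmod (hardy_kernel (s 0) z) * 1"
      by (intro mult_mono e(1) b1 z) auto
    then show ?thesis unfolding exp[OF z] norm_mult by simp
  qed
  ultimately show ?case unfolding x_def by (intro exI[of _ e']) auto
qed

text \<open>
  Testing \<open>F\<close> against the previous combination of kernels isolates the coefficient at \<open>s\<^sub>0\<close> and bounds it by
  \<open>\<parallel>F\<parallel> \<parallel>k\<parallel>\<close>, with \<open>k\<close> the kernel at \<open>s\<^sub>0\<close>, independently of \<open>n\<close>.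
\<close>

lemma blaschke_condition:
  assumes bdd: "bounded (range s)" and s: "inj s" "\<And>j. s j \<in> half_plane"
    and F: "F \<in> hardy_space" "F (s 0) = 1" "\<And>j. j > 0 \<Longrightarrow> F (s j) = 0"
  shows "summable (\<lambda>j. 2 * Re (s j) - 1)"
proof -
  obtain R where R: "R > 0" "\<And>j. cmod (s j) \<le> R"
    using bdd unfolding bounded_pos by auto
  define d where "d j = 2 * Re (s j) - 1" for j
  have d: "d j > 0" for j using s(2)[of j] by (simp add: d_def half_plane_simps)
  define K where "K = (hardy_norm F * hardy_norm (hardy_kernel (s 0)))\<^sup>2"
  have "(\<Sum>i<n. d (Suc i)) \<le> 4 * R\<^sup>2 / d 0 * K" for n
  proof -
    obtain e where e: "\<And>z. z \<in> half_plane \<Longrightarrow> cmod (\<Sum>j<Suc n. e j * hardy_kernel (s j) z) \<le> cmod (hardy_kernel (s 0) z)"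
      "1 + (\<Sum>i<n. d 0 * d (Suc i) / (cmod (s 0 - s (Suc i)))\<^sup>2) \<le> (cmod (e 0))\<^sup>2"
      using kernel_blaschke_expansion[OF s, of n] unfolding d_def by blast
    have "(\<Sum>j<Suc n. cnj (e j) * F (s j)) = cnj (e 0)"
      by (simp add: sum.lessThan_Suc_shift F del: sum.lessThan_Suc)
    then have "cmod (e 0) \<le> hardy_norm F * hardy_norm (\<lambda>z. \<Sum>j<Suc n. e j * hardy_kernel (s j) z)"
      using hardy.kernel_sum_bound[where s = s and n = "Suc n" and c = e, OF s(2) F(1)] by simp
    also have "\<dots> \<le> hardy_norm F * hardy_norm (hardy_kernel (s 0))"
      by (intro mult_left_mono hardy_norm_mono hardy_kernel_mem s e hardy_norm_nonneg)
    finally have "(cmod (e 0))\<^sup>2 \<le> K" unfolding K_def by (simp add: power_mono)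
    then have 1: "(\<Sum>i<n. d 0 * d (Suc i) / (cmod (s 0 - s (Suc i)))\<^sup>2) \<le> K" using e(2) by linarith
    have "(\<Sum>i<n. d 0 * d (Suc i) / (4 * R\<^sup>2)) \<le> (\<Sum>i<n. d 0 * d (Suc i) / (cmod (s 0 - s (Suc i)))\<^sup>2)"
    proof (intro sum_mono divide_left_mono)
      fix i
      have "cmod (s 0 - s (Suc i)) \<le> 2 * R" using norm_triangle_ineq4[of "s 0" "s (Suc i)"] R(2)[of 0] R(2)[of "Suc i"] by linarith
      then have "(cmod (s 0 - s (Suc i)))\<^sup>2 \<le> (2 * R)\<^sup>2" by (rule power_mono) simp
      then show "(cmod (s 0 - s (Suc i)))\<^sup>2 \<le> 4 * R\<^sup>2" by (simp add: power_mult_distrib)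
      show "0 \<le> d 0 * d (Suc i)" using d[of 0] d[of "Suc i"] by simp
      have "s 0 \<noteq> s (Suc i)" using s(1) by (metis inj_eq nat.distinct(1))
      then show "0 < 4 * R\<^sup>2 * (cmod (s 0 - s (Suc i)))\<^sup>2" using R(1) by simp
    qed
    then have "d 0 * (\<Sum>i<n. d (Suc i)) / (4 * R\<^sup>2) \<le> K"
      using 1 by (simp add: sum_distrib_left sum_divide_distrib)
    then have "4 * R\<^sup>2 / d 0 * (d 0 * (\<Sum>i<n. d (Suc i)) / (4 * R\<^sup>2)) \<le> 4 * R\<^sup>2 / d 0 * K"
      using R(1) d[of 0] by (intro mult_left_mono) auto
    then show ?thesis using R(1) d[of 0] by simp
  qed
  then have "summable (\<lambda>i. d (Suc i))"
    using d less_imp_le by (intro summableI_nonneg_bounded) auto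
  then show ?thesis unfolding d_def[symmetric] by (simp add: summable_Suc_iff)
qed

section \<open>Norms of kernel sums as integrals\<close>

lemma xpow_integrable:
  assumes "Re p > 1"
  shows "integrable lborel (\<lambda>x. indicator {1<..} x *\<^sub>R xpow x p)"
proof -
  have "(\<lambda>x. x powr (- Re p)) integrable_on {1..}"
    using has_integral_powr_to_inf[of "- Re p" 1] assms unfolding integrable_on_def by auto
  then have "(\<lambda>x. x powr (- Re p)) absolutely_integrable_on {1..}"
    by (rule nonnegative_absolutely_integrable_1) auto
  then have "set_integrable lebesgue {1..} (\<lambda>x. x powr (- Re p))" .
  then have "set_integrable lborel {1..} (\<lambda>x. x powr (- Re p))"
    unfolding set_integrable_def by (subst (asm) integrable_completion) auto
  then show ?thesis
    unfolding set_integrable_def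
  proof (rule Bochner_Integration.integrable_bound)
    show "(\<lambda>x. indicat_real {1<..} x *\<^sub>R xpow x p) \<in> borel_measurable lborel"
      unfolding xpow_def by measurable
    show "AE x in lborel. norm (indicat_real {1<..} x *\<^sub>R xpow x p) \<le> norm (indicat_real {1..} x *\<^sub>R x powr - Re p)"
      by (rule AE_I2) (auto simp: norm_xpow_powr split: split_indicator)
  qed
qed

lemma xpow_integral:
  assumes p: "Re p > 1"
  shows "(\<integral>x. indicator {1<..} x *\<^sub>R xpow x p \<partial>lborel) = 1 / (p - 1)"
proof -
  have p1: "p - 1 \<noteq> 0" using p by (auto simp: complex_eq_iff)
  have ein: "einterval 1 \<infinity> = {1<..}" by (auto simp: einterval_def one_ereal_def)
  have "(LBINT x=1..\<infinity>. xpow x p) = 0 - xpow 1 (p - 1) / (1 - p)"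
  proof (rule interval_integral_FTC_integrable[where F = "\<lambda>x. xpow x (p - 1) / (1 - p)"])
    show "(1::ereal) < \<infinity>" by simp
    fix x assume "1 < ereal x"
    then have x: "x > 0" by (simp add: one_ereal_def)
    show "isCont (\<lambda>x. xpow x p) x"
      unfolding xpow_def using x by (intro continuous_intros) auto
    have "((\<lambda>x. - ((p - 1) * of_real (ln x))) has_vector_derivative - ((p - 1) * of_real (1 / x))) (at x)"
      using x by (intro has_vector_derivative_minus has_vector_derivative_mult_right has_vector_derivative_of_real)
        (auto intro!: derivative_eq_intros simp flip: has_real_derivative_iff_has_vector_derivative)
    from field_vector_diff_chain_at[OF this DERIV_exp]
    have "((\<lambda>x. xpow x (p - 1)) has_vector_derivative - ((p - 1) * of_real (1 / x)) * xpow x (p - 1)) (at x)"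
      by (simp add: o_def xpow_def)
    then have "((\<lambda>x. xpow x (p - 1) / (1 - p)) has_vector_derivative - ((p - 1) * of_real (1 / x)) * xpow x (p - 1) / (1 - p)) (at x)"
      by (rule has_vector_derivative_divide)
    moreover have "- ((p - 1) * of_real (1 / x)) * xpow x (p - 1) / (1 - p) = of_real (1 / x) * xpow x (p - 1)"
      using p1 by (simp add: divide_simps) (simp add: algebra_simps)
    moreover have "complex_of_real (1 / x) = xpow x 1" using xpow_of_nat[of x 1] x by simp
    then have "of_real (1 / x) * xpow x (p - 1) = xpow x p" using xpow_add[of x 1 "p - 1"] by simp
    ultimately show "((\<lambda>x. xpow x (p - 1) / (1 - p)) has_vector_derivative xpow x p) (at x)"
      by (simp only:)
  next
    show "set_integrable lborel (einterval 1 \<infinity>) (\<lambda>x. xpow x p)"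
      using xpow_integrable[OF p] by (simp add: set_integrable_def ein)
    have "((\<lambda>x. xpow x (p - 1) / (1 - p)) \<longlongrightarrow> xpow 1 (p - 1) / (1 - p)) (at_right 1)"
      unfolding xpow_def by (intro tendsto_intros) (use p1 in auto)
    then show "(((\<lambda>x. xpow x (p - 1) / (1 - p)) \<circ> real_of_ereal) \<longlongrightarrow> xpow 1 (p - 1) / (1 - p)) (at_right 1)"
      unfolding one_ereal_def ereal_tendsto_simps .
    have "((\<lambda>x. xpow x (p - 1)) \<longlongrightarrow> 0) at_top"
    proof (rule tendsto_norm_zero_cancel)
      have "((\<lambda>x. x powr (- (Re p - 1))) \<longlongrightarrow> 0) at_top"
        using p by (intro tendsto_neg_powr filterlim_ident) auto
      moreover have "eventually (\<lambda>x. x powr (- (Re p - 1)) = cmod (xpow x (p - 1))) at_top"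
        using eventually_gt_at_top[of 0] by eventually_elim (simp add: norm_xpow_powr)
      ultimately show "((\<lambda>x. cmod (xpow x (p - 1))) \<longlongrightarrow> 0) at_top"
        by (rule Lim_transform_eventually)
    qed
    then have "((\<lambda>x. xpow x (p - 1) / (1 - p)) \<longlongrightarrow> 0 / (1 - p)) at_top"
      by (intro tendsto_divide tendsto_const) (use p1 in auto)
    then show "(((\<lambda>x. xpow x (p - 1) / (1 - p)) \<circ> real_of_ereal) \<longlongrightarrow> 0) (at_left \<infinity>)"
      unfolding ereal_tendsto_simps by simp
  qed
  also have "(LBINT x=1..\<infinity>. xpow x p) = (\<integral>x. indicator {1<..} x *\<^sub>R xpow x p \<partial>lborel)"
    by (simp add: interval_lebesgue_integral_le_eq ein set_lebesgue_integral_def)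
  also have "0 - xpow 1 (p - 1) / (1 - p) = 1 / (p - 1)"
    using p1 by (simp add: xpow_def divide_simps)
  finally show ?thesis .
qed

definition dual_sum :: "(nat \<Rightarrow> complex) \<Rightarrow> (nat \<Rightarrow> complex) \<Rightarrow> nat \<Rightarrow> real \<Rightarrow> complex" where
  "dual_sum s e J x = (\<Sum>j<J. e j * xpow x (cnj (s j)))"

text \<open>
  Both sides are quadratic forms in \<open>e\<close> with the same Gram matrix, because \<open>\<integral>\<^sub>1\<^sup>\<infinity> x\<^sup>-\<^sup>p dx = 1 / (p - 1)\<close>.
\<close>

lemma hardy_norm_integral:
  assumes s: "\<And>j. s j \<in> half_plane"
  shows "integrable lborel (\<lambda>x. indicator {1<..} x * (cmod (dual_sum s e J x))\<^sup>2)"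
    and "(hardy_norm (\<lambda>z. \<Sum>j<J. e j * hardy_kernel (s j) z))\<^sup>2 =
      (\<integral>x. indicator {1<..} x * (cmod (dual_sum s e J x))\<^sup>2 \<partial>lborel)"
proof -
  have re: "Re (s i + cnj (s j)) > 1" for i j using s[of i] s[of j] by (simp add: half_plane_simps)
  have eq: "complex_of_real (indicator {1<..} x * (cmod (dual_sum s e J x))\<^sup>2) =
     (\<Sum>i<J. \<Sum>j<J. cnj (e i) * e j * (indicator {1<..} x *\<^sub>R xpow x (s i + cnj (s j))))" for x
  proof -
    have "complex_of_real ((cmod (dual_sum s e J x))\<^sup>2) = cnj (dual_sum s e J x) * dual_sum s e J x"
      by (simp only: complex_norm_square mult.commute)
    also have "\<dots> = (\<Sum>i<J. \<Sum>j<J. cnj (e i) * e j * xpow x (s i + cnj (s j)))"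
      unfolding dual_sum_def cnj_sum sum_product by (simp add: cnj_xpow xpow_add mult_ac)
    finally show ?thesis
      by (cases "x \<in> {1<..}") simp_all
  qed
  have i: "integrable lborel (\<lambda>x. cnj (e i) * e j * (indicator {1<..} x *\<^sub>R xpow x (s i + cnj (s j))))" for i j
    by (intro integrable_mult_right xpow_integrable re)
  have "integrable lborel (\<lambda>x. complex_of_real (indicator {1<..} x * (cmod (dual_sum s e J x))\<^sup>2))"
    unfolding eq by (intro Bochner_Integration.integrable_sum i)
  then show "integrable lborel (\<lambda>x. indicator {1<..} x * (cmod (dual_sum s e J x))\<^sup>2)"
    by (simp only: complex_of_real_integrable_eq)
  have "complex_of_real (\<integral>x. indicator {1<..} x * (cmod (dual_sum s e J x))\<^sup>2 \<partial>lborel) =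
     (\<integral>x. (\<Sum>i<J. \<Sum>j<J. cnj (e i) * e j * (indicator {1<..} x *\<^sub>R xpow x (s i + cnj (s j)))) \<partial>lborel)"
    unfolding eq[symmetric] by (rule integral_complex_of_real[symmetric])
  also have "\<dots> = (\<Sum>i<J. \<Sum>j<J. cnj (e i) * e j * (\<integral>x. indicator {1<..} x *\<^sub>R xpow x (s i + cnj (s j)) \<partial>lborel))"
  proof (subst Bochner_Integration.integral_sum)
    show "integrable lborel (\<lambda>x. \<Sum>j<J. cnj (e i) * e j * (indicator {1<..} x *\<^sub>R xpow x (s i + cnj (s j))))" for i
      by (intro Bochner_Integration.integrable_sum i)
    show "(\<Sum>k<J. \<integral>x. (\<Sum>j<J. cnj (e k) * e j * (indicator {1<..} x *\<^sub>R xpow x (s k + cnj (s j)))) \<partial>lborel) =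
      (\<Sum>i<J. \<Sum>j<J. cnj (e i) * e j * (\<integral>x. indicator {1<..} x *\<^sub>R xpow x (s i + cnj (s j)) \<partial>lborel))"
      by (subst Bochner_Integration.integral_sum, rule i, simp only: integral_mult_right_zero)
  qed
  also have "\<dots> = (\<Sum>i<J. \<Sum>j<J. cnj (e i) * e j * hardy_kernel (s j) (s i))"
    using s by (simp only: xpow_integral[OF re] hardy_kernel_def if_True)
  also have "\<dots> = complex_of_real ((hardy_norm (\<lambda>z. \<Sum>j<J. e j * hardy_kernel (s j) z))\<^sup>2)"
    by (rule hardy.norm_kernel_sum_sq[OF s, symmetric])
  finally show "(hardy_norm (\<lambda>z. \<Sum>j<J. e j * hardy_kernel (s j) z))\<^sup>2 =
      (\<integral>x. indicator {1<..} x * (cmod (dual_sum s e J x))\<^sup>2 \<partial>lborel)"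
    by (simp only: of_real_eq_iff)
qed

section \<open>Entire functions of exponential type vanishing at logarithms of integers\<close>

lemma entire_factor_zeros:
  assumes "finite Z" "f holomorphic_on UNIV" "\<And>a. a \<in> Z \<Longrightarrow> f a = 0"
  shows "\<exists>g. g holomorphic_on UNIV \<and> (\<forall>z. f z = (\<Prod>a\<in>Z. z - a) * g z)"
  using assms
proof (induction Z)
  case (insert a Z)
  then obtain g where g: "g holomorphic_on UNIV" "\<And>z. f z = (\<Prod>a\<in>Z. z - a) * g z" by auto
  have "(\<Prod>b\<in>Z. a - b) \<noteq> 0" using insert.hyps by auto
  then have ga: "g a = 0" using g(2)[of a] insert.prems(2)[of a] by simp
  define h where "h z = (if z = a then deriv g a else (g z - g a) / (z - a))" for z
  have "h holomorphic_on UNIV"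
    using pole_lemma_open[of g UNIV a] g(1) unfolding h_def[abs_def] by simp
  moreover have "f z = (\<Prod>a\<in>insert a Z. z - a) * h z" for z
    using g(2)[of z] insert.hyps ga by (auto simp: h_def)
  ultimately show ?case by blast
qed (auto intro: exI[of _ f])

text \<open>
  The disc of radius \<open>\<rho> = ln N\<close> contains \<open>N\<close> zeros.  On the circle of radius \<open>4\<rho>\<close> the distance to each of them is at least
  \<open>3\<rho>\<close>, and at \<open>w\<close> at most \<open>2\<rho>\<close>.  Dividing out the zeros, the maximum principle gives
  \<open>|f(w)| \<le> A e\<^bsup>4R\<rho>\<^esup> (2/3)\<^sup>N = A N\<^bsup>4R\<^esup> (2/3)\<^sup>N\<close>, which tends to 0.
\<close>

lemma exponential_type_zero_at_logs:
  fixes f :: "complex \<Rightarrow> complex"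
  assumes hol: "f holomorphic_on UNIV" and A: "\<And>z. cmod (f z) \<le> A * exp (R * cmod z)" and R: "R \<ge> 0"
    and zero: "\<And>n. f (of_real (ln (real (Suc n)))) = 0"
  shows "f w = 0"
proof -
  have A0: "A \<ge> 0" using A[of 0] norm_ge_zero[of "f 0"] by (simp del: norm_ge_zero)
  have bound: "cmod (f w) \<le> A * (real N powr (4 * R) * (2/3) ^ N)" if N: "N \<ge> 2" "cmod w \<le> ln (real N)" for N
  proof -
    define \<rho> where "\<rho> = ln (real N)"
    have \<rho>: "\<rho> > 0" using N(1) by (simp add: \<rho>_def)
    define Z where "Z = (\<lambda>n. complex_of_real (ln (real (Suc n)))) ` {..<N}"
    have inj: "inj_on (\<lambda>n. complex_of_real (ln (real (Suc n)))) {..<N}"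
      by (auto simp: inj_on_def)
    have Z: "finite Z" "card Z = N" unfolding Z_def using inj by (auto simp: card_image)
    have Zb: "cmod a \<le> \<rho>" if "a \<in> Z" for a
      using that by (auto simp: Z_def \<rho>_def)
    obtain g where g: "g holomorphic_on UNIV" "\<And>z. f z = (\<Prod>a\<in>Z. z - a) * g z"
      using entire_factor_zeros[OF Z(1) hol] zero by (auto simp: Z_def)
    have "cmod (g w) \<le> A * exp (R * (4 * \<rho>)) / (3 * \<rho>) ^ N"
    proof (rule maximum_modulus_frontier[where f = g and S = "ball 0 (4 * \<rho>)"])
      show "g holomorphic_on interior (ball 0 (4 * \<rho>))" using g(1) by (rule holomorphic_on_subset) auto
      show "continuous_on (closure (ball 0 (4 * \<rho>))) g"
        using holomorphic_on_imp_continuous_on[OF g(1)] by (rule continuous_on_subset) auto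
      show "w \<in> ball 0 (4 * \<rho>)" using N(2) \<rho> unfolding \<rho>_def by simp
      fix z :: complex assume "z \<in> frontier (ball 0 (4 * \<rho>))"
      then have z: "cmod z = 4 * \<rho>" using \<rho> by (simp add: dist_norm)
      have "(3 * \<rho>) ^ N = (\<Prod>a\<in>Z. 3 * \<rho>)" by (simp add: Z)
      also have "\<dots> \<le> (\<Prod>a\<in>Z. cmod (z - a))"
      proof (rule prod_mono)
        fix a assume "a \<in> Z"
        then have "3 * \<rho> \<le> cmod z - cmod a" using Zb[of a] z by simp
        also have "\<dots> \<le> cmod (z - a)" by (rule norm_triangle_ineq2)
        finally show "0 \<le> 3 * \<rho> \<and> 3 * \<rho> \<le> cmod (z - a)" using \<rho> by simp
      qed
      finally have "(3 * \<rho>) ^ N * cmod (g z) \<le> cmod (f z)"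
        unfolding g(2) norm_mult prod_norm[symmetric] by (rule mult_right_mono) simp
      also have "\<dots> \<le> A * exp (R * (4 * \<rho>))" using A[of z] z by simp
      finally show "cmod (g z) \<le> A * exp (R * (4 * \<rho>)) / (3 * \<rho>) ^ N"
        using \<rho> by (simp add: pos_le_divide_eq mult.commute)
    qed simp
    moreover have "(\<Prod>a\<in>Z. cmod (w - a)) \<le> (\<Prod>a\<in>Z. 2 * \<rho>)"
    proof (rule prod_mono)
      fix a assume "a \<in> Z"
      then show "0 \<le> cmod (w - a) \<and> cmod (w - a) \<le> 2 * \<rho>"
        using Zb[of a] N(2) norm_triangle_ineq4[of w a] unfolding \<rho>_def by simp
    qed
    ultimately have "cmod (f w) \<le> (2 * \<rho>) ^ N * (A * exp (R * (4 * \<rho>)) / (3 * \<rho>) ^ N)"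
      unfolding g(2) norm_mult prod_norm[symmetric] using \<rho> by (intro mult_mono) (simp_all add: Z)
    also have "\<dots> = A * (exp (4 * R * \<rho>) * ((2 * \<rho>) / (3 * \<rho>)) ^ N)"
      unfolding power_divide by (simp add: mult_ac)
    also have "(2 * \<rho>) / (3 * \<rho>) = 2/3" using \<rho> by simp
    also have "exp (4 * R * \<rho>) = real N powr (4 * R)" using N(1) by (simp add: powr_def \<rho>_def)
    finally show ?thesis .
  qed
  have "(\<lambda>N. A * (real N powr (4 * R) * (2/3) ^ N)) \<longlonglongrightarrow> A * 0"
    by (intro tendsto_mult tendsto_const) real_asymp
  moreover have "eventually (\<lambda>N. cmod (f w) \<le> A * (real N powr (4 * R) * (2/3) ^ N)) sequentially"
  proof -
    have "filterlim (\<lambda>N. ln (real N)) at_top sequentially" by real_asymp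
    then have "eventually (\<lambda>N. cmod w \<le> ln (real N)) sequentially" by (simp add: filterlim_at_top)
    then show ?thesis using eventually_ge_at_top[of 2] by eventually_elim (rule bound)
  qed
  ultimately have "cmod (f w) \<le> A * 0"
    by (intro tendsto_le[OF _ _ tendsto_const]) auto
  then show ?thesis by simp
qed

section \<open>Weak limits and interpolation by square-summable sequences\<close>

lemma l2_cauchy_schwarz:
  fixes a b :: "nat \<Rightarrow> complex"
  assumes a: "summable (\<lambda>n. (cmod (a n))\<^sup>2)" and b: "summable (\<lambda>n. (cmod (b n))\<^sup>2)"
  shows "cmod (\<Sum>n. a n * b n) \<le> sqrt (\<Sum>n. (cmod (a n))\<^sup>2) * sqrt (\<Sum>n. (cmod (b n))\<^sup>2)"
proof -
  have ab: "summable (\<lambda>n. cmod (a n) * cmod (b n))" by (rule l2_mult_summable[OF a b])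
  have "cmod (\<Sum>n. a n * b n) \<le> (\<Sum>n. cmod (a n * b n))"
    by (rule summable_norm) (use ab in \<open>simp add: norm_mult\<close>)
  also have "\<dots> = (\<Sum>n. cmod (a n) * cmod (b n))" by (simp add: norm_mult)
  also have "\<dots> \<le> sqrt (\<Sum>n. (cmod (a n))\<^sup>2) * sqrt (\<Sum>n. (cmod (b n))\<^sup>2)"
  proof (rule suminf_le_const[OF ab])
    fix N
    have "(\<Sum>n<N. cmod (a n) * cmod (b n)) \<le> sqrt (\<Sum>n<N. (cmod (a n))\<^sup>2) * sqrt (\<Sum>n<N. (cmod (b n))\<^sup>2)"
      by (rule cauchy_schwarz_sum)
    also have "\<dots> \<le> sqrt (\<Sum>n. (cmod (a n))\<^sup>2) * sqrt (\<Sum>n. (cmod (b n))\<^sup>2)"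
      by (intro mult_mono real_sqrt_le_mono sum_le_suminf a b real_sqrt_ge_zero suminf_nonneg sum_nonneg) auto
    finally show "(\<Sum>n<N. cmod (a n) * cmod (b n)) \<le> sqrt (\<Sum>n. (cmod (a n))\<^sup>2) * sqrt (\<Sum>n. (cmod (b n))\<^sup>2)" .
  qed
  finally show ?thesis .
qed

lemma l2_weak_limit:
  fixes c :: "nat \<Rightarrow> nat \<Rightarrow> complex"
  assumes c: "\<And>m. summable (\<lambda>j. (cmod (c m j))\<^sup>2)" and B: "\<And>m. (\<Sum>j. (cmod (c m j))\<^sup>2) \<le> B"
    and lim: "\<And>j. (\<lambda>m. c m j) \<longlonglongrightarrow> c' j"
  shows "summable (\<lambda>j. (cmod (c' j))\<^sup>2)"
    and "summable (\<lambda>j. (cmod (y j))\<^sup>2) \<Longrightarrow> (\<lambda>m. \<Sum>j. c m j * y j) \<longlonglongrightarrow> (\<Sum>j. c' j * y j)"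
proof -
  have partial: "(\<Sum>j<n. (cmod (c m j))\<^sup>2) \<le> B" for m n
    using sum_le_suminf[OF c[of m], of "{..<n}"] B[of m] by fastforce
  have partial': "(\<Sum>j<n. (cmod (c' j))\<^sup>2) \<le> B" for n
  proof (rule LIMSEQ_le_const2)
    show "(\<lambda>m. \<Sum>j<n. (cmod (c m j))\<^sup>2) \<longlonglongrightarrow> (\<Sum>j<n. (cmod (c' j))\<^sup>2)"
      by (intro tendsto_sum tendsto_power tendsto_norm lim)
  qed (use partial in blast)
  show c': "summable (\<lambda>j. (cmod (c' j))\<^sup>2)"
    by (rule summableI_nonneg_bounded[OF _ partial']) simp
  assume y: "summable (\<lambda>j. (cmod (y j))\<^sup>2)"
  define e where "e m j = c m j + (-1) * c' j" for m j
  have e: "summable (\<lambda>j. (cmod (e m j))\<^sup>2)" for m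
    unfolding e_def by (rule l2_lin_summable[OF c c'])
  define T where "T N = (\<Sum>j. (cmod (y (j + N)))\<^sup>2)" for N
  have T: "T \<longlonglongrightarrow> 0"
  proof -
    have "(\<lambda>N. (\<Sum>j. (cmod (y j))\<^sup>2) - (\<Sum>j<N. (cmod (y j))\<^sup>2)) \<longlonglongrightarrow> (\<Sum>j. (cmod (y j))\<^sup>2) - (\<Sum>j. (cmod (y j))\<^sup>2)"
      by (intro tendsto_diff tendsto_const summable_LIMSEQ y)
    then show ?thesis unfolding T_def[abs_def] suminf_minus_initial_segment[OF y] by simp
  qed
  have B0: "B \<ge> 0" using partial[of 0 0] by simp
  have tail: "cmod (\<Sum>j. e m (j + N) * y (j + N)) \<le> sqrt (4 * B) * sqrt (T N)" for m N
  proof -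
    have sh: "summable (\<lambda>j. (cmod (e m (j + N)))\<^sup>2)"
      by (subst summable_iff_shift[where f = "\<lambda>j. (cmod (e m j))\<^sup>2"]) (rule e)
    have shy: "summable (\<lambda>j. (cmod (y (j + N)))\<^sup>2)"
      by (subst summable_iff_shift[where f = "\<lambda>j. (cmod (y j))\<^sup>2"]) (rule y)
    have "(\<Sum>j. (cmod (e m (j + N)))\<^sup>2) \<le> 4 * B"
    proof (rule suminf_le_const[OF sh])
      fix n
      have "(\<Sum>j<n. (cmod (e m (j + N)))\<^sup>2) = (\<Sum>j\<in>(\<lambda>j. j + N) ` {..<n}. (cmod (e m j))\<^sup>2)"
        by (subst sum.reindex) (auto simp: o_def)
      also have "\<dots> \<le> (\<Sum>j<n + N. (cmod (e m j))\<^sup>2)" by (rule sum_mono2) auto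
      also have "\<dots> \<le> (\<Sum>j<n + N. 2 * (cmod (c m j))\<^sup>2 + 2 * (cmod (c' j))\<^sup>2)"
      proof (rule sum_mono)
        fix j show "(cmod (e m j))\<^sup>2 \<le> 2 * (cmod (c m j))\<^sup>2 + 2 * (cmod (c' j))\<^sup>2"
          using norm_add_sq_le[of "c m j" "- c' j"] by (simp add: e_def)
      qed
      also have "\<dots> = 2 * (\<Sum>j<n + N. (cmod (c m j))\<^sup>2) + 2 * (\<Sum>j<n + N. (cmod (c' j))\<^sup>2)"
        by (simp add: sum.distrib sum_distrib_left)
      also have "\<dots> \<le> 4 * B" using partial[of m "n + N"] partial'[of "n + N"] by linarith
      finally show "(\<Sum>j<n. (cmod (e m (j + N)))\<^sup>2) \<le> 4 * B" .
    qed
    then have "sqrt (\<Sum>j. (cmod (e m (j + N)))\<^sup>2) * sqrt (T N) \<le> sqrt (4 * B) * sqrt (T N)"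
      by (intro mult_right_mono real_sqrt_le_mono real_sqrt_ge_zero) (auto simp: T_def intro: suminf_nonneg[OF shy])
    then show ?thesis using l2_cauchy_schwarz[OF sh shy] unfolding T_def by linarith
  qed
  have ey: "summable (\<lambda>j. e m j * y j)" for m by (rule l2_mult_summable'[OF e y])
  have "(\<lambda>m. \<Sum>j. e m j * y j) \<longlonglongrightarrow> 0"
  proof (rule LIMSEQ_I)
    fix \<epsilon> :: real assume \<epsilon>: "\<epsilon> > 0"
    have "(\<lambda>N. sqrt (4 * B) * sqrt (T N)) \<longlonglongrightarrow> sqrt (4 * B) * sqrt 0"
      by (intro tendsto_mult tendsto_const tendsto_real_sqrt T)
    then have "eventually (\<lambda>N. sqrt (4 * B) * sqrt (T N) < \<epsilon> / 2) sequentially"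
      by (rule order_tendstoD(2)) (use \<epsilon> in simp)
    then obtain N where N: "sqrt (4 * B) * sqrt (T N) < \<epsilon> / 2" by (auto simp: eventually_sequentially)
    have "(\<lambda>m. \<Sum>j<N. e m j * y j) \<longlonglongrightarrow> (\<Sum>j<N. (c' j + (-1) * c' j) * y j)"
      unfolding e_def by (intro tendsto_intros lim)
    then have "(\<lambda>m. \<Sum>j<N. e m j * y j) \<longlonglongrightarrow> 0" by simp
    from LIMSEQ_D[OF this, of "\<epsilon> / 2"] obtain M where M: "\<And>m. m \<ge> M \<Longrightarrow> cmod (\<Sum>j<N. e m j * y j) < \<epsilon> / 2"
      using \<epsilon> by auto
    show "\<exists>M. \<forall>m\<ge>M. norm ((\<Sum>j. e m j * y j) - 0) < \<epsilon>"
    proof (intro exI[of _ M] allI impI)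
      fix m assume m: "m \<ge> M"
      have "(\<Sum>j. e m j * y j) = (\<Sum>j. e m (j + N) * y (j + N)) + (\<Sum>j<N. e m j * y j)"
        by (rule suminf_split_initial_segment[OF ey])
      then have "cmod (\<Sum>j. e m j * y j) \<le> cmod (\<Sum>j. e m (j + N) * y (j + N)) + cmod (\<Sum>j<N. e m j * y j)"
        by (simp only: norm_triangle_ineq)
      then show "norm ((\<Sum>j. e m j * y j) - 0) < \<epsilon>" using M[OF m] tail[of m N] N by simp
    qed
  qed
  moreover have "(\<Sum>j. e m j * y j) = (\<Sum>j. c m j * y j) - (\<Sum>j. c' j * y j)" for m
  proof -
    have "e m j * y j = c m j * y j - c' j * y j" for j by (simp add: e_def algebra_simps)
    then show ?thesis
      using suminf_diff[OF l2_mult_summable'[OF c[of m] y] l2_mult_summable'[OF c' y]] by simp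
  qed
  ultimately have "(\<lambda>m. (\<Sum>j. c m j * y j) - (\<Sum>j. c' j * y j)) \<longlonglongrightarrow> 0" by simp
  then show "(\<lambda>m. \<Sum>j. c m j * y j) \<longlonglongrightarrow> (\<Sum>j. c' j * y j)" by (rule Lim_null[THEN iffD2])
qed

lemma bounded_pointwise_subsequence:
  fixes f :: "nat \<Rightarrow> nat \<Rightarrow> complex"
  assumes bd: "\<And>m j. cmod (f m j) \<le> M"
  shows "\<exists>k l. strict_mono (k :: nat \<Rightarrow> nat) \<and> (\<forall>j. (\<lambda>m. f (k m) j) \<longlonglongrightarrow> l j)"
proof (rule function_convergent_subsequence[of UNIV f M])
  show "cmod (f n x) \<le> M" for n x by (rule bd)
  fix k :: "nat \<Rightarrow> nat"
  assume k: "strict_mono k" "\<And>j. j \<in> UNIV \<Longrightarrow> \<exists>l. (\<lambda>m. f (k m) j) \<longlonglongrightarrow> l"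
  have "\<forall>j. \<exists>l. (\<lambda>m. f (k m) j) \<longlonglongrightarrow> l" using k(2) by simp
  from choice[OF this] show ?thesis using k(1) by blast
qed simp

text \<open>
  Induction on the size: the vector \<open>w\<close>, with last entry 1, is orthogonal to the first \<open>m\<close> basis vectors with respect to
  \<open>G\<close>, so adding a multiple of it corrects the last equation only.  It is not orthogonal to the last basis vector
  because the form vanishes only at 0.
\<close>

lemma gram_solve:
  fixes G :: "nat \<Rightarrow> nat \<Rightarrow> complex"
  assumes "\<And>c. (\<Sum>i<m. \<Sum>j<m. c i * cnj (c j) * G i j) = 0 \<Longrightarrow> \<forall>i<m. c i = 0"
  shows "\<exists>c. \<forall>j<m. (\<Sum>i<m. c i * G i j) = a j"
  using assms
proof (induction m arbitrary: a)
  case (Suc m)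
  have pd: "\<forall>i<m. c i = 0" if "(\<Sum>i<m. \<Sum>j<m. c i * cnj (c j) * G i j) = 0" for c
  proof -
    define c' where "c' i = (if i < m then c i else 0)" for i
    have "(\<Sum>i<Suc m. \<Sum>j<Suc m. c' i * cnj (c' j) * G i j) = (\<Sum>i<m. \<Sum>j<m. c i * cnj (c j) * G i j)"
      by (simp add: c'_def)
    then have "(\<Sum>i<Suc m. \<Sum>j<Suc m. c' i * cnj (c' j) * G i j) = 0" by (simp only: that)
    from Suc.prems[OF this] have c'0: "\<forall>i<Suc m. c' i = 0" .
    show ?thesis
    proof (intro allI impI)
      fix i assume "i < m"
      then show "c i = 0" using c'0[THEN spec[of _ i]] by (simp add: c'_def)
    qed
  qed
  note IH = Suc.IH[OF pd]
  obtain p where p: "\<forall>j<m. (\<Sum>i<m. p i * G i j) = - G m j" using IH[of "\<lambda>j. - G m j"] by blast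
  define w where "w i = (if i < m then p i else 1)" for i
  have w: "(\<Sum>i<Suc m. w i * G i j) = 0" if "j < m" for j
    using p that by (simp add: w_def)
  define t where "t = (\<Sum>i<Suc m. w i * G i m)"
  have "t \<noteq> 0"
  proof
    assume "t = 0"
    then have all: "(\<Sum>i<Suc m. w i * G i j) = 0" if "j < Suc m" for j
      using w[of j] that unfolding t_def by (cases "j = m") auto
    have "(\<Sum>i<Suc m. \<Sum>j<Suc m. w i * cnj (w j) * G i j) = (\<Sum>j<Suc m. \<Sum>i<Suc m. w i * cnj (w j) * G i j)"
      by (rule sum.swap)
    also have "\<dots> = (\<Sum>j<Suc m. cnj (w j) * (\<Sum>i<Suc m. w i * G i j))"
      by (simp only: sum_distrib_left mult_ac)
    also have "\<dots> = 0" using all by (intro sum.neutral ballI) (simp only: lessThan_iff mult_zero_right)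
    finally have "(\<Sum>i<Suc m. \<Sum>j<Suc m. w i * cnj (w j) * G i j) = 0" .
    from Suc.prems[OF this] have "w m = 0" by simp
    then show False by (simp add: w_def)
  qed
  obtain c where c: "\<forall>j<m. (\<Sum>i<m. c i * G i j) = a j" using IH[of a] by blast
  define u where "u = (\<Sum>i<m. c i * G i m)"
  define c' where "c' i = (if i < m then c i else 0) + (a m - u) / t * w i" for i
  have "(\<Sum>i<Suc m. c' i * G i j) = (\<Sum>i<m. c i * G i j) + (a m - u) / t * (\<Sum>i<Suc m. w i * G i j)" for j
  proof -
    have "(\<Sum>i<Suc m. c' i * G i j) = (\<Sum>i<Suc m. (if i < m then c i else 0) * G i j) + (\<Sum>i<Suc m. (a m - u) / t * (w i * G i j))"
      unfolding sum.distrib[symmetric] by (intro sum.cong refl) (simp only: c'_def distrib_right mult.assoc)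
    also have "(\<Sum>i<Suc m. (if i < m then c i else 0) * G i j) = (\<Sum>i<m. c i * G i j)" by simp
    finally show ?thesis by (simp only: sum_distrib_left)
  qed
  then have "\<forall>j<Suc m. (\<Sum>i<Suc m. c' i * G i j) = a j"
    using c w \<open>t \<noteq> 0\<close> unfolding less_Suc_eq t_def[symmetric] u_def[symmetric]
    by (auto simp: t_def[symmetric] u_def[symmetric] simp del: sum.lessThan_Suc)
  then show ?case by blast
qed simp

lemma gram_form_eq_norm_sq:
  fixes v :: "nat \<Rightarrow> nat \<Rightarrow> complex"
  assumes v: "\<And>j. summable (\<lambda>n. (cmod (v j n))\<^sup>2)"
  shows "summable (\<lambda>n. (cmod (\<Sum>j<m. c j * v j n))\<^sup>2)"
    and "(\<Sum>i<m. \<Sum>j<m. c i * cnj (c j) * (\<Sum>n. v i n * cnj (v j n))) =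
       complex_of_real (\<Sum>n. (cmod (\<Sum>j<m. c j * v j n))\<^sup>2)"
proof -
  show s: "summable (\<lambda>n. (cmod (\<Sum>j<m. c j * v j n))\<^sup>2)"
  proof (induction m)
    case (Suc m)
    then show ?case using l2_lin_summable[OF Suc v[of m], of "c m"] by simp
  qed simp
  have g: "summable (\<lambda>n. v i n * cnj (v j n))" for i j
    by (rule l2_mult_summable'[OF v]) (simp add: v)
  have 1: "(\<lambda>n. \<Sum>i<m. \<Sum>j<m. c i * cnj (c j) * (v i n * cnj (v j n))) sums
     (\<Sum>i<m. \<Sum>j<m. c i * cnj (c j) * (\<Sum>n. v i n * cnj (v j n)))"
    by (intro sums_sum sums_mult summable_sums g)
  have 2: "(\<Sum>i<m. \<Sum>j<m. c i * cnj (c j) * (v i n * cnj (v j n))) = complex_of_real ((cmod (\<Sum>j<m. c j * v j n))\<^sup>2)" for n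
    unfolding complex_norm_square cnj_sum sum_product by (simp add: mult_ac)
  have 3: "(\<lambda>n. complex_of_real ((cmod (\<Sum>j<m. c j * v j n))\<^sup>2)) sums complex_of_real (\<Sum>n. (cmod (\<Sum>j<m. c j * v j n))\<^sup>2)"
    by (intro sums_of_real summable_sums s)
  show "(\<Sum>i<m. \<Sum>j<m. c i * cnj (c j) * (\<Sum>n. v i n * cnj (v j n))) =
       complex_of_real (\<Sum>n. (cmod (\<Sum>j<m. c j * v j n))\<^sup>2)"
    by (rule sums_unique2[OF 1[unfolded 2] 3])
qed

text \<open>
  The solution is sought in the span of the vectors \<open>v\<^sub>j\<close>, where the lower bound makes the Gram matrix nonsingular.  For
  \<open>\<alpha> = \<Sum> c\<^sub>j v\<^sub>j\<close> one has \<open>\<parallel>\<alpha>\<parallel>\<^sup>2 = \<Sum> cnj c\<^sub>j b\<^sub>j \<le> \<parallel>c\<parallel> \<parallel>b\<parallel> \<le> (\<parallel>\<alpha>\<parallel> / \<delta>\<^bsup>1/2\<^esup>) \<parallel>b\<parallel>\<close>, hence the norm bound uniform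
  in \<open>m\<close>.
\<close>

lemma l2_interpolation_finite:
  fixes v :: "nat \<Rightarrow> nat \<Rightarrow> complex"
  assumes v: "\<And>j. summable (\<lambda>n. (cmod (v j n))\<^sup>2)" and \<delta>: "\<delta> > 0"
    and lower: "\<And>c. \<delta> * (\<Sum>j<m. (cmod (c j))\<^sup>2) \<le> (\<Sum>n. (cmod (\<Sum>j<m. c j * v j n))\<^sup>2)"
    and B: "(\<Sum>j<m. (cmod (b j))\<^sup>2) \<le> B"
  shows "\<exists>\<alpha>. summable (\<lambda>n. (cmod (\<alpha> n))\<^sup>2) \<and> (\<Sum>n. (cmod (\<alpha> n))\<^sup>2) \<le> B / \<delta> \<and>
    (\<forall>j<m. (\<Sum>n. \<alpha> n * cnj (v j n)) = b j)"
proof -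
  define G where "G i j = (\<Sum>n. v i n * cnj (v j n))" for i j
  have "\<forall>i<m. c i = 0" if "(\<Sum>i<m. \<Sum>j<m. c i * cnj (c j) * G i j) = 0" for c
  proof -
    have "complex_of_real (\<Sum>n. (cmod (\<Sum>j<m. c j * v j n))\<^sup>2) = 0"
      using gram_form_eq_norm_sq(2)[where v = v and m = m and c = c, OF v] that unfolding G_def by simp
    then have "(\<Sum>n. (cmod (\<Sum>j<m. c j * v j n))\<^sup>2) = 0" by (simp only: of_real_eq_0_iff)
    then have "\<delta> * (\<Sum>j<m. (cmod (c j))\<^sup>2) \<le> 0" using lower[of c] by (simp only:)
    then have "(\<Sum>j<m. (cmod (c j))\<^sup>2) \<le> 0" using \<delta> by (simp add: mult_le_0_iff)
    then have "(\<Sum>j<m. (cmod (c j))\<^sup>2) = 0" by (simp add: antisym sum_nonneg)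
    then show ?thesis by (simp add: sum_nonneg_eq_0_iff)
  qed
  from gram_solve[OF this] obtain c where c: "\<forall>j<m. (\<Sum>i<m. c i * G i j) = b j" by blast
  define \<alpha> where "\<alpha> n = (\<Sum>j<m. c j * v j n)" for n
  have sa: "summable (\<lambda>n. (cmod (\<alpha> n))\<^sup>2)" unfolding \<alpha>_def by (rule gram_form_eq_norm_sq(1)[OF v])
  have val: "(\<Sum>n. \<alpha> n * cnj (v j n)) = b j" if j: "j < m" for j
  proof -
    have "summable (\<lambda>n. v i n * cnj (v j n))" for i
      by (rule l2_mult_summable'[OF v]) (simp add: v)
    then have "(\<lambda>n. \<Sum>i<m. c i * (v i n * cnj (v j n))) sums (\<Sum>i<m. c i * G i j)"
      unfolding G_def by (intro sums_sum sums_mult summable_sums)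
    then show ?thesis using c j unfolding \<alpha>_def by (simp add: sums_iff sum_distrib_right mult.assoc)
  qed
  define A where "A = (\<Sum>n. (cmod (\<alpha> n))\<^sup>2)"
  have A0: "A \<ge> 0" unfolding A_def by (rule suminf_nonneg[OF sa]) simp
  have B0: "B \<ge> 0" using B sum_nonneg[of "{..<m}" "\<lambda>j. (cmod (b j))\<^sup>2"] by (meson order_trans zero_le_power2)
  have "complex_of_real A = (\<Sum>i<m. \<Sum>j<m. c i * cnj (c j) * G i j)"
    unfolding A_def \<alpha>_def G_def by (rule gram_form_eq_norm_sq(2)[OF v, symmetric])
  also have "\<dots> = (\<Sum>j<m. \<Sum>i<m. c i * cnj (c j) * G i j)" by (rule sum.swap)
  also have "\<dots> = (\<Sum>j<m. cnj (c j) * (\<Sum>i<m. c i * G i j))"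
    by (simp only: sum_distrib_left mult_ac)
  also have "\<dots> = (\<Sum>j<m. cnj (c j) * b j)" using c by simp
  finally have "complex_of_real A = (\<Sum>j<m. cnj (c j) * b j)" .
  then have "A = cmod (\<Sum>j<m. cnj (c j) * b j)" using A0 by (metis abs_of_nonneg norm_of_real)
  also have "\<dots> \<le> (\<Sum>j<m. cmod (c j) * cmod (b j))"
    by (rule order.trans[OF norm_sum]) (simp add: norm_mult)
  also have "\<dots> \<le> sqrt (\<Sum>j<m. (cmod (c j))\<^sup>2) * sqrt (\<Sum>j<m. (cmod (b j))\<^sup>2)" by (rule cauchy_schwarz_sum)
  also have "\<dots> \<le> sqrt (A / \<delta>) * sqrt B"
  proof (intro mult_mono real_sqrt_le_mono B)
    show "(\<Sum>j<m. (cmod (c j))\<^sup>2) \<le> A / \<delta>"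
      using lower[of c] \<delta> unfolding A_def \<alpha>_def by (simp add: pos_le_divide_eq mult.commute)
  qed (use A0 \<delta> in \<open>auto intro: sum_nonneg\<close>)
  finally have "A \<le> sqrt (A / \<delta> * B)" by (simp only: real_sqrt_mult)
  then have "A\<^sup>2 \<le> (sqrt (A / \<delta> * B))\<^sup>2" by (rule power_mono[OF _ A0])
  also have "\<dots> = A / \<delta> * B" using A0 B0 \<delta> by (intro real_sqrt_pow2) simp
  finally have "A * A \<le> A * (B / \<delta>)" by (simp add: power2_eq_square)
  then have "A = 0 \<or> A \<le> B / \<delta>" using A0 by (metis mult_le_cancel_left_pos order_le_less)
  then have "A \<le> B / \<delta>" using B0 \<delta> by auto
  then show ?thesis using sa val unfolding A_def by blast
qed

text \<open>
  A weak limit of the solutions of the finite problems.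
\<close>

lemma l2_interpolation:
  fixes v :: "nat \<Rightarrow> nat \<Rightarrow> complex"
  assumes v: "\<And>j. summable (\<lambda>n. (cmod (v j n))\<^sup>2)" and \<delta>: "\<delta> > 0"
    and lower: "\<And>m c. \<delta> * (\<Sum>j<m. (cmod (c j))\<^sup>2) \<le> (\<Sum>n. (cmod (\<Sum>j<m. c j * v j n))\<^sup>2)"
    and b: "summable (\<lambda>j. (cmod (b j))\<^sup>2)"
  shows "\<exists>\<alpha>. summable (\<lambda>n. (cmod (\<alpha> n))\<^sup>2) \<and> (\<forall>j. (\<Sum>n. \<alpha> n * cnj (v j n)) = b j)"
proof -
  define B where "B = (\<Sum>j. (cmod (b j))\<^sup>2)"
  have "(\<Sum>j<m. (cmod (b j))\<^sup>2) \<le> B" for m unfolding B_def by (rule sum_le_suminf[OF b]) auto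
  then have "\<forall>m. \<exists>\<alpha>. summable (\<lambda>n. (cmod (\<alpha> n))\<^sup>2) \<and> (\<Sum>n. (cmod (\<alpha> n))\<^sup>2) \<le> B / \<delta> \<and>
    (\<forall>j<m. (\<Sum>n. \<alpha> n * cnj (v j n)) = b j)"
    by (intro allI l2_interpolation_finite[OF v \<delta> lower])
  from choice[OF this] obtain \<alpha> where \<alpha>: "\<And>m. summable (\<lambda>n. (cmod (\<alpha> m n))\<^sup>2)"
    "\<And>m. (\<Sum>n. (cmod (\<alpha> m n))\<^sup>2) \<le> B / \<delta>" "\<And>m j. j < m \<Longrightarrow> (\<Sum>n. \<alpha> m n * cnj (v j n)) = b j" by blast
  have bd: "cmod (\<alpha> m n) \<le> sqrt (B / \<delta>)" for m n
  proof -
    have "(cmod (\<alpha> m n))\<^sup>2 \<le> B / \<delta>"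
      using sum_le_suminf[OF \<alpha>(1)[of m], of "{n}"] \<alpha>(2)[of m] by simp
    then show ?thesis by (rule real_le_rsqrt)
  qed
  from bounded_pointwise_subsequence[of \<alpha>, OF bd]
  obtain k \<beta> where k: "strict_mono (k :: nat \<Rightarrow> nat)" and \<beta>: "\<And>n. (\<lambda>m. \<alpha> (k m) n) \<longlonglongrightarrow> \<beta> n" by blast
  have "(\<Sum>n. \<beta> n * cnj (v j n)) = b j" for j
  proof -
    have "summable (\<lambda>n. (cmod (cnj (v j n)))\<^sup>2)" by (simp add: v)
    then have "(\<lambda>m. \<Sum>n. \<alpha> (k m) n * cnj (v j n)) \<longlonglongrightarrow> (\<Sum>n. \<beta> n * cnj (v j n))"
      by (rule l2_weak_limit(2)[of "\<lambda>m. \<alpha> (k m)", OF \<alpha>(1) \<alpha>(2) \<beta>])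
    moreover have "eventually (\<lambda>m. (\<Sum>n. \<alpha> (k m) n * cnj (v j n)) = b j) sequentially"
      using eventually_gt_at_top[of j]
    proof eventually_elim
      case (elim m)
      then have "j < k m" using seq_suble[OF k(1), of m] by linarith
      then show ?case by (rule \<alpha>(3))
    qed
    then have "(\<lambda>m. \<Sum>n. \<alpha> (k m) n * cnj (v j n)) \<longlonglongrightarrow> b j" by (rule tendsto_eventually)
    ultimately show ?thesis using LIMSEQ_unique by blast
  qed
  moreover have "summable (\<lambda>n. (cmod (\<beta> n))\<^sup>2)"
    by (rule l2_weak_limit(1)[of "\<lambda>m. \<alpha> (k m)", OF \<alpha>(1) \<alpha>(2) \<beta>])
  ultimately show ?thesis by blast
qed

section \<open>From integrals to sums over the integers\<close>

text \<open>
  The mean value inequality in the variable \<open>ln x\<close>.  For \<open>y = \<lfloor>x\<rfloor>\<close> the bound is square-integrable in \<open>x\<close>.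
\<close>

lemma xpow_increment_bound:
  assumes y: "1 \<le> y" "y \<le> x" "x \<le> y + 1" and s: "1/2 < Re s" "cmod s \<le> R"
  shows "cmod (xpow x s - xpow y s) \<le> R / y"
proof -
  have R0: "0 \<le> R" using s(2) norm_ge_zero[of s] by linarith
  define f where "f z = exp (- (s * z))" for z :: complex
  let ?S = "closed_segment (complex_of_real (ln y)) (of_real (ln x))"
  have "cmod (f (of_real (ln x)) - f (of_real (ln y))) \<le> R * cmod (complex_of_real (ln x) - of_real (ln y))"
  proof (rule field_differentiable_bound[of ?S])
    show "(f has_field_derivative - (s * exp (- (s * z)))) (at z within ?S)" for z
      unfolding f_def by (auto intro!: derivative_eq_intros)
    fix z assume "z \<in> ?S"
    then obtain t where t: "z = of_real t" "ln y \<le> t"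
      using y by (auto simp: closed_segment_of_real closed_segment_eq_real_ivl)
    have "0 \<le> ln y" using y by simp
    then have "0 \<le> Re s * t" using t s by (intro mult_nonneg_nonneg) linarith+
    then have "cmod (exp (- (s * z))) \<le> 1" by (simp add: t)
    then have "cmod s * cmod (exp (- (s * z))) \<le> R * 1" using s(2) R0 by (intro mult_mono) auto
    then show "cmod (- (s * exp (- (s * z)))) \<le> R" by (simp add: norm_mult)
  qed auto
  also have "cmod (complex_of_real (ln x) - of_real (ln y)) = \<bar>ln x - ln y\<bar>"
    by (metis norm_of_real of_real_diff)
  also have "\<dots> = ln (x / y)" using y by (simp add: ln_div)
  also have "ln (x / y) \<le> x / y - 1" using y by (intro ln_le_minus_one) simp
  also have "x / y - 1 \<le> 1 / y"
  proof -
    have "(x - y) / y \<le> 1 / y" using y by (intro divide_right_mono) auto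
    then show ?thesis using y by (simp add: diff_divide_distrib)
  qed
  finally have "cmod (f (of_real (ln x)) - f (of_real (ln y))) \<le> R * (1 / y)"
    using R0 by (simp add: mult_left_mono)
  then show ?thesis by (simp add: f_def xpow_def)
qed

text \<open>
  In the variable \<open>z = ln x\<close> the series is an entire function of exponential type that vanishes at the logarithms of the
  integers.
\<close>

lemma exponential_series_zero:
  fixes e s :: "nat \<Rightarrow> complex"
  assumes e: "summable (\<lambda>j. cmod (e j))" and R: "\<And>j. cmod (s j) \<le> R"
    and z: "\<And>n. (\<Sum>j. e j * xpow (real (Suc n)) (s j)) = 0"
  shows "(\<Sum>j. e j * xpow x (s j)) = 0"
proof -
  define f where "f z = (\<Sum>j. e j * exp (- (s j * z)))" for z
  have R0: "R \<ge> 0" using R[of 0] norm_ge_zero[of "s 0"] by linarith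
  have le_exp: "cmod (e j * exp (- (s j * z))) \<le> cmod (e j) * exp (R * cmod z)" for j z
  proof -
    have "- Re (s j * z) \<le> cmod (s j * z)" using abs_Re_le_cmod[of "s j * z"] by linarith
    also have "\<dots> \<le> R * cmod z" unfolding norm_mult by (intro mult_right_mono R) simp
    finally have "cmod (exp (- (s j * z))) \<le> exp (R * cmod z)" by simp
    then show ?thesis unfolding norm_mult by (rule mult_left_mono) simp
  qed
  have sm: "summable (\<lambda>j. cmod (e j * exp (- (s j * z))))" for z
    by (rule summable_comparison_test'[where N = 0, OF summable_mult2[OF e]]) (use le_exp in auto)
  have "f (of_real (ln x)) = 0"
  proof (rule exponential_type_zero_at_logs[where f = f and R = R])
    show "f holomorphic_on UNIV"
    proof (rule holomorphic_uniform_sequence[OF open_UNIV])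
      show "(\<lambda>z. \<Sum>j<n. e j * exp (- (s j * z))) holomorphic_on UNIV" for n
        by (intro holomorphic_intros)
      fix w :: complex
      have "uniform_limit (cball w 1) (\<lambda>n z. \<Sum>j<n. e j * exp (- (s j * z))) (\<lambda>z. \<Sum>j. e j * exp (- (s j * z))) sequentially"
      proof (rule Weierstrass_m_test)
        show "summable (\<lambda>j. cmod (e j) * exp (R * (cmod w + 1)))" by (rule summable_mult2[OF e])
        fix j z assume "z \<in> cball w 1"
        then have "cmod z \<le> cmod w + 1"
          using norm_triangle_sub[of z w] by (simp add: dist_norm norm_minus_commute)
        then have "cmod (e j) * exp (R * cmod z) \<le> cmod (e j) * exp (R * (cmod w + 1))"
          using R0 by (intro mult_left_mono) (auto intro: mult_left_mono)
        then show "cmod (e j * exp (- (s j * z))) \<le> cmod (e j) * exp (R * (cmod w + 1))"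
          using le_exp[of j z] by linarith
      qed
      then show "\<exists>d>0. cball w d \<subseteq> UNIV \<and> uniform_limit (cball w d) (\<lambda>n z. \<Sum>j<n. e j * exp (- (s j * z))) f sequentially"
        unfolding f_def[abs_def] by (intro exI[of _ 1]) auto
    qed
    show "cmod (f z) \<le> (\<Sum>j. cmod (e j)) * exp (R * cmod z)" for z
    proof -
      have "cmod (f z) \<le> (\<Sum>j. cmod (e j * exp (- (s j * z))))"
        unfolding f_def by (rule summable_norm[OF sm])
      also have "\<dots> \<le> (\<Sum>j. cmod (e j) * exp (R * cmod z))"
        by (intro suminf_le le_exp sm summable_mult2[OF e])
      also have "\<dots> = (\<Sum>j. cmod (e j)) * exp (R * cmod z)" by (rule suminf_mult2[OF e, symmetric])
      finally show ?thesis .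
    qed
    show "f (of_real (ln (real (Suc n)))) = 0" for n
      using z[of n] by (simp only: f_def xpow_def)
  qed (rule R0)
  then show ?thesis by (simp add: f_def xpow_def)
qed

lemma nn_integral_step:
  fixes a :: "nat \<Rightarrow> ennreal"
  shows "(\<integral>\<^sup>+x. (\<Sum>n. a n * indicator {real (Suc n)..<real (Suc (Suc n))} x) \<partial>lborel) = (\<Sum>n. a n)"
  by (subst nn_integral_suminf) (auto simp: nn_integral_cmult_indicator)

text \<open>
  \<open>|D(x)|\<^sup>2 \<le> 2 |D(\<lfloor>x\<rfloor>)|\<^sup>2 + 2 |D(x) - D(\<lfloor>x\<rfloor>)|\<^sup>2\<close>, and the first term is a step function.
\<close>

lemma integral_le_sum_plus_oscillation:
  fixes D :: "real \<Rightarrow> complex"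
  assumes [measurable]: "D \<in> borel_measurable lborel"
  shows "(\<integral>\<^sup>+x. ennreal (indicator {1<..} x * (cmod (D x))\<^sup>2) \<partial>lborel) \<le>
    (\<Sum>n. ennreal (2 * (cmod (D (real (Suc n))))\<^sup>2)) +
    (\<integral>\<^sup>+x. ennreal (2 * (indicator {1<..} x * (cmod (D x - D (of_int \<lfloor>x\<rfloor>)))\<^sup>2)) \<partial>lborel)"
proof -
  let ?a = "\<lambda>n. ennreal (2 * (cmod (D (real (Suc n))))\<^sup>2)"
  let ?h = "\<lambda>x. ennreal (2 * (indicator {1<..} x * (cmod (D x - D (of_int \<lfloor>x\<rfloor>)))\<^sup>2))"
  have "(\<integral>\<^sup>+x. ennreal (indicator {1<..} x * (cmod (D x))\<^sup>2) \<partial>lborel) \<le>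
     (\<integral>\<^sup>+x. (\<Sum>n. ?a n * indicator {real (Suc n)..<real (Suc (Suc n))} x) + ?h x \<partial>lborel)"
  proof (rule nn_integral_mono)
    fix x :: real
    show "ennreal (indicator {1<..} x * (cmod (D x))\<^sup>2) \<le>
      (\<Sum>n. ?a n * indicator {real (Suc n)..<real (Suc (Suc n))} x) + ?h x"
    proof (cases "x > 1")
      case True
      \<comment> \<open>terms are indexed from 0, so the index \<open>n\<close> belongs to the integer \<open>n + 1 = \<lfloor>x\<rfloor>\<close>\<close>
      define n where "n = nat \<lfloor>x\<rfloor> - 1"
      have fl: "\<lfloor>x\<rfloor> \<ge> 1" using True by (simp add: le_floor_iff)
      then have nx: "real (Suc n) = of_int \<lfloor>x\<rfloor>" by (simp add: n_def of_nat_diff)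
      have ind: "x \<in> {real (Suc n)..<real (Suc (Suc n))}"
        using nx by simp linarith
      have "(cmod (D x))\<^sup>2 \<le> 2 * (cmod (D (real (Suc n))))\<^sup>2 + 2 * (cmod (D x - D (real (Suc n))))\<^sup>2"
        using norm_add_sq_le[of "D (real (Suc n))" "D x - D (real (Suc n))"] by simp
      then have "ennreal (indicator {1<..} x * (cmod (D x))\<^sup>2) \<le>
         ennreal (2 * (cmod (D (real (Suc n))))\<^sup>2 + 2 * (cmod (D x - D (real (Suc n))))\<^sup>2)"
        using True by (intro ennreal_leI) simp
      also have "\<dots> = ?a n * indicator {real (Suc n)..<real (Suc (Suc n))} x + ?h x"
        using True ind unfolding nx by (simp add: ennreal_plus del: of_nat_Suc)
      also have "?a n * indicator {real (Suc n)..<real (Suc (Suc n))} x \<le> (\<Sum>n. ?a n * indicator {real (Suc n)..<real (Suc (Suc n))} x)"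
      proof -
        have single: "(\<Sum>i\<in>{n}. f i) = f n" for f :: "nat \<Rightarrow> ennreal" by simp
        have "(\<Sum>i\<in>{n}. ?a i * indicator {real (Suc i)..<real (Suc (Suc i))} x) \<le>
           (\<Sum>n. ?a n * indicator {real (Suc n)..<real (Suc (Suc n))} x)"
          by (rule sum_le_suminf) auto
        then show ?thesis unfolding single .
      qed
      finally show ?thesis by (simp add: add_right_mono)
    qed simp
  qed
  also have "\<dots> = (\<integral>\<^sup>+x. (\<Sum>n. ?a n * indicator {real (Suc n)..<real (Suc (Suc n))} x) \<partial>lborel) + (\<integral>\<^sup>+x. ?h x \<partial>lborel)"
    by (rule nn_integral_add) measurable
  finally show ?thesis unfolding nn_integral_step .
qed

text \<open>
  The heart of the theorem: the lower bound for integrals implies one for sums over the integers.  Suppose that unit vectors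
  \<open>c\<^sub>m\<close> have sums tending to 0, and let \<open>\<gamma>\<close> be the weak limit of a subsequence.  By the Blaschke condition the dual sums converge
  pointwise to the dual sum of \<open>\<gamma>\<close>, which vanishes at the integers, hence everywhere.  The oscillation between \<open>\<lfloor>x\<rfloor>\<close> and \<open>x\<close>
  is dominated by a multiple of \<open>1 / x\<close> and tends to 0 pointwise, so the integrals tend to 0 as well.
\<close>

lemma dirichlet_lower_bound:
  fixes s :: "nat \<Rightarrow> complex"
  assumes s: "\<And>j. s j \<in> half_plane" and R: "\<And>j. cmod (s j) \<le> R"
    and blaschke: "summable (\<lambda>j. 2 * Re (s j) - 1)"
  defines "r \<equiv> \<lambda>j. complex_of_real (sqrt (2 * Re (s j) - 1))"
  assumes \<delta>: "\<delta> > 0"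
    and hardy: "\<And>J c. \<delta> * (\<Sum>j<J. (cmod (c j))\<^sup>2) \<le> (hardy_norm (\<lambda>z. \<Sum>j<J. (c j * r j) * hardy_kernel (s j) z))\<^sup>2"
  shows "\<exists>\<epsilon>>0. \<forall>J c. \<epsilon> * (\<Sum>j<J. (cmod (c j))\<^sup>2) \<le> (\<Sum>n. (cmod (dual_sum s (\<lambda>j. c j * r j) J (real (Suc n))))\<^sup>2)"
proof (rule ccontr)
  assume contra: "\<not> ?thesis"
  have d: "2 * Re (s j) - 1 > 0" for j using s[of j] by (simp add: half_plane_simps)
  have r2: "(cmod (r j))\<^sup>2 = 2 * Re (s j) - 1" for j using d[of j] by (simp add: r_def)
  have sr: "summable (\<lambda>j. (cmod (r j))\<^sup>2)" unfolding r2 by (rule blaschke)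
  let ?D = "\<lambda>c. dual_sum s (\<lambda>j. c j * r j)"
  have R0: "R \<ge> 0" using R[of 0] norm_ge_zero[of "s 0"] by linarith
  have Dl2: "summable (\<lambda>n. (cmod (?D c J (real (Suc n))))\<^sup>2)" for c J
  proof -
    have "summable (\<lambda>n. (cmod (xpow (real (Suc n)) (cnj (s j))))\<^sup>2)" for j
      by (rule xpow_l2) (use s[of j] in \<open>simp add: half_plane_simps\<close>)
    from gram_form_eq_norm_sq(1)[where v = "\<lambda>j n. xpow (real (Suc n)) (cnj (s j))" and c = "\<lambda>j. c j * r j", OF this]
    show ?thesis by (simp only: dual_sum_def)
  qed
  have ex: "\<exists>c J. (\<Sum>n. (cmod (?D c J (real (Suc n))))\<^sup>2) < \<epsilon> * (\<Sum>j<J. (cmod (c j))\<^sup>2)" if "\<epsilon> > 0" for \<epsilon>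
  proof (rule ccontr)
    assume "\<not> ?thesis"
    then have "\<forall>J c. \<epsilon> * (\<Sum>j<J. (cmod (c j))\<^sup>2) \<le> (\<Sum>n. (cmod (?D c J (real (Suc n))))\<^sup>2)"
      by (metis not_le)
    then have "\<exists>\<epsilon>>0. \<forall>J c. \<epsilon> * (\<Sum>j<J. (cmod (c j))\<^sup>2) \<le> (\<Sum>n. (cmod (?D c J (real (Suc n))))\<^sup>2)"
      using that by (intro exI[of _ \<epsilon>] conjI)
    then show False by (rule notE[OF contra])
  qed
  have "\<forall>m. \<exists>c J. (\<Sum>n. (cmod (?D c J (real (Suc n))))\<^sup>2) < 1 / real (Suc m) * (\<Sum>j<J. (cmod (c j))\<^sup>2)"
    by (rule allI, rule ex) simp
  from choice[OF this] obtain c' where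
    "\<forall>m. \<exists>J. (\<Sum>n. (cmod (?D (c' m) J (real (Suc n))))\<^sup>2) < 1 / real (Suc m) * (\<Sum>j<J. (cmod (c' m j))\<^sup>2)" ..
  from choice[OF this] obtain J where c':
    "\<And>m. (\<Sum>n. (cmod (?D (c' m) (J m) (real (Suc n))))\<^sup>2) < 1 / real (Suc m) * (\<Sum>j<J m. (cmod (c' m j))\<^sup>2)" by blast
  define N where "N m = sqrt (\<Sum>j<J m. (cmod (c' m j))\<^sup>2)" for m
  have N2: "(N m)\<^sup>2 = (\<Sum>j<J m. (cmod (c' m j))\<^sup>2)" for m by (simp add: N_def sum_nonneg)
  have N: "N m > 0" for m
  proof -
    have "0 \<le> (\<Sum>n. (cmod (?D (c' m) (J m) (real (Suc n))))\<^sup>2)" by (rule suminf_nonneg[OF Dl2]) simp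
    then have "0 < 1 / real (Suc m) * (N m)\<^sup>2" using c'[of m] unfolding N2 by linarith
    then have "N m \<noteq> 0" by auto
    moreover have "N m \<ge> 0" by (simp add: N_def sum_nonneg)
    ultimately show ?thesis by simp
  qed
  define c where "c m j = (if j < J m then c' m j / of_real (N m) else 0)" for m j
  have unit: "(\<Sum>j<J m. (cmod (c m j))\<^sup>2) = 1" for m
  proof -
    have "(\<Sum>j<J m. (cmod (c m j))\<^sup>2) = (\<Sum>j<J m. (cmod (c' m j))\<^sup>2 / (N m)\<^sup>2)"
      by (intro sum.cong) (auto simp: c_def norm_divide power_divide)
    also have "\<dots> = 1" using N[of m] unfolding sum_divide_distrib[symmetric] N2[symmetric] by simp
    finally show ?thesis .
  qed
  have sums1: "(\<lambda>j. (cmod (c m j))\<^sup>2) sums 1" for m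
    using sums_finite[of "{..<J m}" "\<lambda>j. (cmod (c m j))\<^sup>2"] unit[of m] by (simp add: c_def)
  have DC: "?D (c m) (J m) x = ?D (c' m) (J m) x / of_real (N m)" for m x
    unfolding dual_sum_def sum_divide_distrib by (intro sum.cong) (auto simp: c_def)
  have small: "(\<Sum>n. (cmod (?D (c m) (J m) (real (Suc n))))\<^sup>2) \<le> 1 / real (Suc m)" for m
  proof -
    have "(\<Sum>n. (cmod (?D (c m) (J m) (real (Suc n))))\<^sup>2) = (\<Sum>n. (cmod (?D (c' m) (J m) (real (Suc n))))\<^sup>2 / (N m)\<^sup>2)"
      unfolding DC norm_divide power_divide norm_of_real by simp
    also have "\<dots> = (\<Sum>n. (cmod (?D (c' m) (J m) (real (Suc n))))\<^sup>2) / (N m)\<^sup>2"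
      by (rule suminf_divide[OF Dl2])
    also have "\<dots> \<le> (1 / real (Suc m) * (N m)\<^sup>2) / (N m)\<^sup>2"
      using c'[of m] unfolding N2[symmetric] by (intro divide_right_mono) auto
    also have "\<dots> = 1 / real (Suc m)" using N[of m] by simp
    finally show ?thesis .
  qed
  have cb: "cmod (c m j) \<le> 1" for m j
  proof -
    have "(cmod (c m j))\<^sup>2 \<le> 1"
      using sum_le_suminf[OF sums_summable[OF sums1[of m]], of "{j}"] sums_unique[OF sums1[of m]] by simp
    then show ?thesis by (simp add: power_le_one_iff abs_square_le_1)
  qed
  from bounded_pointwise_subsequence[of c, OF cb]
  obtain k \<gamma> where k: "strict_mono (k :: nat \<Rightarrow> nat)" and \<gamma>: "\<And>j. (\<lambda>m. c (k m) j) \<longlonglongrightarrow> \<gamma> j" by blast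
  note weak = l2_weak_limit[of "\<lambda>m. c (k m)" 1 \<gamma>, OF sums_summable[OF sums1] _ \<gamma>]
  have \<gamma>2: "summable (\<lambda>j. (cmod (\<gamma> j))\<^sup>2)"
    by (rule weak(1)) (use sums_unique[OF sums1] in \<open>simp add: sums_unique[OF sums1, symmetric]\<close>)
  define E where "E m = ?D (c (k m)) (J (k m))" for m
  have Elim: "(\<lambda>m. E m x) \<longlonglongrightarrow> (\<Sum>j. \<gamma> j * r j * xpow x (cnj (s j)))" if x: "x \<ge> 1" for x
  proof -
    have "summable (\<lambda>j. (cmod (r j * xpow x (cnj (s j))))\<^sup>2)"
    proof (rule summable_comparison_test'[where N = 0, OF sr])
      fix j :: nat
      have "0 \<le> Re (s j) * ln x" using s[of j] x by (intro mult_nonneg_nonneg) (auto simp: half_plane_simps)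
      then have "cmod (xpow x (cnj (s j))) \<le> 1" by (simp add: norm_xpow)
      then have "cmod (r j * xpow x (cnj (s j))) \<le> cmod (r j) * 1"
        unfolding norm_mult by (rule mult_left_mono) simp
      then show "norm ((cmod (r j * xpow x (cnj (s j))))\<^sup>2) \<le> (cmod (r j))\<^sup>2" by (simp add: power_mono)
    qed
    then have "(\<lambda>m. \<Sum>j. c (k m) j * (r j * xpow x (cnj (s j)))) \<longlonglongrightarrow> (\<Sum>j. \<gamma> j * (r j * xpow x (cnj (s j))))"
      by (intro weak(2)) (simp add: sums_unique[OF sums1, symmetric])
    moreover have "(\<Sum>j. c (k m) j * (r j * xpow x (cnj (s j)))) = E m x" for m
      using suminf_finite[of "{..<J (k m)}" "\<lambda>j. c (k m) j * (r j * xpow x (cnj (s j)))"]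
      by (simp add: E_def dual_sum_def c_def mult.assoc)
    ultimately show ?thesis by (simp add: mult.assoc)
  qed
  have kinv: "(\<lambda>m. 1 / real (Suc (k m))) \<longlonglongrightarrow> 0"
    using LIMSEQ_subseq_LIMSEQ[OF LIMSEQ_inverse_real_of_nat k(1)] by (simp add: o_def inverse_eq_divide)
  have zero_int: "(\<Sum>j. \<gamma> j * r j * xpow (real (Suc n)) (cnj (s j))) = 0" for n
  proof -
    have "(\<lambda>m. (cmod (E m (real (Suc n))))\<^sup>2) \<longlonglongrightarrow> 0"
    proof (rule Lim_null_comparison[OF _ kinv], intro always_eventually allI)
      fix m
      have "(cmod (E m (real (Suc n))))\<^sup>2 \<le> (\<Sum>n. (cmod (E m (real (Suc n))))\<^sup>2)"
        using sum_le_suminf[OF Dl2[of "c (k m)" "J (k m)"], of "{n}"] by (simp add: E_def)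
      then show "norm ((cmod (E m (real (Suc n))))\<^sup>2) \<le> 1 / real (Suc (k m))"
        using small[of "k m"] unfolding E_def by simp
    qed
    moreover have "(\<lambda>m. (cmod (E m (real (Suc n))))\<^sup>2) \<longlonglongrightarrow> (cmod (\<Sum>j. \<gamma> j * r j * xpow (real (Suc n)) (cnj (s j))))\<^sup>2"
      by (intro tendsto_power tendsto_norm Elim) simp
    ultimately have "(cmod (\<Sum>j. \<gamma> j * r j * xpow (real (Suc n)) (cnj (s j))))\<^sup>2 = 0"
      using LIMSEQ_unique by blast
    then show ?thesis by simp
  qed
  have zero: "(\<Sum>j. \<gamma> j * r j * xpow x (cnj (s j))) = 0" for x
  proof (rule exponential_series_zero[where e = "\<lambda>j. \<gamma> j * r j" and s = "\<lambda>j. cnj (s j)" and R = R])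
    show "summable (\<lambda>j. cmod (\<gamma> j * r j))" using l2_mult_summable[OF \<gamma>2 sr] by (simp add: norm_mult)
  qed (use R zero_int in auto)
  have E0: "(\<lambda>m. E m x) \<longlonglongrightarrow> 0" if "x \<ge> 1" for x using Elim[OF that] unfolding zero .
  define T where "T = sqrt (\<Sum>j. (cmod (r j))\<^sup>2)"
  have T0: "T \<ge> 0" unfolding T_def by (intro real_sqrt_ge_zero suminf_nonneg[OF sr]) simp
  have cr: "(\<Sum>j<J m. cmod (c m j) * cmod (r j)) \<le> T" for m
  proof -
    have "(\<Sum>j<J m. cmod (c m j) * cmod (r j)) \<le> sqrt (\<Sum>j<J m. (cmod (c m j))\<^sup>2) * sqrt (\<Sum>j<J m. (cmod (r j))\<^sup>2)"
      by (rule cauchy_schwarz_sum)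
    also have "\<dots> = sqrt (\<Sum>j<J m. (cmod (r j))\<^sup>2)" unfolding unit by simp
    also have "\<dots> \<le> T" unfolding T_def by (intro real_sqrt_le_mono sum_le_suminf sr) auto
    finally show ?thesis .
  qed
  define h where "h m x = ennreal (2 * (indicator {1<..} x * (cmod (E m x - E m (of_int \<lfloor>x\<rfloor>)))\<^sup>2))" for m x
  have Em[measurable]: "E m \<in> borel_measurable lborel" for m
    unfolding E_def dual_sum_def[abs_def] xpow_def by measurable
  let ?w = "\<lambda>x. 8 * T\<^sup>2 * R\<^sup>2 * cmod (indicator {1<..} x *\<^sub>R xpow x 2)"
  have hdom: "h m x \<le> ennreal (?w x)" for m x
  proof (cases "x > 1")
    case True
    define y where "y = real_of_int \<lfloor>x\<rfloor>"
    have y: "1 \<le> y" "y \<le> x" "x \<le> y + 1" "x \<le> 2 * y"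
    proof -
      have "1 \<le> \<lfloor>x\<rfloor>" using True by (simp add: le_floor_iff)
      then show 1: "1 \<le> y" by (simp add: y_def)
      show "y \<le> x" by (simp add: y_def)
      show 2: "x \<le> y + 1" unfolding y_def by linarith
      show "x \<le> 2 * y" using 1 2 by linarith
    qed
    have "cmod (E m x - E m y) = cmod (\<Sum>j<J (k m). c (k m) j * r j * (xpow x (cnj (s j)) - xpow y (cnj (s j))))"
      by (simp add: E_def dual_sum_def sum_subtractf right_diff_distrib)
    also have "\<dots> \<le> (\<Sum>j<J (k m). cmod (c (k m) j) * cmod (r j) * (R / y))"
      unfolding norm_mult[symmetric]
    proof (rule order.trans[OF norm_sum], rule sum_mono)
      fix j
      have "cmod (xpow x (cnj (s j)) - xpow y (cnj (s j))) \<le> R / y"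
        by (rule xpow_increment_bound) (use y s[of j] R[of j] in \<open>auto simp: half_plane_simps\<close>)
      then show "cmod (c (k m) j * r j * (xpow x (cnj (s j)) - xpow y (cnj (s j)))) \<le> cmod (c (k m) j * r j) * (R / y)"
        unfolding norm_mult by (intro mult_left_mono) auto
    qed
    also have "\<dots> \<le> T * (R / y)"
      unfolding sum_distrib_right[symmetric] using y R0 by (intro mult_right_mono cr) auto
    also have "\<dots> \<le> T * (2 * R / x)"
    proof (rule mult_left_mono[OF _ T0])
      have "R * x \<le> R * (2 * y)" by (rule mult_left_mono[OF y(4) R0])
      then show "R / y \<le> 2 * R / x" using y True by (simp add: field_simps)
    qed
    finally have "(cmod (E m x - E m y))\<^sup>2 \<le> (T * (2 * R / x))\<^sup>2" by (rule power_mono) simp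
    also have "\<dots> = 4 * T\<^sup>2 * R\<^sup>2 * (1 / x\<^sup>2)" by (simp add: power_mult_distrib power_divide)
    also have "1 / x\<^sup>2 = cmod (xpow x 2)" using norm_xpow_of_nat[of x 2] True by simp
    finally have "2 * (cmod (E m x - E m y))\<^sup>2 \<le> 8 * T\<^sup>2 * R\<^sup>2 * cmod (xpow x 2)" by linarith
    then show ?thesis using True unfolding h_def y_def by (intro ennreal_leI) simp
  qed (simp add: h_def)
  have hlim: "(\<lambda>m. \<integral>\<^sup>+x. h m x \<partial>lborel) \<longlonglongrightarrow> (\<integral>\<^sup>+x. 0 \<partial>(lborel :: real measure))"
  proof (rule nn_integral_dominated_convergence[where w = "\<lambda>x. ennreal (?w x)"])
    show "h m \<in> borel_measurable lborel" for m unfolding h_def[abs_def] by measurable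
    have i: "integrable lborel (\<lambda>x. ?w x)"
      by (intro integrable_mult_right integrable_norm xpow_integrable) simp
    then show "(\<lambda>x. ennreal (?w x)) \<in> borel_measurable lborel"
      by (intro measurable_compose[OF borel_measurable_integrable measurable_ennreal])
    show "(\<integral>\<^sup>+x. ennreal (?w x) \<partial>lborel) < \<infinity>"
      by (subst nn_integral_eq_integral[OF i]) auto
    show "AE x in lborel. h m x \<le> ennreal (?w x)" for m
      by (rule AE_I2) (rule hdom)
    show "AE x in lborel. (\<lambda>m. h m x) \<longlonglongrightarrow> 0"
    proof (rule AE_I2)
      fix x :: real
      show "(\<lambda>m. h m x) \<longlonglongrightarrow> 0"
      proof (cases "x > 1")
        case True
        then have "1 \<le> real_of_int \<lfloor>x\<rfloor>" by (simp add: le_floor_iff)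
        then have "(\<lambda>m. 2 * (indicator {1<..} x * (cmod (E m x - E m (of_int \<lfloor>x\<rfloor>)))\<^sup>2)) \<longlonglongrightarrow> 2 * (indicator {1<..} x * (cmod (0 - 0))\<^sup>2)"
          using True by (intro tendsto_intros E0) auto
        from tendsto_ennrealI[OF this] show ?thesis by (simp add: h_def)
      qed (simp add: h_def)
    qed
  qed simp
  have main: "ennreal \<delta> \<le> ennreal (2 * (1 / real (Suc (k m)))) + (\<integral>\<^sup>+x. h m x \<partial>lborel)" for m
  proof -
    let ?e = "\<lambda>j. c (k m) j * r j"
    note H = hardy_norm_integral[where s = s and e = ?e and J = "J (k m)", OF s]
    have "ennreal \<delta> \<le> ennreal (\<integral>x. indicator {1<..} x * (cmod (E m x))\<^sup>2 \<partial>lborel)"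
      using hardy[where J = "J (k m)" and c = "c (k m)"] unfolding unit H(2) E_def by (intro ennreal_leI) simp
    also have "\<dots> = (\<integral>\<^sup>+x. ennreal (indicator {1<..} x * (cmod (E m x))\<^sup>2) \<partial>lborel)"
      using H(1) unfolding E_def by (intro nn_integral_eq_integral[symmetric]) auto
    also have "\<dots> \<le> (\<Sum>n. ennreal (2 * (cmod (E m (real (Suc n))))\<^sup>2)) + (\<integral>\<^sup>+x. h m x \<partial>lborel)"
      unfolding h_def by (rule integral_le_sum_plus_oscillation) simp
    also have "(\<Sum>n. ennreal (2 * (cmod (E m (real (Suc n))))\<^sup>2)) = ennreal (\<Sum>n. 2 * (cmod (E m (real (Suc n))))\<^sup>2)"
      unfolding E_def by (rule suminf_ennreal2[OF _ summable_mult[OF Dl2]]) simp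
    also have "(\<Sum>n. 2 * (cmod (E m (real (Suc n))))\<^sup>2) = 2 * (\<Sum>n. (cmod (E m (real (Suc n))))\<^sup>2)"
      unfolding E_def by (rule suminf_mult[OF Dl2])
    also have "ennreal (2 * (\<Sum>n. (cmod (E m (real (Suc n))))\<^sup>2)) \<le> ennreal (2 * (1 / real (Suc (k m))))"
      unfolding E_def by (intro ennreal_leI mult_left_mono small) simp
    finally show ?thesis by (simp add: add_right_mono)
  qed
  have "(\<lambda>m. ennreal (2 * (1 / real (Suc (k m)))) + (\<integral>\<^sup>+x. h m x \<partial>lborel)) \<longlonglongrightarrow> ennreal (2 * 0) + (\<integral>\<^sup>+x. 0 \<partial>(lborel :: real measure))"
    by (intro tendsto_add hlim tendsto_ennrealI tendsto_mult tendsto_const kinv)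
  then have "ennreal \<delta> \<le> ennreal (2 * 0) + (\<integral>\<^sup>+x. 0 \<partial>(lborel :: real measure))"
    by (rule LIMSEQ_le_const) (intro exI allI impI main)
  then show False using \<delta> by simp
qed

section \<open>Comparison of interpolating sequences\<close>

theorem theorem2p1:
  fixes s :: "nat \<Rightarrow> complex"
  assumes "bounded (range s)"
    and "inj s"
    and "range s \<subseteq> half_plane"
  shows "interpolating_sequence half_plane dirichlet_space dirichlet_norm s \<longleftrightarrow>
         interpolating_sequence half_plane hardy_space hardy_norm s"
proof -
  obtain R where R: "\<And>j. cmod (s j) \<le> R" using assms(1) unfolding bounded_iff by auto
  have s: "s j \<in> half_plane" for j using assms(3) by auto
  define d where "d j = 2 * Re (s j) - 1" for j
  have d: "d j > 0" for j using s[of j] by (simp add: d_def half_plane_simps)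
  have d2: "d j + 1 \<le> 2 * R" for j using abs_Re_le_cmod[of "s j"] R[of j] by (simp add: d_def)
  have R0: "R \<ge> 0" using R[of 0] norm_ge_zero[of "s 0"] by linarith
  define K where "K j = (dirichlet_norm (dirichlet_kernel (s j)))\<^sup>2" for j
  have K: "1 / d j \<le> K j" "K j \<le> 1 + 1 / d j" for j
    using dirichlet_kernel_norm[OF s] unfolding K_def d_def by auto
  have K0: "K j > 0" for j using K(1)[of j] d[of j] by (meson divide_pos_pos less_le_trans zero_less_one)
  have dir_iff: "interpolating_sequence half_plane dirichlet_space dirichlet_norm s \<longleftrightarrow>
    (\<forall>a. summable (\<lambda>j. (cmod (a j))\<^sup>2 / K j) \<longrightarrow> (\<exists>f\<in>dirichlet_space. \<forall>j. f (s j) = a j))"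
    unfolding interpolating_sequence_def dirichlet.reproducing_kernel_eq[OF s] power_divide K_def
    using assms by simp
  have hardy_iff: "interpolating_sequence half_plane hardy_space hardy_norm s \<longleftrightarrow>
    (\<forall>a. summable (\<lambda>j. (cmod (a j))\<^sup>2 * d j) \<longrightarrow> (\<exists>f\<in>hardy_space. \<forall>j. f (s j) = a j))"
    unfolding d_def by (rule interpolating_hardy_iff[OF assms(2,3)])
  show ?thesis
  proof
    assume dir: "interpolating_sequence half_plane dirichlet_space dirichlet_norm s"
    show "interpolating_sequence half_plane hardy_space hardy_norm s"
      unfolding hardy_iff
    proof (intro allI impI)
      fix a :: "nat \<Rightarrow> complex" assume a: "summable (\<lambda>j. (cmod (a j))\<^sup>2 * d j)"
      have "summable (\<lambda>j. (cmod (a j * (s j + 1)))\<^sup>2 / K j)"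
      proof (rule summable_comparison_test'[where N = 0, OF summable_mult[OF a, of "(R + 1)\<^sup>2"]])
        fix j :: nat
        have "cmod (s j + 1) \<le> R + 1" using norm_triangle_ineq[of "s j" 1] R[of j] by simp
        then have 1: "(cmod (s j + 1))\<^sup>2 \<le> (R + 1)\<^sup>2" by (rule power_mono) simp
        have 2: "1 / K j \<le> d j" using K(1)[of j] K0[of j] d[of j] by (simp add: field_simps)
        have "(cmod (a j * (s j + 1)))\<^sup>2 / K j = (cmod (a j))\<^sup>2 * ((cmod (s j + 1))\<^sup>2 * (1 / K j))"
          by (simp add: norm_mult power_mult_distrib)
        also have "\<dots> \<le> (cmod (a j))\<^sup>2 * ((R + 1)\<^sup>2 * d j)"
          using 1 2 K0[of j] by (intro mult_left_mono mult_mono) auto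
        finally have "(cmod (a j * (s j + 1)))\<^sup>2 / K j \<le> (R + 1)\<^sup>2 * ((cmod (a j))\<^sup>2 * d j)" by (simp add: mult_ac)
        then show "norm ((cmod (a j * (s j + 1)))\<^sup>2 / K j) \<le> (R + 1)\<^sup>2 * ((cmod (a j))\<^sup>2 * d j)"
          using K0[of j] by simp
      qed
      then obtain f where f: "f \<in> dirichlet_space" "\<forall>j. f (s j) = a j * (s j + 1)"
        using dir[unfolded dir_iff, THEN spec[of _ "\<lambda>j. a j * (s j + 1)"]] by blast
      have "s j + 1 \<noteq> 0" for j using s[of j] by (auto simp: half_plane_simps complex_eq_iff)
      then have "\<forall>j. f (s j) / (s j + 1) = a j" using f(2) by simp
      then show "\<exists>f\<in>hardy_space. \<forall>j. f (s j) = a j"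
        by (intro bexI[OF _ dirichlet_embedding[OF f(1)]])
    qed
  next
    assume hardy: "interpolating_sequence half_plane hardy_space hardy_norm s"
    let ?r = "\<lambda>j. complex_of_real (sqrt (2 * Re (s j) - 1))"
    \<comment> \<open>the function that proves the Blaschke condition\<close>
    have "summable (\<lambda>j. (cmod (if j = 0 then 1 else 0 :: complex))\<^sup>2 * d j)"
      by (rule summable_finite[of "{0}"]) auto
    then obtain F where F: "F \<in> hardy_space" "\<forall>j. F (s j) = (if j = 0 then 1 else 0)"
      using hardy[unfolded hardy_iff, THEN spec[of _ "\<lambda>j. if j = 0 then 1 else 0"]] by blast
    have bl: "summable (\<lambda>j. 2 * Re (s j) - 1)"
      by (rule blaschke_condition[OF assms(1,2) s F(1)]) (use F(2) in auto)
    from hardy_lower_bound[OF assms(2,3) hardy]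
    obtain \<delta> where \<delta>: "\<delta> > 0" "\<forall>J c. \<delta> * (\<Sum>j<J. (cmod (c j))\<^sup>2) \<le>
      (hardy_norm (\<lambda>z. \<Sum>j<J. (c j * ?r j) * hardy_kernel (s j) z))\<^sup>2"
      by (elim exE conjE)
    from dirichlet_lower_bound[OF s R bl \<delta>(1) \<delta>(2)[rule_format]]
    obtain \<epsilon> where \<epsilon>: "\<epsilon> > 0"
      "\<forall>J c. \<epsilon> * (\<Sum>j<J. (cmod (c j))\<^sup>2) \<le> (\<Sum>n. (cmod (dual_sum s (\<lambda>j. c j * ?r j) J (real (Suc n))))\<^sup>2)"
      by (elim exE conjE)
    define v where "v j n = ?r j * xpow (real (Suc n)) (cnj (s j))" for j n
    have v: "summable (\<lambda>n. (cmod (v j n))\<^sup>2)" for j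
    proof -
      have "summable (\<lambda>n. (cmod (?r j))\<^sup>2 * (cmod (xpow (real (Suc n)) (cnj (s j))))\<^sup>2)"
        by (intro summable_mult xpow_l2) (use s[of j] in \<open>simp add: half_plane_simps\<close>)
      then show ?thesis by (simp only: v_def norm_mult power_mult_distrib)
    qed
    have lower: "\<epsilon> * (\<Sum>j<m. (cmod (c j))\<^sup>2) \<le> (\<Sum>n. (cmod (\<Sum>j<m. c j * v j n))\<^sup>2)" for m c
      using \<epsilon>(2)[THEN spec[of _ m], THEN spec[of _ c]] unfolding dual_sum_def v_def mult.assoc .
    show "interpolating_sequence half_plane dirichlet_space dirichlet_norm s"
      unfolding dir_iff
    proof (intro allI impI)
      fix a :: "nat \<Rightarrow> complex" assume a: "summable (\<lambda>j. (cmod (a j))\<^sup>2 / K j)"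
      have "summable (\<lambda>j. (cmod (?r j * a j))\<^sup>2)"
      proof (rule summable_comparison_test'[where N = 0, OF summable_mult[OF a, of "2 * R"]])
        fix j :: nat
        have "d j * K j \<le> d j * (1 + 1 / d j)" using K(2)[of j] d[of j] by (intro mult_left_mono) auto
        also have "\<dots> = d j + 1" using d[of j] by (simp add: field_simps)
        also have "\<dots> \<le> 2 * R" by (rule d2)
        finally have dK: "d j \<le> 2 * R / K j" using K0[of j] by (simp add: pos_le_divide_eq)
        have "(cmod (?r j))\<^sup>2 = d j" using d[of j] by (simp add: d_def)
        then have "(cmod (?r j * a j))\<^sup>2 = d j * (cmod (a j))\<^sup>2" by (simp only: norm_mult power_mult_distrib)
        also have "\<dots> \<le> 2 * R / K j * (cmod (a j))\<^sup>2" by (rule mult_right_mono[OF dK]) simp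
        finally show "norm ((cmod (?r j * a j))\<^sup>2) \<le> 2 * R * ((cmod (a j))\<^sup>2 / K j)" by simp
      qed
      from l2_interpolation[where v = v, OF v \<epsilon>(1) lower this]
      obtain \<alpha> where \<alpha>: "summable (\<lambda>n. (cmod (\<alpha> n))\<^sup>2)" "\<And>j. (\<Sum>n. \<alpha> n * cnj (v j n)) = ?r j * a j" by blast
      define f where "f z = (if z \<in> half_plane then \<Sum>n. \<alpha> n * xpow (real (Suc n)) z else 0)" for z
      have sums: "(\<lambda>n. \<alpha> n * xpow (real (Suc n)) z) sums f z" if "z \<in> half_plane" for z
        using that summable_norm_cancel[OF dirichlet_abs_summable[OF \<alpha>(1), of z]]
        by (simp only: f_def if_True half_plane_simps(3) summable_sums)
      have "has_dirichlet_coeffs f \<alpha>" unfolding has_dirichlet_coeffs_xpow using \<alpha>(1) sums by blast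
      then have "f \<in> dirichlet_space" unfolding mem_dirichlet_space by (auto simp: f_def)
      moreover have "f (s j) = a j" for j
      proof -
        have "?r j * a j = (\<Sum>n. ?r j * (\<alpha> n * xpow (real (Suc n)) (s j)))"
          unfolding \<alpha>(2)[symmetric] v_def by (simp add: cnj_xpow mult_ac)
        also have "\<dots> = ?r j * f (s j)"
          using sums_mult[OF sums[OF s[of j]], of "?r j"] by (rule sums_unique[symmetric])
        finally have "?r j * a j = ?r j * f (s j)" .
        moreover have "?r j \<noteq> 0" using d[of j] by (simp add: d_def)
        ultimately show ?thesis by simp
      qed
      ultimately show "\<exists>f\<in>dirichlet_space. \<forall>j. f (s j) = a j" by blast
    qed
  qed
qed

end
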